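(* Let $M$ be a smooth $n$-manifold, $V$ a rank $n$ real vector bundle on $M$ with a flat connection $\nabla$, and let $\mathcal{J}=F^{-1}(\pi^*\underline{\mathcal{J}})F$ be a $\nabla$-semi-flat generalized almost complex structure on $X=\mathrm{tot}(V)$. Then $\mathcal{J}$ is integrable if and only if the mirror generalized almost complex structure $\widehat{\mathcal{J}}=\widehat F^{-1}(\hat\pi^*\widehat{\underline{\mathcal{J}}})\widehat F$ on $\widehat X=\mathrm{tot}(V^\vee)$ is integrable.
   Context: On $W\oplus W^\vee$ ($W$ a real vector bundle) use the pairing $\langle v+f,w+g\rangle=-\tfrac12(f(w)+g(v))$. A generalized almost complex structure on $W$ is an automorphism $\mathcal{J}$ of $W\oplus W^\vee$ which is orthogonal for this pairing and satisfies $\mathcal{J}^2=-1$. A generalized almost complex structure on a manifold $N$ is one on $W=T_N$. The Courant bracket is $[X+\xi,Y+\eta]=[X,Y]+\mathcal{L}_X\eta-\mathcal{L}_Y\xi+\tfrac12 d(\iota_Y\xi-\iota_X\eta)$. A generalized almost complex structure on $N$ is integrable if the sheaf of sections of its $(+i)$-eigenbundle in $(T_N\oplus T_N^\vee)\otimes\mathbb{C}$ is closed under the ($\mathbb{C}$-bilinearly extended) Courant bracket. Let $\pi:X=\mathrm{tot}(V)\to M$, and let $0\to\pi^*V\xrightarrow{j}T_X\xrightarrow{d\pi}\pi^*T_M\to0$ be the tangent sequence. A connection $\nabla$ on $V$ gives a splitting: if $S$ is the tautological section of $\pi^*V$, then $D=(\pi^*\nabla)(S):T_X\to\pi^*V$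 satisfies $D\circ j=1$; let $\alpha:\pi^*T_M\to T_X$ be the corresponding map with $d\pi\circ\alpha=1$, $D\circ\alpha=0$. Set $$F:T_X\oplus T_X^\vee\to\pi^*V\oplus\pi^*T_M\oplus\pi^*V^\vee\oplus\pi^*T_M^\vee,\quad F(w+\xi)=(Dw,\ d\pi\,w,\ j^\vee\xi,\ \alpha^\vee\xi),$$ an isomorphism. When $\mathrm{rank}\,V=\dim M$ and $\nabla$ is flat, a $\nabla$-semi-flat generalized almost complex structure on $X$ is one of the form $\mathcal{J}=F^{-1}(\pi^*\underline{\mathcal{J}})F$ with $\underline{\mathcal{J}}$ a generalized almost complex structure on $V\oplus T_M$ that is adapted: $\underline{\mathcal{J}}(V\oplus V^\vee)=T_M\oplus T_M^\vee$. Mirror: let $\hat\pi:\widehat X=\mathrm{tot}(V^\vee)\to M$, and let $\widehat F:T_{\widehat X}\oplus T_{\widehat X}^\vee\to\hat\pi^*V^\vee\oplus\hat\pi^*T_M\oplus\hat\pi^*V\oplus\hat\pi^*T_M^\vee$ be the isomorphism obtained by the same construction from $(V^\vee,\nabla^\vee)$, where $\nabla^\vee$ is the dual connection. Put $\widehat{\underline{\mathcal{J}}}=\tau\underline{\mathcal{J}}\tau^{-1}$, where $\tau:V\oplus T_M\oplus V^\vee\oplus T_M^\vee\to V^\vee\oplus T_M\oplus V\oplus T_M^\vee$ interchanges the summands $V$ and $V^\vee$. *)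

theory Defs
  imports "HOL-Analysis.Analysis" "HOL-Library.Function_Algebras"
begin

text \<open>
  Tangent vectors, covectors and elements of dual fibres are real-valued functions on
  suitable types; functions into a real vector space form a real vector space pointwise.
\<close>

instantiation "fun" :: (type, real_vector) real_vector
begin

definition scaleR_fun :: "real \<Rightarrow> ('a \<Rightarrow> 'b) \<Rightarrow> 'a \<Rightarrow> 'b" where
  "scaleR_fun c f = (\<lambda>x. c *\<^sub>R f x)"

instance
  by standard (auto simp: scaleR_fun_def fun_eq_iff scaleR_add_right scaleR_add_left)

end


section \<open>Smooth manifolds\<close>

primrec Ck_on :: "nat \<Rightarrow> 'a::real_normed_vector set \<Rightarrow> ('a \<Rightarrow> 'b::real_normed_vector) \<Rightarrow> bool" where
  "Ck_on 0 S f \<longleftrightarrow> continuous_on S f"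
| "Ck_on (Suc k) S f \<longleftrightarrow>
     (\<forall>x\<in>S. f differentiable (at x)) \<and> (\<forall>v. Ck_on k S (\<lambda>x. frechet_derivative f (at x) v))"

text \<open>Intended for open \<open>S\<close> only.\<close>

definition smooth_on :: "'a::real_normed_vector set \<Rightarrow> ('a \<Rightarrow> 'b::real_normed_vector) \<Rightarrow> bool" where
  "smooth_on S f \<longleftrightarrow> (\<forall>k. Ck_on k S f)"

text \<open>
  A manifold is given by an atlas. A chart is a pair \<open>(U, \<phi>)\<close> of a domain and a map that is
  relevant on \<open>U\<close> only. The underlying set is the union of the chart domains, and it carries the
  topology for which the charts are homeomorphisms onto their images.
\<close>

type_synonym ('a, 'e) atlas = "('a set \<times> ('a \<Rightarrow> 'e)) set"

definition carrier :: "('a, 'e) atlas \<Rightarrow> 'a set" where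
  "carrier M = (\<Union>(U, \<phi>)\<in>M. U)"

definition atlas_topology :: "('a, 'e::euclidean_space) atlas \<Rightarrow> 'a topology" where
  "atlas_topology M = topology (\<lambda>W. W \<subseteq> carrier M \<and> (\<forall>(U, \<phi>)\<in>M. open (\<phi> ` (W \<inter> U))))"

definition smooth_manifold :: "('a, 'e::euclidean_space) atlas \<Rightarrow> bool" where
  "smooth_manifold M \<longleftrightarrow>
     (\<forall>(U, \<phi>)\<in>M. inj_on \<phi> U \<and> open (\<phi> ` U)) \<and>
     (\<forall>(U, \<phi>)\<in>M. \<forall>(W, \<psi>)\<in>M.
        open (\<phi> ` (U \<inter> W)) \<and> smooth_on (\<phi> ` (U \<inter> W)) (\<psi> \<circ> inv_into U \<phi>)) \<and>
     Hausdorff_space (atlas_topology M) \<and> second_countable (atlas_topology M)"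

lemma openin_atlas_topology:
  assumes "smooth_manifold M"
  shows "openin (atlas_topology M) W \<longleftrightarrow>
           W \<subseteq> carrier M \<and> (\<forall>(U, \<phi>)\<in>M. open (\<phi> ` (W \<inter> U)))"
proof -
  let ?L = "\<lambda>W. W \<subseteq> carrier M \<and> (\<forall>(U, \<phi>)\<in>M. open (\<phi> ` (W \<inter> U)))"
  have "?L (S \<inter> T)" if "?L S" "?L T" for S T
  proof -
    have "open (\<phi> ` (S \<inter> T \<inter> U))" if c: "(U, \<phi>) \<in> M" for U \<phi>
    proof -
      have "inj_on \<phi> U"
        using assms c by (auto simp: smooth_manifold_def)
      then have "\<phi> ` (S \<inter> T \<inter> U) = \<phi> ` (S \<inter> U) \<inter> \<phi> ` (T \<inter> U)"
        unfolding inj_on_def by auto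
      moreover have "open (\<phi> ` (S \<inter> U))" "open (\<phi> ` (T \<inter> U))"
        using \<open>?L S\<close> \<open>?L T\<close> c by auto
      ultimately show ?thesis
        by auto
    qed
    then show ?thesis
      using that by auto
  qed
  moreover have "?L (\<Union>K)" if "\<forall>S\<in>K. ?L S" for K
  proof -
    have "open (\<phi> ` (\<Union>K \<inter> U))" if c: "(U, \<phi>) \<in> M" for U \<phi>
    proof -
      have "\<phi> ` (\<Union>K \<inter> U) = (\<Union>S\<in>K. \<phi> ` (S \<inter> U))"
        by auto
      moreover have "open (\<phi> ` (S \<inter> U))" if "S \<in> K" for S
        using \<open>\<forall>S\<in>K. ?L S\<close> c that by auto
      ultimately show ?thesis
        by auto
    qed
    then show ?thesis
      using that by auto
  qed
  ultimately have "istopology ?L"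
    unfolding istopology_def by blast
  then show ?thesis
    by (simp add: atlas_topology_def)
qed

definition smooth_fun ::
    "('a, 'e::euclidean_space) atlas \<Rightarrow> 'a set \<Rightarrow> ('a \<Rightarrow> 'b::real_normed_vector) \<Rightarrow> bool" where
  "smooth_fun M W f \<longleftrightarrow> openin (atlas_topology M) W \<and>
     (\<forall>(U, \<phi>)\<in>M. smooth_on (\<phi> ` (U \<inter> W)) (f \<circ> inv_into U \<phi>))"

definition smooth_near ::
    "('a, 'e::euclidean_space) atlas \<Rightarrow> 'a \<Rightarrow> ('a \<Rightarrow> 'b::real_normed_vector) \<Rightarrow> bool" where
  "smooth_near M p f \<longleftrightarrow> (\<exists>W. p \<in> W \<and> smooth_fun M W f)"


section \<open>Vector bundles\<close>

text \<open>
  The fibre of a bundle over \<open>x\<close> is a linear subspace \<open>fib V x\<close> of an ambient vector space,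
  which is no restriction: any family of vector spaces embeds into its direct sum. Fibres over
  different points need not be disjoint; the total space is \<open>Sigma (carrier M) (fib V)\<close>.
  The smooth structure is given by local trivializations \<open>(U, e)\<close>, where for \<open>x \<in> U\<close> the map
  \<open>e x\<close> is a linear isomorphism from the model fibre onto the fibre over \<open>x\<close>.
\<close>

record ('a, 'v, 'f) vbundle =
  fib :: "'a \<Rightarrow> 'v set"
  triv :: "('a set \<times> ('a \<Rightarrow> 'f \<Rightarrow> 'v)) set"

definition vector_bundle ::
    "('a, 'e::euclidean_space) atlas \<Rightarrow> ('a, 'v::real_vector, 'f::euclidean_space) vbundle \<Rightarrow> bool" where
  "vector_bundle M V \<longleftrightarrow>
     (\<Union>(U, e)\<in>triv V. U) = carrier M \<and>
     (\<forall>(U, e)\<in>triv V. openin (atlas_topology M) U \<and>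
        (\<forall>x\<in>U. linear (e x) \<and> inj (e x) \<and> range (e x) = fib V x)) \<and>
     (\<forall>(U, e)\<in>triv V. \<forall>(W, d)\<in>triv V. \<forall>u. smooth_fun M (U \<inter> W) (\<lambda>x. inv (d x) (e x u)))"

definition smooth_section ::
    "('a, 'e::euclidean_space) atlas \<Rightarrow> ('a, 'v::real_vector, 'f::euclidean_space) vbundle \<Rightarrow>
     'a set \<Rightarrow> ('a \<Rightarrow> 'v) \<Rightarrow> bool" where
  "smooth_section M V W s \<longleftrightarrow> openin (atlas_topology M) W \<and> (\<forall>x\<in>W. s x \<in> fib V x) \<and>
     (\<forall>(U, e)\<in>triv V. smooth_fun M (U \<inter> W) (\<lambda>x. inv (e x) (s x)))"

definition smooth_section_near ::
    "('a, 'e::euclidean_space) atlas \<Rightarrow> ('a, 'v::real_vector, 'f::euclidean_space) vbundle \<Rightarrow>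
     'a \<Rightarrow> ('a \<Rightarrow> 'v) \<Rightarrow> bool" where
  "smooth_section_near M V x s \<longleftrightarrow> (\<exists>W. x \<in> W \<and> smooth_section M V W s)"

text \<open>
  Linear functionals on a subspace are extended by zero, so that they are determined by
  their values on the subspace.
\<close>

definition dual_space :: "'v::real_vector set \<Rightarrow> ('v \<Rightarrow> real) set" where
  "dual_space S = {f. (\<forall>u\<in>S. \<forall>v\<in>S. f (u + v) = f u + f v) \<and>
                      (\<forall>c. \<forall>u\<in>S. f (c *\<^sub>R u) = c * f u) \<and> (\<forall>u. u \<notin> S \<longrightarrow> f u = 0)}"

definition dual_bundle ::
    "('a, 'v::real_vector, 'f::euclidean_space) vbundle \<Rightarrow> ('a, 'v \<Rightarrow> real, 'f) vbundle" where
  "dual_bundle V =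
     \<lparr>fib = (\<lambda>x. dual_space (fib V x)),
      triv = (\<lambda>(U, e). (U, \<lambda>x u v. if v \<in> fib V x then u \<bullet> inv (e x) v else 0)) ` triv V\<rparr>"

definition sum_bundle ::
    "('a, 'v::real_vector, 'f::euclidean_space) vbundle \<Rightarrow>
     ('a, 'w::real_vector, 'g::euclidean_space) vbundle \<Rightarrow> ('a, 'v \<times> 'w, 'f \<times> 'g) vbundle" where
  "sum_bundle V W =
     \<lparr>fib = (\<lambda>x. fib V x \<times> fib W x),
      triv = (\<lambda>((U, e), (U', e')). (U \<inter> U', \<lambda>x (u, u'). (e x u, e' x u'))) ` (triv V \<times> triv W)\<rparr>"

definition total_space ::
    "('a, 'e::euclidean_space) atlas \<Rightarrow> ('a, 'v::real_vector, 'f::euclidean_space) vbundle \<Rightarrow>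
     ('a \<times> 'v, 'e \<times> 'f) atlas" where
  "total_space M V =
     (\<lambda>((U, \<phi>), (W, e)). (Sigma (U \<inter> W) (fib V), \<lambda>(x, v). (\<phi> x, inv (e x) v))) ` (M \<times> triv V)"


section \<open>Tangent bundle\<close>

text \<open>
  A tangent vector at \<open>p\<close> is a directional derivative \<open>f \<mapsto> D(f \<circ> \<phi>\<^sup>-\<^sup>1)(\<phi> p) u\<close> acting on germs
  at \<open>p\<close> of smooth functions, extended by zero to functions that are not smooth near \<open>p\<close>.
\<close>

type_synonym 'a tvec = "('a \<Rightarrow> real) \<Rightarrow> real"

definition dir_deriv ::
    "('a, 'e::euclidean_space) atlas \<Rightarrow> 'a set \<times> ('a \<Rightarrow> 'e) \<Rightarrow> 'a \<Rightarrow> 'e \<Rightarrow> 'a tvec" where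
  "dir_deriv M = (\<lambda>(U, \<phi>) p u f.
     if smooth_near M p f then frechet_derivative (f \<circ> inv_into U \<phi>) (at (\<phi> p)) u else 0)"

definition tangent_bundle ::
    "('a, 'e::euclidean_space) atlas \<Rightarrow> ('a, 'a tvec, 'e) vbundle" where
  "tangent_bundle M =
     \<lparr>fib = (\<lambda>p. {dir_deriv M (U, \<phi>) p u | U \<phi> u. (U, \<phi>) \<in> M \<and> p \<in> U}),
      triv = (\<lambda>(U, \<phi>). (U, dir_deriv M (U, \<phi>))) ` M\<rparr>"

abbreviation tangent_space :: "('a, 'e::euclidean_space) atlas \<Rightarrow> 'a \<Rightarrow> 'a tvec set" where
  "tangent_space M p \<equiv> fib (tangent_bundle M) p"

definition differential ::
    "('b, 'g::euclidean_space) atlas \<Rightarrow> ('a \<Rightarrow> 'b) \<Rightarrow> 'a \<Rightarrow> 'a tvec \<Rightarrow> 'b tvec" where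
  "differential N h p w = (\<lambda>g. if smooth_near N (h p) g then w (g \<circ> h) else 0)"

definition lie_bracket ::
    "('a, 'e::euclidean_space) atlas \<Rightarrow> ('a \<Rightarrow> 'a tvec) \<Rightarrow> ('a \<Rightarrow> 'a tvec) \<Rightarrow> 'a \<Rightarrow> 'a tvec" where
  "lie_bracket M X Y p = (\<lambda>f.
     if smooth_near M p f then X p (\<lambda>q. Y q f) - Y p (\<lambda>q. X q f) else 0)"

text \<open>\<open>(L\<^sub>X \<eta>)(Y) = X(\<eta>(Y)) - \<eta>([X,Y])\<close>, which at \<open>p\<close> depends on \<open>Y\<close> only through \<open>Y p\<close>.\<close>

definition lie_derivative ::
    "('a, 'e::euclidean_space) atlas \<Rightarrow> ('a \<Rightarrow> 'a tvec) \<Rightarrow> ('a \<Rightarrow> 'a tvec \<Rightarrow> real) \<Rightarrow>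
     'a \<Rightarrow> 'a tvec \<Rightarrow> real" where
  "lie_derivative M X \<eta> p v =
     (if v \<in> tangent_space M p then
        (THE r. \<forall>Y. smooth_section_near M (tangent_bundle M) p Y \<and> Y p = v \<longrightarrow>
           r = X p (\<lambda>q. \<eta> q (Y q)) - \<eta> p (lie_bracket M X Y p))
      else 0)"

definition ext_deriv ::
    "('a, 'e::euclidean_space) atlas \<Rightarrow> ('a \<Rightarrow> real) \<Rightarrow> 'a \<Rightarrow> 'a tvec \<Rightarrow> real" where
  "ext_deriv M f p v = (if v \<in> tangent_space M p then v f else 0)"


section \<open>Generalized almost complex structures\<close>

abbreviation double_bundle ::
    "('a, 'w::real_vector, 'f::euclidean_space) vbundle \<Rightarrow> ('a, 'w \<times> ('w \<Rightarrow> real), 'f \<times> 'f) vbundle" where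
  "double_bundle W \<equiv> sum_bundle W (dual_bundle W)"

definition pairing :: "'w \<times> ('w \<Rightarrow> real) \<Rightarrow> 'w \<times> ('w \<Rightarrow> real) \<Rightarrow> real" where
  "pairing = (\<lambda>(v, f) (w, g). - (1/2) * (f w + g v))"

definition generalized_acs ::
    "('a, 'e::euclidean_space) atlas \<Rightarrow> ('a, 'w::real_vector, 'f::euclidean_space) vbundle \<Rightarrow>
     ('a \<Rightarrow> 'w \<times> ('w \<Rightarrow> real) \<Rightarrow> 'w \<times> ('w \<Rightarrow> real)) \<Rightarrow> bool" where
  "generalized_acs M W J \<longleftrightarrow>
     (\<forall>x\<in>carrier M. let E = fib (double_bundle W) x in
        bij_betw (J x) E E \<and>
        (\<forall>a\<in>E. \<forall>b\<in>E. J x (a + b) = J x a + J x b) \<and>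
        (\<forall>c. \<forall>a\<in>E. J x (c *\<^sub>R a) = c *\<^sub>R J x a) \<and>
        (\<forall>a\<in>E. \<forall>b\<in>E. pairing (J x a) (J x b) = pairing a b) \<and>
        (\<forall>a\<in>E. J x (J x a) = - a)) \<and>
     (\<forall>O' s. smooth_section M (double_bundle W) O' s \<longrightarrow>
        smooth_section M (double_bundle W) O' (\<lambda>x. J x (s x)))"

type_synonym 'a gtvec = "'a tvec \<times> ('a tvec \<Rightarrow> real)"

text \<open>\<open>[X + \<xi>, Y + \<eta>] = [X,Y] + L\<^sub>X \<eta> - L\<^sub>Y \<xi> + 1/2 d(\<xi>(Y) - \<eta>(X))\<close>\<close>

definition courant ::
    "('a, 'e::euclidean_space) atlas \<Rightarrow> ('a \<Rightarrow> 'a gtvec) \<Rightarrow> ('a \<Rightarrow> 'a gtvec) \<Rightarrow> 'a \<Rightarrow> 'a gtvec" where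
  "courant M s t p =
     (let X = fst \<circ> s; \<xi> = snd \<circ> s; Y = fst \<circ> t; \<eta> = snd \<circ> t in
       (lie_bracket M X Y p,
        lie_derivative M X \<eta> p - lie_derivative M Y \<xi> p
          + (1/2) *\<^sub>R ext_deriv M (\<lambda>q. \<xi> q (Y q) - \<eta> q (X q)) p))"

text \<open>
  An element \<open>a + \<i> b\<close> of the complexification of a real vector space is represented by the
  pair \<open>(a, b)\<close>.
\<close>

definition courant_complex ::
    "('a, 'e::euclidean_space) atlas \<Rightarrow> ('a \<Rightarrow> 'a gtvec \<times> 'a gtvec) \<Rightarrow>
     ('a \<Rightarrow> 'a gtvec \<times> 'a gtvec) \<Rightarrow> 'a \<Rightarrow> 'a gtvec \<times> 'a gtvec" where
  "courant_complex M s t p =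
     (let a = fst \<circ> s; b = snd \<circ> s; c = fst \<circ> t; d = snd \<circ> t in
       (courant M a c p - courant M b d p, courant M a d p + courant M b c p))"

text \<open>Smooth sections over \<open>O'\<close> of the \<open>(+\<i>)\<close>-eigenbundle: \<open>J (a + \<i> b) = \<i> (a + \<i> b)\<close>.\<close>

definition eigen_section ::
    "('a, 'e::euclidean_space) atlas \<Rightarrow> ('a \<Rightarrow> 'a gtvec \<Rightarrow> 'a gtvec) \<Rightarrow>
     'a set \<Rightarrow> ('a \<Rightarrow> 'a gtvec \<times> 'a gtvec) \<Rightarrow> bool" where
  "eigen_section M J O' s \<longleftrightarrow>
     smooth_section M (double_bundle (tangent_bundle M)) O' (fst \<circ> s) \<and>
     smooth_section M (double_bundle (tangent_bundle M)) O' (snd \<circ> s) \<and>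
     (\<forall>x\<in>O'. (J x (fst (s x)), J x (snd (s x))) = (- snd (s x), fst (s x)))"

definition integrable_gacs ::
    "('a, 'e::euclidean_space) atlas \<Rightarrow> ('a \<Rightarrow> 'a gtvec \<Rightarrow> 'a gtvec) \<Rightarrow> bool" where
  "integrable_gacs M J \<longleftrightarrow>
     (\<forall>O' s t. eigen_section M J O' s \<and> eigen_section M J O' t \<longrightarrow>
        eigen_section M J O' (courant_complex M s t))"


section \<open>Connections\<close>

text \<open>
  \<open>D x v s\<close> is the covariant derivative of the (germ at \<open>x\<close> of a) section \<open>s\<close> along the tangent
  vector \<open>v\<close> at \<open>x\<close>.
\<close>

type_synonym ('a, 'v) conn = "'a \<Rightarrow> 'a tvec \<Rightarrow> ('a \<Rightarrow> 'v) \<Rightarrow> 'v"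

definition connection ::
    "('a, 'e::euclidean_space) atlas \<Rightarrow> ('a, 'v::real_vector, 'f::euclidean_space) vbundle \<Rightarrow>
     ('a, 'v) conn \<Rightarrow> bool" where
  "connection M V D \<longleftrightarrow>
     (\<forall>x\<in>carrier M. \<forall>s. smooth_section_near M V x s \<longrightarrow>
        (\<forall>v\<in>tangent_space M x. D x v s \<in> fib V x) \<and>
        (\<forall>v\<in>tangent_space M x. \<forall>w\<in>tangent_space M x. D x (v + w) s = D x v s + D x w s) \<and>
        (\<forall>c. \<forall>v\<in>tangent_space M x. D x (c *\<^sub>R v) s = c *\<^sub>R D x v s) \<and>
        (\<forall>v\<in>tangent_space M x. \<forall>t. smooth_section_near M V x t \<longrightarrow>
           D x v (\<lambda>y. s y + t y) = D x v s + D x v t) \<and>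
        (\<forall>v\<in>tangent_space M x. \<forall>f. smooth_near M x f \<longrightarrow>
           D x v (\<lambda>y. f y *\<^sub>R s y) = v f *\<^sub>R s x + f x *\<^sub>R D x v s) \<and>
        (\<forall>v\<in>tangent_space M x. \<forall>t W. openin (atlas_topology M) W \<and> x \<in> W \<and> (\<forall>y\<in>W. t y = s y) \<longrightarrow>
           D x v t = D x v s)) \<and>
     (\<forall>W X s. smooth_section M (tangent_bundle M) W X \<and> smooth_section M V W s \<longrightarrow>
        smooth_section M V W (\<lambda>x. D x (X x) s))"

definition flat ::
    "('a, 'e::euclidean_space) atlas \<Rightarrow> ('a, 'v::real_vector, 'f::euclidean_space) vbundle \<Rightarrow>
     ('a, 'v) conn \<Rightarrow> bool" where
  "flat M V D \<longleftrightarrow>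
     (\<forall>W X Y s. smooth_section M (tangent_bundle M) W X \<and> smooth_section M (tangent_bundle M) W Y \<and>
        smooth_section M V W s \<longrightarrow>
        (\<forall>x\<in>W. D x (X x) (\<lambda>y. D y (Y y) s) - D x (Y x) (\<lambda>y. D y (X y) s)
                 - D x (lie_bracket M X Y x) s = 0))"

text \<open>\<open>(D\<^sub>v\<^sup>* \<phi>)(s) = v(\<phi>(s)) - \<phi>(D\<^sub>v s)\<close>, which at \<open>x\<close> depends on \<open>s\<close> only through \<open>s x\<close>.\<close>

definition dual_connection ::
    "('a, 'e::euclidean_space) atlas \<Rightarrow> ('a, 'v::real_vector, 'f::euclidean_space) vbundle \<Rightarrow>
     ('a, 'v) conn \<Rightarrow> ('a, 'v \<Rightarrow> real) conn" where
  "dual_connection M V D x v \<phi> = (\<lambda>u.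
     if u \<in> fib V x then
       (THE r. \<forall>s. smooth_section_near M V x s \<and> s x = u \<longrightarrow>
          r = v (\<lambda>y. \<phi> y (s y)) - \<phi> x (D x v s))
     else 0)"

text \<open>
  The connection \<open>h\<^sup>*D\<close> on the pullback of \<open>V\<close> along \<open>h\<close>, characterised by
  \<open>(h\<^sup>*D)\<^sub>w (s \<circ> h) = D\<^bsub>dh(w)\<^esub> s\<close>, in terms of the components of a section of the pullback
  (a map \<open>s\<close> with \<open>s p \<in> fib V (h p)\<close>) with respect to a local frame \<open>e _ b\<close> of \<open>V\<close>. The value
  does not depend on the frame.
\<close>

definition pullback_connection ::
    "('b, 'g::euclidean_space) atlas \<Rightarrow> ('b, 'v::real_vector, 'f::euclidean_space) vbundle \<Rightarrow>
     ('b, 'v) conn \<Rightarrow> ('a \<Rightarrow> 'b) \<Rightarrow> 'a \<Rightarrow> 'a tvec \<Rightarrow> ('a \<Rightarrow> 'v) \<Rightarrow> 'v" where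
  "pullback_connection M V D h p w s =
     (THE d. \<forall>(U, e)\<in>triv V. h p \<in> U \<longrightarrow>
        (let c = (\<lambda>b q. inv (e (h q)) (s q) \<bullet> b) in
         d = (\<Sum>b\<in>Basis. w (c b) *\<^sub>R e (h p) b
                + c b p *\<^sub>R D (h p) (differential M h p w) (\<lambda>x. e x b))))"


section \<open>Semi-flat structures\<close>

text \<open>
  A point of the total space is a pair \<open>p = (x, v)\<close>, the projection is \<open>fst\<close> and the
  tautological section of the pullback of \<open>V\<close> is \<open>snd\<close>.
\<close>

definition vertical_lift ::
    "('a, 'e::euclidean_space) atlas \<Rightarrow> ('a, 'v::real_vector, 'f::euclidean_space) vbundle \<Rightarrow>
     'a \<times> 'v \<Rightarrow> 'v \<Rightarrow> ('a \<times> 'v) tvec" where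
  "vertical_lift M V p v = (\<lambda>f.
     if smooth_near (total_space M V) p f then deriv (\<lambda>t. f (fst p, snd p + t *\<^sub>R v)) 0 else 0)"

definition vertical_proj ::
    "('a, 'e::euclidean_space) atlas \<Rightarrow> ('a, 'v::real_vector, 'f::euclidean_space) vbundle \<Rightarrow>
     ('a, 'v) conn \<Rightarrow> 'a \<times> 'v \<Rightarrow> ('a \<times> 'v) tvec \<Rightarrow> 'v" where
  "vertical_proj M V D p w = pullback_connection M V D fst p w snd"

definition horizontal_lift ::
    "('a, 'e::euclidean_space) atlas \<Rightarrow> ('a, 'v::real_vector, 'f::euclidean_space) vbundle \<Rightarrow>
     ('a, 'v) conn \<Rightarrow> 'a \<times> 'v \<Rightarrow> 'a tvec \<Rightarrow> ('a \<times> 'v) tvec" where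
  "horizontal_lift M V D p t =
     (THE w. w \<in> tangent_space (total_space M V) p \<and>
        differential M fst p w = t \<and> vertical_proj M V D p w = 0)"

definition transpose_map :: "'v set \<Rightarrow> ('v \<Rightarrow> 'w) \<Rightarrow> ('w \<Rightarrow> real) \<Rightarrow> 'v \<Rightarrow> real" where
  "transpose_map S h \<xi> = (\<lambda>v. if v \<in> S then \<xi> (h v) else 0)"

text \<open>
  The identification of \<open>S\<^sup>* \<oplus> T\<^sup>*\<close> with \<open>(S \<oplus> T)\<^sup>*\<close>. Through it \<open>V \<oplus> T\<^sub>M \<oplus> V\<^sup>* \<oplus> T\<^sub>M\<^sup>*\<close> is
  represented by the double of the bundle \<open>V \<oplus> T\<^sub>M\<close>.
\<close>

definition functional_sum ::
    "'v set \<Rightarrow> 'w set \<Rightarrow> ('v \<Rightarrow> real) \<Rightarrow> ('w \<Rightarrow> real) \<Rightarrow> 'v \<times> 'w \<Rightarrow> real" where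
  "functional_sum S T f g = (\<lambda>(v, w). if v \<in> S \<and> w \<in> T then f v + g w else 0)"

type_synonym ('a, 'v) mixed = "('v \<times> 'a tvec) \<times> ('v \<times> 'a tvec \<Rightarrow> real)"

definition splitting ::
    "('a, 'e::euclidean_space) atlas \<Rightarrow> ('a, 'v::real_vector, 'f::euclidean_space) vbundle \<Rightarrow>
     ('a, 'v) conn \<Rightarrow> 'a \<times> 'v \<Rightarrow> ('a \<times> 'v) gtvec \<Rightarrow> ('a, 'v) mixed" where
  "splitting M V D p = (\<lambda>(w, \<xi>).
     ((vertical_proj M V D p w, differential M fst p w),
      functional_sum (fib V (fst p)) (tangent_space M (fst p))
        (transpose_map (fib V (fst p)) (vertical_lift M V p) \<xi>)
        (transpose_map (tangent_space M (fst p)) (horizontal_lift M V D p) \<xi>)))"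

definition adapted ::
    "('a, 'e::euclidean_space) atlas \<Rightarrow> ('a, 'v::real_vector, 'f::euclidean_space) vbundle \<Rightarrow>
     ('a \<Rightarrow> ('a, 'v) mixed \<Rightarrow> ('a, 'v) mixed) \<Rightarrow> bool" where
  "adapted M V J \<longleftrightarrow>
     (\<forall>x\<in>carrier M. let S = fib V x; T = tangent_space M x in
        J x ` {((v, 0), functional_sum S T f 0) | v f. v \<in> S \<and> f \<in> dual_space S} =
        {((0, t), functional_sum S T 0 g) | t g. t \<in> T \<and> g \<in> dual_space T})"

definition semi_flat ::
    "('a, 'e::euclidean_space) atlas \<Rightarrow> ('a, 'v::real_vector, 'f::euclidean_space) vbundle \<Rightarrow>
     ('a, 'v) conn \<Rightarrow> ('a \<Rightarrow> ('a, 'v) mixed \<Rightarrow> ('a, 'v) mixed) \<Rightarrow>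
     'a \<times> 'v \<Rightarrow> ('a \<times> 'v) gtvec \<Rightarrow> ('a \<times> 'v) gtvec" where
  "semi_flat M V D J p = (\<lambda>a.
     inv_into (fib (double_bundle (tangent_bundle (total_space M V))) p) (splitting M V D p)
       (J (fst p) (splitting M V D p a)))"

text \<open>
  The interchange of \<open>V\<close> and \<open>V\<^sup>*\<close>, with \<open>V\<close> identified with \<open>V\<^sup>*\<^sup>*\<close> by evaluation. The
  components in \<open>V\<^sup>*\<close> and \<open>T\<^sub>M\<^sup>*\<close> of a functional \<open>\<phi>\<close> on \<open>V \<oplus> T\<^sub>M\<close> are its restrictions.
\<close>

definition mirror_swap ::
    "('a, 'e::euclidean_space) atlas \<Rightarrow> ('a, 'v::real_vector, 'f::euclidean_space) vbundle \<Rightarrow>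
     'a \<Rightarrow> ('a, 'v) mixed \<Rightarrow> ('a, 'v \<Rightarrow> real) mixed" where
  "mirror_swap M V x = (\<lambda>((v, t), \<phi>).
     ((\<lambda>u. \<phi> (u, 0), t),
      functional_sum (dual_space (fib V x)) (tangent_space M x)
        (\<lambda>f. if f \<in> dual_space (fib V x) then f v else 0) (\<lambda>t'. \<phi> (0, t'))))"

definition mirror ::
    "('a, 'e::euclidean_space) atlas \<Rightarrow> ('a, 'v::real_vector, 'f::euclidean_space) vbundle \<Rightarrow>
     ('a \<Rightarrow> ('a, 'v) mixed \<Rightarrow> ('a, 'v) mixed) \<Rightarrow>
     'a \<Rightarrow> ('a, 'v \<Rightarrow> real) mixed \<Rightarrow> ('a, 'v \<Rightarrow> real) mixed" where
  "mirror M V J x = (\<lambda>a.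
     mirror_swap M V x
       (J x (inv_into (fib (double_bundle (sum_bundle V (tangent_bundle M))) x)
               (mirror_swap M V x) a)))"

end

theory Submission
  imports Defs
begin

text \<open>
  Writing eigensections as \<open>J b + i b\<close>, integrability of \<open>J\<close> on the total space \<open>X\<close> becomes the
  vanishing of the Nijenhuis expression \<open>J([s,t] - [Js,Jt]) - [s,Jt] - [Js,t]\<close>, which is
  tensorial because \<open>J\<close> is orthogonal for the pairing. It can therefore be tested on the frame
  obtained by applying \<open>F\<^sup>-\<^sup>1\<close> to sections pulled back from the base.

  The Courant brackets of this frame are governed by the cyclic form
  \<open>\<Sum> f\<^sub>1 (\<nabla>\<^bsub>t\<^sub>2\<^esub> v\<^sub>3 - \<nabla>\<^bsub>t\<^sub>3\<^esub> v\<^sub>2)\<close> in the components \<open>v\<close>, \<open>t\<close>, \<open>f\<close> in \<open>V\<close>, \<open>T\<^sub>M\<close>, \<open>V\<^sup>*\<close>. All terms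
  that depend on the position in the fibre carry the curvature of \<open>\<nabla>\<close> and vanish, so
  integrability is a condition on the base. The cyclic form is unchanged when \<open>v\<close> and \<open>f\<close> are
  interchanged and \<open>\<nabla>\<close> is replaced by its dual, whence the condition for the mirror is the same. No
  flat frames are needed: everything is computed with the connection form of an arbitrary frame.
\<close>

section \<open>Smooth functions on Euclidean spaces\<close>

text \<open>The cyclic form comes from orthogonality. Write \<open>\<Omega> a b c\<close> for the
  derivative along \<open>a\<close> of the frame field with constant components \<open>b\<close>,
  paired with the frame field of \<open>c\<close>. The splitting preserves the pairing, so
  \<open>\<Omega>\<close> is skew in its last two arguments, and the Courant bracket of two frame
  fields, paired with a third, becomes
  \<open>\<Omega> a b c + \<Omega> b c a + \<Omega> c a b\<close>. Away from the curvature, the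
  connection form \<open>A\<close> enters through six signed products
  \<open>f \<bullet> A t v\<close>. The dual connection has the form \<open>- A^T\<close>, so
  exchanging \<open>v\<close> and \<open>f\<close> permutes these products.

  The formal obstacle lies in the definitions: Lie derivatives, dual connections and the splitting
  are definite descriptions over all extensions or all frames, and all maps have default values
  outside the fibres. Each object is therefore evaluated once on local representatives and replaced
  by a coordinate formula. Pairing with an arbitrary third vector then turns identities between
  brackets into scalar ones.\<close>

abbreviation fd :: "('a::real_normed_vector \<Rightarrow> 'b::real_normed_vector) \<Rightarrow> 'a \<Rightarrow> 'a \<Rightarrow> 'b" where
  "fd f x \<equiv> frechet_derivative f (at x)"

lemma fd_eq: "(f has_derivative f') (at x) \<Longrightarrow> fd f x = f'"
  using frechet_derivative_at by metis

lemma has_fd: "f differentiable (at x) \<Longrightarrow> (f has_derivative fd f x) (at x)"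
  using frechet_derivative_works by blast

lemma has_derivative_cong_nhds:
  assumes "\<forall>\<^sub>F y in nhds x. f y = g y"
  shows "(f has_derivative f') (at x) \<longleftrightarrow> (g has_derivative f') (at x)"
proof -
  obtain S where "open S" "x \<in> S" "\<And>y. y \<in> S \<Longrightarrow> f y = g y"
    using assms eventually_nhds[of _ x] by auto
  then show ?thesis
    by (metis has_derivative_transform_within_open)
qed

lemma fd_cong: "\<forall>\<^sub>F y in nhds x. f y = g y \<Longrightarrow> fd f x = fd g x"
  unfolding frechet_derivative_def by (simp only: has_derivative_cong_nhds)

lemma differentiable_cong_nhds:
  "\<forall>\<^sub>F y in nhds x. f y = g y \<Longrightarrow> f differentiable (at x) \<longleftrightarrow> g differentiable (at x)"
  unfolding differentiable_def by (simp only: has_derivative_cong_nhds)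

lemma Ck_on_cong:
  assumes "open S" "\<And>x. x \<in> S \<Longrightarrow> f x = g x" "Ck_on k S f"
  shows "Ck_on k S g"
  using assms(2,3)
proof (induction k arbitrary: f g)
  case 0
  then show ?case by (simp cong: continuous_on_cong)
next
  case (Suc k)
  have ev: "\<forall>\<^sub>F y in nhds x. f y = g y" if "x \<in> S" for x
    using Suc.prems(1) assms(1) that eventually_nhds by blast
  have "Ck_on k S (\<lambda>x. fd g x v)" for v
    by (rule Suc.IH[of "\<lambda>x. fd f x v"]) (use Suc.prems fd_cong[OF ev] in auto)
  then show ?case
    using Suc.prems(2) differentiable_cong_nhds[OF ev] by auto
qed

lemma Ck_on_subset: "Ck_on k S f \<Longrightarrow> T \<subseteq> S \<Longrightarrow> Ck_on k T f"
  by (induction k arbitrary: f) (auto intro: continuous_on_subset)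

lemma Ck_on_SucD: "Ck_on (Suc k) S f \<Longrightarrow> Ck_on k S f"
proof (induction k arbitrary: f)
  case 0
  then show ?case
    by (simp add: differentiable_imp_continuous_on differentiable_at_imp_differentiable_on)
next
  case (Suc k)
  then show ?case by (metis Ck_on.simps(2))
qed

text \<open>Derivatives in \<open>Ck_on\<close> are taken at \<open>x\<close> in the whole space,
  not within \<open>S\<close>, so every clause is a condition at single points; continuity on an
  open neighbourhood gives continuity at the point.\<close>

lemma Ck_on_local:
  assumes "\<And>x. x \<in> S \<Longrightarrow> \<exists>T. open T \<and> x \<in> T \<and> Ck_on k T f"
  shows "Ck_on k S f"
  using assms
proof (induction k arbitrary: f)
  case 0
  then show ?case
    by (metis Ck_on.simps(1) continuous_at_imp_continuous_on continuous_on_eq_continuous_at)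
next
  case (Suc k)
  then show ?case by (metis Ck_on.simps(2))
qed

text \<open>Smoothness of a germ. It allows open domains to be replaced by statements that hold
  eventually in \<open>nhds x\<close>.\<close>

definition smooth_at :: "'a::real_normed_vector \<Rightarrow> ('a \<Rightarrow> 'b::real_normed_vector) \<Rightarrow> bool" where
  "smooth_at x f \<longleftrightarrow> (\<exists>S. open S \<and> x \<in> S \<and> smooth_on S f)"

lemma smooth_on_iff_smooth_at:
  assumes "open S"
  shows "smooth_on S f \<longleftrightarrow> (\<forall>x\<in>S. smooth_at x f)"
proof
  assume "smooth_on S f" then show "\<forall>x\<in>S. smooth_at x f"
    using assms unfolding smooth_at_def by blast
next
  assume *: "\<forall>x\<in>S. smooth_at x f"
  show "smooth_on S f"
    unfolding smooth_on_def
  proof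
    fix k
    show "Ck_on k S f"
      by (rule Ck_on_local) (use * in \<open>unfold smooth_at_def smooth_on_def, blast\<close>)
  qed
qed

text \<open>A shift of the order by one; \<open>Ck_on_SucD\<close> covers the order
  \<open>0\<close>.\<close>

lemma smooth_on_Diff:
  "smooth_on S f \<longleftrightarrow> (\<forall>x\<in>S. f differentiable (at x)) \<and> (\<forall>v. smooth_on S (\<lambda>x. fd f x v))"
  unfolding smooth_on_def by (metis Ck_on.simps(2) Ck_on_SucD)

lemma smooth_at_differentiable: "smooth_at x f \<Longrightarrow> f differentiable (at x)"
  unfolding smooth_at_def using smooth_on_Diff by blast

lemma smooth_at_has_derivative: "smooth_at x f \<Longrightarrow> (f has_derivative fd f x) (at x)"
  using smooth_at_differentiable frechet_derivative_works by blast

lemma linear_fd: "smooth_at x f \<Longrightarrow> linear (fd f x)"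
  using smooth_at_differentiable linear_frechet_derivative by blast

lemma smooth_at_fd_const: "smooth_at x f \<Longrightarrow> smooth_at x (\<lambda>y. fd f y v)"
  unfolding smooth_at_def using smooth_on_Diff by blast

lemma smooth_at_eventually: "smooth_at x f \<Longrightarrow> \<forall>\<^sub>F y in nhds x. smooth_at y f"
  unfolding smooth_at_def eventually_nhds by blast

lemma smooth_at_cong:
  assumes "\<forall>\<^sub>F y in nhds x. f y = g y"
  shows "smooth_at x f \<longleftrightarrow> smooth_at x g"
proof -
  have *: "smooth_at x g" if fg: "\<forall>\<^sub>F y in nhds x. f y = g y" and f: "smooth_at x f" for f g :: "'a \<Rightarrow> 'b"
  proof -
    obtain S where S: "open S" "x \<in> S" "smooth_on S f"
      using f smooth_at_def by blast
    obtain T where T: "open T" "x \<in> T" "\<And>y. y \<in> T \<Longrightarrow> f y = g y"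
      using fg eventually_nhds[of _ x] by auto
    have "smooth_on (S \<inter> T) g"
      unfolding smooth_on_def
    proof
      fix k
      have "Ck_on k (S \<inter> T) f"
        using S(3) Ck_on_subset unfolding smooth_on_def by blast
      then show "Ck_on k (S \<inter> T) g"
        using Ck_on_cong[of "S \<inter> T" f g] S T by auto
    qed
    then show ?thesis
      unfolding smooth_at_def using S T by blast
  qed
  have "\<forall>\<^sub>F y in nhds x. g y = f y"
    using assms by eventually_elim simp
  then show ?thesis
    using * assms by blast
qed

lemma Ck_on_bounded_linear:
  assumes L: "bounded_linear L" and f: "Ck_on k S f" and S: "open S"
  shows "Ck_on k S (\<lambda>x. L (f x))"
  using f
proof (induction k arbitrary: f)
  case 0
  then show ?case using L by (simp add: bounded_linear.continuous_on)
next
  case (Suc k)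
  have d: "((\<lambda>x. L (f x)) has_derivative (\<lambda>v. L (fd f x v))) (at x)" if "x \<in> S" for x
    using Suc.prems that
    by (auto intro!: bounded_linear.has_derivative[OF L] has_fd)
  have "Ck_on k S (\<lambda>x. fd (\<lambda>x. L (f x)) x v)" for v
    by (rule Ck_on_cong[OF S, of "\<lambda>x. L (fd f x v)"]) (use Suc fd_eq[OF d] in auto)
  then show ?case
    using d by (auto intro: Derivative.differentiableI)
qed

lemma Ck_on_const: "Ck_on k S (\<lambda>x. c)"
proof (induction k arbitrary: c)
  case (Suc k)
  then show ?case by simp
qed simp

lemma Ck_on_add:
  assumes "open S" "Ck_on k S f" "Ck_on k S g"
  shows "Ck_on k S (\<lambda>x. f x + g x)"
  using assms(2,3)
proof (induction k arbitrary: f g)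
  case 0
  then show ?case by (simp add: continuous_on_add)
next
  case (Suc k)
  have d: "((\<lambda>x. f x + g x) has_derivative (\<lambda>v. fd f x v + fd g x v)) (at x)" if "x \<in> S" for x
    using Suc.prems that
    by (auto intro!: has_derivative_add has_fd)
  have "Ck_on k S (\<lambda>x. fd (\<lambda>x. f x + g x) x v)" for v
    by (rule Ck_on_cong[OF assms(1), of "\<lambda>x. fd f x v + fd g x v"]) (use Suc fd_eq[OF d] in auto)
  then show ?case
    using d by (auto intro: Derivative.differentiableI)
qed

text \<open>In the product rule one factor stays undifferentiated, so the induction also needs it
  one order lower, which \<open>Ck_on_SucD\<close> supplies.\<close>

lemma Ck_on_bilinear:
  assumes B: "bounded_bilinear B" and S: "open S" and "Ck_on k S f" "Ck_on k S g"
  shows "Ck_on k S (\<lambda>x. B (f x) (g x))"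
  using assms(3,4)
proof (induction k arbitrary: f g)
  case 0
  then show ?case using B by (simp add: bounded_bilinear.continuous_on)
next
  case (Suc k)
  have d: "((\<lambda>x. B (f x) (g x)) has_derivative (\<lambda>v. B (f x) (fd g x v) + B (fd f x v) (g x))) (at x)"
    if "x \<in> S" for x
    using Suc.prems that
    by (auto intro!: bounded_bilinear.FDERIV[OF B] has_fd)
  have "Ck_on k S (\<lambda>x. fd (\<lambda>x. B (f x) (g x)) x v)" for v
    by (rule Ck_on_cong[OF S, of "\<lambda>x. B (f x) (fd g x v) + B (fd f x v) (g x)"])
      (use Suc Ck_on_SucD[OF Suc.prems(1)] Ck_on_SucD[OF Suc.prems(2)] fd_eq[OF d]
        in \<open>auto intro!: Ck_on_add S Suc.IH\<close>)
  then show ?case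
    using d by (auto intro: Derivative.differentiableI)
qed

lemma Ck_on_sum:
  assumes "open S" "\<And>i. i \<in> I \<Longrightarrow> Ck_on k S (f i)"
  shows "Ck_on k S (\<lambda>x. \<Sum>i\<in>I. f i x)"
  using assms(2)
proof (induction I rule: infinite_finite_induct)
  case (insert i I)
  then show ?case by (simp add: Ck_on_add[OF assms(1)])
qed (auto simp: Ck_on_const)

text \<open>The chain rule applies \<open>fd f (g x)\<close> to a vector that varies with
  \<open>x\<close>, while \<open>Ck_on\<close> only controls derivatives along fixed vectors.
  Expanding the vector in the finite basis of the middle space restores fixed directions; this is
  why that space is Euclidean.\<close>

lemma Ck_on_compose:
  fixes g :: "'a::real_normed_vector \<Rightarrow> 'b::euclidean_space"
  assumes S: "open S" and T: "open T" and gST: "g ` S \<subseteq> T"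
    and "Ck_on k T f" "Ck_on k S g"
  shows "Ck_on k S (\<lambda>x. f (g x))"
  using assms(4,5)
proof (induction k arbitrary: f)
  case 0
  then show ?case
    using continuous_on_compose2[of T f S g] gST by simp
next
  case (Suc k)
  have dg: "(g has_derivative fd g x) (at x)" if "x \<in> S" for x
    using Suc.prems that by (auto intro: has_fd)
  have df: "(f has_derivative fd f x) (at x)" if "x \<in> T" for x
    using Suc.prems that by (auto intro: has_fd)
  have d: "((\<lambda>x. f (g x)) has_derivative (\<lambda>v. fd f (g x) (fd g x v))) (at x)" if "x \<in> S" for x
    using has_derivative_compose[OF dg df, of x] that gST by auto
  have eq: "fd (\<lambda>x. f (g x)) x v = (\<Sum>b\<in>Basis. (fd g x v \<bullet> b) *\<^sub>R fd f (g x) b)" if x: "x \<in> S" for x v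
  proof -
    have "linear (fd f (g x))"
      using df x gST by (meson has_derivative_linear image_subset_iff)
    have "fd f (g x) (fd g x v) = fd f (g x) (\<Sum>b\<in>Basis. (fd g x v \<bullet> b) *\<^sub>R b)"
      by (simp add: euclidean_representation)
    also have "\<dots> = (\<Sum>b\<in>Basis. (fd g x v \<bullet> b) *\<^sub>R fd f (g x) b)"
      using \<open>linear _\<close> by (simp add: linear_sum linear_scale)
    finally show ?thesis
      using fd_eq[OF d[OF x]] by simp
  qed
  have "Ck_on k S (\<lambda>x. \<Sum>b\<in>Basis. (fd g x v \<bullet> b) *\<^sub>R fd f (g x) b)" for v
  proof (intro Ck_on_sum S Ck_on_bilinear[OF bounded_bilinear_scaleR])
    fix b :: 'b
    show "Ck_on k S (\<lambda>x. fd g x v \<bullet> b)"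
      using Suc.prems by (intro Ck_on_bounded_linear[OF bounded_linear_inner_left _ S]) auto
    show "Ck_on k S (\<lambda>x. fd f (g x) b)"
      using Suc.prems Ck_on_SucD by (intro Suc.IH) auto
  qed
  then have "Ck_on k S (\<lambda>x. fd (\<lambda>x. f (g x)) x v)" for v
    by (rule Ck_on_cong[OF S, rotated]) (simp add: eq)
  then show ?case
    using d by (auto intro: Derivative.differentiableI)
qed

lemma smooth_at_const [simp, intro]: "smooth_at x (\<lambda>y. c)"
  unfolding smooth_at_def smooth_on_def using Ck_on_const open_UNIV by blast

lemma smooth_at_common:
  assumes "smooth_at x f" "smooth_at x g"
  obtains S where "open S" "x \<in> S" "smooth_on S f" "smooth_on S g"
proof -
  obtain S T where "open S" "x \<in> S" "smooth_on S f" "open T" "x \<in> T" "smooth_on T g"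
    using assms smooth_at_def by metis
  then have "open (S \<inter> T)" "x \<in> S \<inter> T" "smooth_on (S \<inter> T) f" "smooth_on (S \<inter> T) g"
    by (auto simp: smooth_on_def intro: Ck_on_subset)
  then show ?thesis using that by blast
qed

lemma smooth_at_linear:
  assumes "bounded_linear L" "smooth_at x f" shows "smooth_at x (\<lambda>y. L (f y))"
  using assms unfolding smooth_at_def smooth_on_def by (blast intro: Ck_on_bounded_linear)

lemma smooth_at_id: "smooth_at x (\<lambda>y. y)"
proof -
  have "Ck_on k UNIV (\<lambda>y::'a. y)" for k
    by (cases k) (auto simp: Ck_on_const)
  then show ?thesis
    unfolding smooth_at_def smooth_on_def by blast
qed

lemma smooth_at_linear': "bounded_linear L \<Longrightarrow> smooth_at x L"
  using smooth_at_linear[OF _ smooth_at_id] by auto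

lemma smooth_at_add:
  assumes "smooth_at x f" "smooth_at x g" shows "smooth_at x (\<lambda>y. f y + g y)"
  using smooth_at_common[OF assms] unfolding smooth_at_def smooth_on_def by (metis Ck_on_add)

lemma smooth_at_bilinear:
  assumes "bounded_bilinear B" "smooth_at x f" "smooth_at x g" shows "smooth_at x (\<lambda>y. B (f y) (g y))"
  using smooth_at_common[OF assms(2,3)] assms(1) unfolding smooth_at_def smooth_on_def
  by (metis Ck_on_bilinear)

lemma smooth_at_sum:
  assumes "\<And>i. i \<in> I \<Longrightarrow> smooth_at x (f i)" shows "smooth_at x (\<lambda>y. \<Sum>i\<in>I. f i y)"
  using assms by (induction I rule: infinite_finite_induct) (auto intro: smooth_at_add)

lemmas smooth_at_scaleR = smooth_at_bilinear[OF bounded_bilinear_scaleR]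
  and smooth_at_inner = smooth_at_bilinear[OF bounded_bilinear_inner]
  and smooth_at_fst = smooth_at_linear[OF bounded_linear_fst]
  and smooth_at_snd = smooth_at_linear[OF bounded_linear_snd]
  and smooth_at_uminus = smooth_at_linear[OF bounded_linear_minus[OF bounded_linear_ident]]

lemma smooth_at_diff:
  "smooth_at x f \<Longrightarrow> smooth_at x g \<Longrightarrow> smooth_at x (\<lambda>y. f y - g y)"
  using smooth_at_add[OF _ smooth_at_uminus, of x f g] by simp

lemma smooth_at_Pair:
  assumes "smooth_at x f" "smooth_at x g"
  shows "smooth_at x (\<lambda>y. (f y, g y))"
proof -
  have "smooth_at x (\<lambda>y. (f y, 0) + (0, g y))"
    by (intro smooth_at_add smooth_at_linear[OF _ assms(1)] smooth_at_linear[OF _ assms(2)]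
        bounded_linear_Pair bounded_linear_ident bounded_linear_zero)
  then show ?thesis by simp
qed

lemma smooth_at_compose:
  fixes g :: "'a::real_normed_vector \<Rightarrow> 'b::euclidean_space"
  assumes f: "smooth_at (g x) f" and g: "smooth_at x g"
  shows "smooth_at x (\<lambda>y. f (g y))"
proof -
  obtain T where T: "open T" "g x \<in> T" "smooth_on T f"
    using f smooth_at_def by blast
  obtain S where S: "open S" "x \<in> S" "smooth_on S g"
    using g smooth_at_def by blast
  have "continuous_on S g"
    using S(3) unfolding smooth_on_def by (metis Ck_on.simps(1))
  then have o: "open (S \<inter> g -` T)"
    using S(1) T(1) continuous_open_preimage by blast
  have "Ck_on k (S \<inter> g -` T) (\<lambda>y. f (g y))" for k
    by (rule Ck_on_compose[OF o T(1)]) (use T S in \<open>auto simp: smooth_on_def intro: Ck_on_subset\<close>)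
  then show ?thesis
    unfolding smooth_at_def smooth_on_def using o S T by blast
qed

lemma linear_expand:
  fixes L :: "'a::euclidean_space \<Rightarrow> 'b::real_vector"
  assumes "linear L"
  shows "L v = (\<Sum>b\<in>Basis. (v \<bullet> b) *\<^sub>R L b)"
proof -
  have "L v = L (\<Sum>b\<in>Basis. (v \<bullet> b) *\<^sub>R b)"
    by (simp add: euclidean_representation)
  then show ?thesis
    using assms by (simp add: linear_sum linear_scale)
qed

text \<open>A smoothly varying linear map is known only through its values on fixed vectors.
  Linearity near \<open>x\<close> and a finite basis allow a moving argument. Transition matrices,
  connection forms, matrices of \<open>J\<close> and the moving frame all enter through this
  rule.\<close>

lemma smooth_at_family:
  fixes L :: "'a::real_normed_vector \<Rightarrow> 'b::euclidean_space \<Rightarrow> 'c::real_normed_vector"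
  assumes lin: "\<forall>\<^sub>F y in nhds x. linear (L y)"
    and L: "\<And>b. smooth_at x (\<lambda>y. L y b)" and s: "smooth_at x s"
  shows "smooth_at x (\<lambda>y. L y (s y))"
    and "fd (\<lambda>y. L y (s y)) x w = fd (\<lambda>y. L y (s x)) x w + L x (fd s x w)"
proof -
  have ev: "\<forall>\<^sub>F y in nhds x. L y (s y) = (\<Sum>b\<in>Basis. (s y \<bullet> b) *\<^sub>R L y b)"
    and ev': "\<forall>\<^sub>F y in nhds x. L y (s x) = (\<Sum>b\<in>Basis. (s x \<bullet> b) *\<^sub>R L y b)"
    using lin lin by (auto elim!: eventually_mono intro: linear_expand)
  have lx: "linear (L x)"
    using lin by (rule eventually_nhds_x_imp_x)
  show "smooth_at x (\<lambda>y. L y (s y))"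
    unfolding smooth_at_cong[OF ev]
    by (intro smooth_at_sum smooth_at_scaleR smooth_at_inner s smooth_at_const L)
  note d = smooth_at_has_derivative[OF L] smooth_at_has_derivative[OF s]
  have "((\<lambda>y. \<Sum>b\<in>Basis. (s y \<bullet> b) *\<^sub>R L y b) has_derivative
      (\<lambda>w. \<Sum>b\<in>Basis. (s x \<bullet> b) *\<^sub>R fd (\<lambda>y. L y b) x w + (fd s x w \<bullet> b) *\<^sub>R L x b)) (at x)"
    by (intro has_derivative_sum has_derivative_scaleR d bounded_linear.has_derivative[OF bounded_linear_inner_left])
  moreover have "((\<lambda>y. \<Sum>b\<in>Basis. (s x \<bullet> b) *\<^sub>R L y b) has_derivative
      (\<lambda>w. \<Sum>b\<in>Basis. (s x \<bullet> b) *\<^sub>R fd (\<lambda>y. L y b) x w)) (at x)"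
    by (intro has_derivative_sum bounded_linear.has_derivative[OF bounded_linear_scaleR_right] d)
  ultimately show "fd (\<lambda>y. L y (s y)) x w = fd (\<lambda>y. L y (s x)) x w + L x (fd s x w)"
    unfolding fd_cong[OF ev] fd_cong[OF ev'] linear_expand[OF lx, of "fd s x w"]
    by (simp add: fd_eq sum.distrib)
qed

lemma smooth_at_fd:
  fixes f :: "'a::euclidean_space \<Rightarrow> 'b::real_normed_vector"
  assumes "smooth_at x f" "smooth_at x s"
  shows "smooth_at x (\<lambda>y. fd f y (s y))"
    and "fd (\<lambda>y. fd f y (s y)) x w = fd (\<lambda>y. fd f y (s x)) x w + fd f x (fd s x w)"
proof -
  have "\<forall>\<^sub>F y in nhds x. linear (fd f y)"
    using smooth_at_eventually[OF assms(1)] by eventually_elim (rule linear_fd)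
  then show "smooth_at x (\<lambda>y. fd f y (s y))"
    "fd (\<lambda>y. fd f y (s y)) x w = fd (\<lambda>y. fd f y (s x)) x w + fd f x (fd s x w)"
    by (rule smooth_at_family[OF _ smooth_at_fd_const[OF assms(1)] assms(2)])+
qed

lemmas smooth_at_intros = smooth_at_const smooth_at_id smooth_at_add smooth_at_diff smooth_at_sum
  smooth_at_scaleR smooth_at_inner smooth_at_fst smooth_at_snd smooth_at_uminus smooth_at_Pair
  smooth_at_fd(1)

lemma smooth_at_continuous: "smooth_at x f \<Longrightarrow> continuous (at x) f"
  using smooth_at_differentiable differentiable_imp_continuous_within by blast

text \<open>Two applications of the mean value theorem, first along \<open>u\<close>, then along
  \<open>v\<close>. The second difference on the left is symmetric in \<open>u\<close> and
  \<open>v\<close>, and the symmetry of second derivatives rests on this.\<close>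

lemma second_difference:
  fixes f :: "'a::real_normed_vector \<Rightarrow> real"
  assumes "h > 0" and f: "\<And>y. dist y x \<le> h * (norm u + norm v) \<Longrightarrow> smooth_at y f"
  shows "\<exists>y. dist y x \<le> h * (norm u + norm v) \<and>
    f (x + h *\<^sub>R u + h *\<^sub>R v) - f (x + h *\<^sub>R u) - f (x + h *\<^sub>R v) + f x = h * h * fd (\<lambda>y. fd f y u) y v"
proof -
  have near: "dist (x + s *\<^sub>R u + t *\<^sub>R v) x \<le> h * (norm u + norm v)"
    if "0 \<le> s" "s \<le> h" "0 \<le> t" "t \<le> h" for s t
  proof -
    have "dist (x + s *\<^sub>R u + t *\<^sub>R v) x = norm (s *\<^sub>R u + t *\<^sub>R v)"
      by (simp add: dist_norm algebra_simps)
    also have "\<dots> \<le> s * norm u + t * norm v"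
      using that by (intro norm_triangle_le) simp
    also have "\<dots> \<le> h * norm u + h * norm v"
      using that by (intro add_mono mult_right_mono) auto
    finally show ?thesis by (simp add: distrib_left)
  qed
  let ?g = "\<lambda>s. f (x + s *\<^sub>R u + h *\<^sub>R v) - f (x + s *\<^sub>R u)"
  have d1: "((\<lambda>s. f (x + s *\<^sub>R u + t *\<^sub>R v)) has_real_derivative fd f (x + s *\<^sub>R u + t *\<^sub>R v) u) (at s)"
    if "0 \<le> s" "s \<le> h" "0 \<le> t" "t \<le> h" for s t
  proof -
    note sm = f[OF near[OF that]]
    have "((\<lambda>s. x + s *\<^sub>R u + t *\<^sub>R v) has_derivative (\<lambda>r. r *\<^sub>R u)) (at s)"
      by (auto intro!: derivative_eq_intros)
    from has_derivative_compose[OF this smooth_at_has_derivative[OF sm]]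
    show ?thesis
      unfolding has_field_derivative_def
      by (rule has_derivative_eq_rhs) (auto simp: linear_scale[OF linear_fd[OF sm]])
  qed
  have "(?g has_real_derivative fd f (x + s *\<^sub>R u + h *\<^sub>R v) u - fd f (x + s *\<^sub>R u + 0 *\<^sub>R v) u) (at s)"
    if "0 \<le> s" "s \<le> h" for s
    using DERIV_diff[OF d1[OF that, of h] d1[OF that, of 0]] \<open>h > 0\<close> by simp
  then obtain s where s: "0 < s" "s < h"
    "?g h - ?g 0 = h * (fd f (x + s *\<^sub>R u + h *\<^sub>R v) u - fd f (x + s *\<^sub>R u) u)"
    using MVT2[of 0 h ?g "\<lambda>s. fd f (x + s *\<^sub>R u + h *\<^sub>R v) u - fd f (x + s *\<^sub>R u + 0 *\<^sub>R v) u"] \<open>h > 0\<close> by auto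
  have d2: "((\<lambda>t. fd f (x + s *\<^sub>R u + t *\<^sub>R v) u) has_real_derivative
      fd (\<lambda>y. fd f y u) (x + s *\<^sub>R u + t *\<^sub>R v) v) (at t)" if "0 \<le> t" "t \<le> h" for t
  proof -
    note sm = smooth_at_fd_const[OF f[OF near[OF _ _ that]], of s u]
    have "((\<lambda>t. x + s *\<^sub>R u + t *\<^sub>R v) has_derivative (\<lambda>r. r *\<^sub>R v)) (at t)"
      by (auto intro!: derivative_eq_intros)
    from has_derivative_compose[OF this smooth_at_has_derivative[OF sm]]
    show ?thesis
      unfolding has_field_derivative_def
      by (rule has_derivative_eq_rhs) (use s in \<open>auto simp: linear_scale[OF linear_fd[OF sm]]\<close>)
  qed
  obtain t where t: "0 < t" "t < h"
    "fd f (x + s *\<^sub>R u + h *\<^sub>R v) u - fd f (x + s *\<^sub>R u + 0 *\<^sub>R v) u =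
      h * fd (\<lambda>y. fd f y u) (x + s *\<^sub>R u + t *\<^sub>R v) v"
    using MVT2[of 0 h "\<lambda>t. fd f (x + s *\<^sub>R u + t *\<^sub>R v) u" "\<lambda>t. fd (\<lambda>y. fd f y u) (x + s *\<^sub>R u + t *\<^sub>R v) v"]
      d2 \<open>h > 0\<close> by auto
  have "dist (x + s *\<^sub>R u + t *\<^sub>R v) x \<le> h * (norm u + norm v)"
    using near s t by simp
  moreover have "f (x + h *\<^sub>R u + h *\<^sub>R v) - f (x + h *\<^sub>R u) - f (x + h *\<^sub>R v) + f x
      = h * h * fd (\<lambda>y. fd f y u) (x + s *\<^sub>R u + t *\<^sub>R v) v"
    using s(3) t(3) by simp
  ultimately show ?thesis by blast
qed

text \<open>If the mixed derivatives differed at \<open>x\<close>, continuity would keep them apart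
  on a ball. A second difference small enough to stay in that ball equals both of them, up to the
  factor \<open>h * h\<close>, at two points of the ball.\<close>

lemma fd_symmetric_real:
  fixes f :: "'a::real_normed_vector \<Rightarrow> real"
  assumes "smooth_at x f"
  shows "fd (\<lambda>y. fd f y u) x v = fd (\<lambda>y. fd f y v) x u"
proof (rule ccontr)
  let ?a = "\<lambda>y. fd (\<lambda>y. fd f y u) y v" and ?b = "\<lambda>y. fd (\<lambda>y. fd f y v) y u"
  assume ne: "?a x \<noteq> ?b x"
  define \<epsilon> where "\<epsilon> = dist (?a x) (?b x) / 2"
  have "\<epsilon> > 0" using ne by (simp add: \<epsilon>_def)
  have ca: "continuous (at x) ?a" and ccourant: "continuous (at x) ?b"
    by (intro smooth_at_continuous smooth_at_fd_const assms)+
  have "\<forall>\<^sub>F y in nhds x. dist (?a y) (?a x) < \<epsilon>" "\<forall>\<^sub>F y in nhds x. dist (?b y) (?b x) < \<epsilon>"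
    using ca ccourant \<open>\<epsilon> > 0\<close> unfolding continuous_at_eps_delta eventually_nhds_metric by blast+
  then have "\<forall>\<^sub>F y in nhds x. dist (?a y) (?a x) < \<epsilon> \<and> dist (?b y) (?b x) < \<epsilon> \<and> smooth_at y f"
    using smooth_at_eventually[OF assms] by eventually_elim simp
  then obtain d where d: "d > 0"
    "\<And>y. dist y x < d \<Longrightarrow> dist (?a y) (?a x) < \<epsilon> \<and> dist (?b y) (?b x) < \<epsilon> \<and> smooth_at y f"
    unfolding eventually_nhds_metric by blast
  \<comment> \<open>The summand \<open>1\<close> keeps the denominator positive when
    \<open>u = v = 0\<close> and makes the bound below strict.\<close>
  define h where "h = d / (norm u + norm v + 1)"
  have pos: "norm u + norm v + 1 > 0"
    using norm_ge_zero[of u] norm_ge_zero[of v] by linarith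
  then have h: "h > 0" using d(1) by (simp add: h_def)
  have "h * (norm u + norm v) < h * (norm u + norm v + 1)"
    using h by simp
  also have "\<dots> = d" using pos by (simp add: h_def)
  finally have hd: "h * (norm u + norm v) < d" .
  let ?\<Delta> = "f (x + h *\<^sub>R u + h *\<^sub>R v) - f (x + h *\<^sub>R u) - f (x + h *\<^sub>R v) + f x"
  have "\<exists>y. dist y x \<le> h * (norm u + norm v) \<and> ?\<Delta> = h * h * ?a y"
    by (rule second_difference[OF h]) (use d hd in force)
  then obtain y where y: "dist y x < d" "?\<Delta> = h * h * ?a y"
    using hd by force
  have "\<exists>y. dist y x \<le> h * (norm v + norm u) \<and>
    f (x + h *\<^sub>R v + h *\<^sub>R u) - f (x + h *\<^sub>R v) - f (x + h *\<^sub>R u) + f x = h * h * ?b y"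
    by (rule second_difference[OF h]) (use d hd in \<open>force simp: add.commute\<close>)
  then obtain z where z: "dist z x \<le> h * (norm v + norm u)"
    "f (x + h *\<^sub>R v + h *\<^sub>R u) - f (x + h *\<^sub>R v) - f (x + h *\<^sub>R u) + f x = h * h * ?b z"
    by blast
  have "x + h *\<^sub>R v + h *\<^sub>R u = x + h *\<^sub>R u + h *\<^sub>R v" by simp
  then have "?\<Delta> = h * h * ?b z" using z(2) by (simp only: algebra_simps)
  then have "h * h * ?a y = h * h * ?b z" using y(2) by metis
  then have "?a y = ?b z" using h by simp
  moreover have "dist z x < d" using z(1) hd by (simp add: add.commute)
  then have "dist (?b z) (?b x) < \<epsilon>" "dist (?a y) (?a x) < \<epsilon>"
    using d(2) y(1) by blast+
  ultimately have "dist (?a x) (?b x) < 2 * \<epsilon>"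
    unfolding dist_real_def by linarith
  then show False by (simp add: \<epsilon>_def)
qed

lemma fd_bounded_linear:
  assumes "bounded_linear L" "smooth_at x f"
  shows "fd (\<lambda>y. L (f y)) x v = L (fd f x v)"
  by (simp add: fd_eq[OF bounded_linear.has_derivative[OF assms(1) smooth_at_has_derivative[OF assms(2)]]])

lemma fd_symmetric:
  fixes f :: "'a::real_normed_vector \<Rightarrow> 'b::euclidean_space"
  assumes "smooth_at x f"
  shows "fd (\<lambda>y. fd f y u) x v = fd (\<lambda>y. fd f y v) x u"
proof (rule euclidean_eqI)
  fix b :: 'b
  have ev: "\<forall>\<^sub>F y in nhds x. fd f y w \<bullet> b = fd (\<lambda>y. f y \<bullet> b) y w" for w
    using smooth_at_eventually[OF assms]
    by eventually_elim (simp add: fd_bounded_linear[OF bounded_linear_inner_left])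
  have "fd (\<lambda>y. fd f y w) x z \<bullet> b = fd (\<lambda>y. fd (\<lambda>y. f y \<bullet> b) y w) x z" for w z
    using fd_bounded_linear[OF bounded_linear_inner_left[of b] smooth_at_fd_const[OF assms]]
      fd_cong[OF ev] by metis
  then show "fd (\<lambda>y. fd f y u) x v \<bullet> b = fd (\<lambda>y. fd f y v) x u \<bullet> b"
    using fd_symmetric_real[of x "\<lambda>y. f y \<bullet> b"] smooth_at_inner[OF assms] by simp
qed

lemma fd_add:
  assumes "smooth_at x f" "smooth_at x g"
  shows "fd (\<lambda>y. f y + g y) x v = fd f x v + fd g x v"
  by (simp add: fd_eq[OF has_derivative_add[OF assms[THEN smooth_at_has_derivative]]])

lemma fd_diff:
  assumes "smooth_at x f" "smooth_at x g"
  shows "fd (\<lambda>y. f y - g y) x v = fd f x v - fd g x v"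
  by (simp add: fd_eq[OF has_derivative_diff[OF assms[THEN smooth_at_has_derivative]]])

lemma fd_bilinear:
  assumes "bounded_bilinear B" "smooth_at x f" "smooth_at x g"
  shows "fd (\<lambda>y. B (f y) (g y)) x v = B (f x) (fd g x v) + B (fd f x v) (g x)"
  by (simp add: fd_eq[OF bounded_bilinear.FDERIV[OF assms(1) assms(2,3)[THEN smooth_at_has_derivative]]])

lemma fd_compose:
  assumes "smooth_at (g x) f" "smooth_at x g"
  shows "fd (\<lambda>y. f (g y)) x v = fd f (g x) (fd g x v)"
  by (simp add: fd_eq[OF has_derivative_compose[OF assms(2)[THEN smooth_at_has_derivative]
          assms(1)[THEN smooth_at_has_derivative]]])

lemmas fd_inner = fd_bilinear[OF bounded_bilinear_inner]
  and fd_fst = fd_bounded_linear[OF bounded_linear_fst]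
  and fd_snd = fd_bounded_linear[OF bounded_linear_snd]
  and fd_uminus = fd_bounded_linear[OF bounded_linear_minus[OF bounded_linear_ident]]

lemma smooth_at_transfer:
  "smooth_at x f \<Longrightarrow> \<forall>\<^sub>F y in nhds x. f y = g y \<Longrightarrow> smooth_at x g"
  using smooth_at_cong by metis

section \<open>Atlases and vector bundles\<close>

text \<open>The local conditions on an atlas. They hold for the base by assumption and for the total
  space by \<open>total_atlas\<close>, so that one chart calculus serves both.\<close>

locale smooth_atlas =
  fixes M :: "('a, 'e::euclidean_space) atlas"
  assumes chart_inj: "(U, \<phi>) \<in> M \<Longrightarrow> inj_on \<phi> U"
    and chart_open: "(U, \<phi>) \<in> M \<Longrightarrow> open (\<phi> ` U)"
    and transition_open: "(U, \<phi>) \<in> M \<Longrightarrow> (W, \<theta>) \<in> M \<Longrightarrow> open (\<phi> ` (U \<inter> W))"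
    and transition_smooth: "(U, \<phi>) \<in> M \<Longrightarrow> (W, \<theta>) \<in> M \<Longrightarrow>
      smooth_on (\<phi> ` (U \<inter> W)) (\<theta> \<circ> inv_into U \<phi>)"
begin

text \<open>Injective charts preserve intersections, so the predicate in
  \<open>atlas_topology\<close> is a topology. The argument is given for \<open>smooth_atlas\<close>
  because it is also applied to total spaces.\<close>

lemma openin_iff:
  "openin (atlas_topology M) W \<longleftrightarrow> W \<subseteq> carrier M \<and> (\<forall>(U, \<phi>)\<in>M. open (\<phi> ` (W \<inter> U)))"
proof -
  let ?L = "\<lambda>W. W \<subseteq> carrier M \<and> (\<forall>(U, \<phi>)\<in>M. open (\<phi> ` (W \<inter> U)))"
  have "istopology ?L"
    unfolding istopology_def
  proof (intro conjI allI impI)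
    fix S T assume S: "?L S" and T: "?L T"
    have "\<phi> ` (S \<inter> T \<inter> U) = \<phi> ` (S \<inter> U) \<inter> \<phi> ` (T \<inter> U)" if "(U, \<phi>) \<in> M" for U \<phi>
      using chart_inj[OF that] unfolding inj_on_def by auto
    then show "S \<inter> T \<subseteq> carrier M" "\<forall>(U, \<phi>)\<in>M. open (\<phi> ` (S \<inter> T \<inter> U))"
      using S T by (auto intro!: open_Int)
  next
    fix K assume K: "\<forall>S\<in>K. ?L S"
    have "\<phi> ` (\<Union>K \<inter> U) = (\<Union>S\<in>K. \<phi> ` (S \<inter> U))" for U and \<phi> :: "'a \<Rightarrow> 'e"
      by auto
    then show "\<Union>K \<subseteq> carrier M" "\<forall>(U, \<phi>)\<in>M. open (\<phi> ` (\<Union>K \<inter> U))"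
      using K by (fastforce intro!: open_UN)+
  qed
  then show ?thesis
    by (simp add: atlas_topology_def)
qed

lemma chart_inv [simp]:
  assumes "(U, \<phi>) \<in> M" "p \<in> U" shows "inv_into U \<phi> (\<phi> p) = p"
  using chart_inj assms by simp

lemma coordinate_openin:
  assumes c: "(U, \<phi>) \<in> M" and "open S"
  shows "openin (atlas_topology M) {q \<in> U. \<phi> q \<in> S}"
  unfolding openin_iff
proof safe
  fix q assume "q \<in> U" then show "q \<in> carrier M"
    using c unfolding carrier_def by auto
next
  fix W \<theta> assume d: "(W, \<theta>) \<in> M"
  have "continuous_on (\<theta> ` (W \<inter> U)) (\<phi> \<circ> inv_into W \<theta>)"
    using transition_smooth[OF d c] unfolding smooth_on_def by (metis Ck_on.simps(1))
  then have "open (\<theta> ` (W \<inter> U) \<inter> (\<phi> \<circ> inv_into W \<theta>) -` S)"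
    using transition_open[OF d c] \<open>open S\<close> continuous_open_preimage by blast
  moreover have "\<theta> ` ({q \<in> U. \<phi> q \<in> S} \<inter> W) = \<theta> ` (W \<inter> U) \<inter> (\<phi> \<circ> inv_into W \<theta>) -` S"
    using d by auto
  ultimately show "open (\<theta> ` ({q \<in> U. \<phi> q \<in> S} \<inter> W))" by simp
qed

lemma chart_openin: "(U, \<phi>) \<in> M \<Longrightarrow> openin (atlas_topology M) U"
  using coordinate_openin[of U \<phi> UNIV] by simp

lemma eventually_coordinate:
  assumes "(U, \<phi>) \<in> M" "p \<in> U" "openin (atlas_topology M) W" "p \<in> W"
  shows "\<forall>\<^sub>F y in nhds (\<phi> p). y \<in> \<phi> ` U \<and> inv_into U \<phi> y \<in> U \<and> \<phi> (inv_into U \<phi> y) = y \<and> inv_into U \<phi> y \<in> W"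
proof -
  have "open (\<phi> ` (W \<inter> U))" "\<phi> p \<in> \<phi> ` (W \<inter> U)"
    using assms unfolding openin_iff by auto
  then have "\<forall>\<^sub>F y in nhds (\<phi> p). y \<in> \<phi> ` (W \<inter> U)"
    by (simp add: eventually_nhds_in_open)
  then show ?thesis
    by eventually_elim (use assms in auto)
qed

lemma neighbourhood_coordinate:
  assumes "(U, \<phi>) \<in> M" "p \<in> U" "\<forall>\<^sub>F y in nhds (\<phi> p). P (inv_into U \<phi> y)"
  obtains W where "openin (atlas_topology M) W" "p \<in> W" "W \<subseteq> U" "\<And>q. q \<in> W \<Longrightarrow> P q"
proof -
  obtain S where "open S" "\<phi> p \<in> S" "\<And>y. y \<in> S \<Longrightarrow> P (inv_into U \<phi> y)"
    using assms(3) unfolding eventually_nhds by blast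
  then have "P q" if "q \<in> {q \<in> U. \<phi> q \<in> S}" for q
    using that assms(1) by (metis (mono_tags, lifting) chart_inv mem_Collect_eq)
  then show ?thesis
    using that[OF coordinate_openin[OF assms(1) \<open>open S\<close>]] assms(2) \<open>\<phi> p \<in> S\<close> by simp
qed

lemma eventually_chart:
  assumes "(U, \<phi>) \<in> M" "p \<in> U"
  shows "\<forall>\<^sub>F y in nhds (\<phi> p). y \<in> \<phi> ` U \<and> inv_into U \<phi> y \<in> U \<and> \<phi> (inv_into U \<phi> y) = y"
  using eventually_coordinate[OF assms chart_openin[OF assms(1)] assms(2)]
  by (auto elim: eventually_mono)

lemma transition_smooth_at:
  assumes "(U, \<phi>) \<in> M" "(W, \<theta>) \<in> M" "p \<in> U" "p \<in> W"
  shows "smooth_at (\<phi> p) (\<lambda>y. \<theta> (inv_into U \<phi> y))"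
  using transition_smooth[OF assms(1,2)] transition_open[OF assms(1,2)] assms(3,4)
  unfolding smooth_at_def comp_def by (intro exI[of _ "\<phi> ` (U \<inter> W)"]) auto

lemma smooth_at_transition:
  assumes c: "(U, \<phi>) \<in> M" and d: "(W, \<theta>) \<in> M" and "p \<in> U" "p \<in> W"
    and f: "smooth_at (\<phi> p) (f \<circ> inv_into U \<phi>)"
  shows "smooth_at (\<theta> p) (f \<circ> inv_into W \<theta>)"
proof -
  have "smooth_at (\<theta> p) (\<lambda>y. (f \<circ> inv_into U \<phi>) (\<phi> (inv_into W \<theta> y)))"
    by (rule smooth_at_compose[where g = "\<lambda>y. \<phi> (inv_into W \<theta> y)"])
      (use assms transition_smooth_at in \<open>simp_all add: comp_def\<close>)
  moreover have "\<forall>\<^sub>F y in nhds (\<theta> p). (f \<circ> inv_into U \<phi>) (\<phi> (inv_into W \<theta> y)) = (f \<circ> inv_into W \<theta>) y"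
    using eventually_coordinate[OF d \<open>p \<in> W\<close> chart_openin[OF c] \<open>p \<in> U\<close>]
    by eventually_elim (use c in auto)
  ultimately show ?thesis
    by (rule smooth_at_transfer)
qed

text \<open>The definition quantifies over all charts; smooth transition maps let a single chart at
  \<open>p\<close> decide.\<close>

lemma smooth_near_iff:
  assumes c: "(U, \<phi>) \<in> M" and p: "p \<in> U"
  shows "smooth_near M p f \<longleftrightarrow> smooth_at (\<phi> p) (f \<circ> inv_into U \<phi>)"
proof
  assume "smooth_near M p f"
  then obtain W where W: "p \<in> W" "openin (atlas_topology M) W"
    "smooth_on (\<phi> ` (U \<inter> W)) (f \<circ> inv_into U \<phi>)"
    unfolding smooth_near_def smooth_fun_def using c by blast
  then have "open (\<phi> ` (U \<inter> W))"
    unfolding openin_iff using c by (auto simp: Int_commute)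
  then show "smooth_at (\<phi> p) (f \<circ> inv_into U \<phi>)"
    unfolding smooth_at_def using W p by (intro exI[of _ "\<phi> ` (U \<inter> W)"]) auto
next
  assume "smooth_at (\<phi> p) (f \<circ> inv_into U \<phi>)"
  then obtain S where S: "open S" "\<phi> p \<in> S" "smooth_on S (f \<circ> inv_into U \<phi>)"
    unfolding smooth_at_def by blast
  let ?W = "{q \<in> U. \<phi> q \<in> S}"
  have W: "openin (atlas_topology M) ?W"
    using coordinate_openin[OF c S(1)] .
  have "smooth_on (\<theta> ` (W \<inter> ?W)) (f \<circ> inv_into W \<theta>)" if d: "(W, \<theta>) \<in> M" for W \<theta>
  proof -
    have o: "open (\<theta> ` (W \<inter> ?W))"
      using W d unfolding openin_iff by (auto simp: Int_commute)
    show ?thesis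
      unfolding smooth_on_iff_smooth_at[OF o]
      using smooth_at_transition[OF c d] S unfolding smooth_at_def by blast
  qed
  then have "smooth_fun M ?W f"
    using W unfolding smooth_fun_def by blast
  then show "smooth_near M p f"
    unfolding smooth_near_def using p S by (intro exI[of _ ?W]) simp
qed

lemma smooth_fun_iff:
  "smooth_fun M W f \<longleftrightarrow> openin (atlas_topology M) W \<and> (\<forall>p\<in>W. smooth_near M p f)"
proof
  assume "smooth_fun M W f"
  then show "openin (atlas_topology M) W \<and> (\<forall>p\<in>W. smooth_near M p f)"
    unfolding smooth_near_def smooth_fun_def by blast
next
  assume W: "openin (atlas_topology M) W \<and> (\<forall>p\<in>W. smooth_near M p f)"
  have "smooth_on (\<phi> ` (U \<inter> W)) (f \<circ> inv_into U \<phi>)" if c: "(U, \<phi>) \<in> M" for U \<phi>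
  proof -
    have o: "open (\<phi> ` (U \<inter> W))"
      using W c unfolding openin_iff by (auto simp: Int_commute)
    show ?thesis
      unfolding smooth_on_iff_smooth_at[OF o] using W smooth_near_iff[OF c] by blast
  qed
  then show "smooth_fun M W f"
    unfolding smooth_fun_def using W by blast
qed

lemma carrierE:
  assumes "p \<in> carrier M" obtains U \<phi> where "(U, \<phi>) \<in> M" "p \<in> U"
  using assms unfolding carrier_def by blast

lemma chart_carrier: "(U, \<phi>) \<in> M \<Longrightarrow> p \<in> U \<Longrightarrow> p \<in> carrier M"
  unfolding carrier_def by blast

end

text \<open>\<open>\<sigma>\<close> gives the components of the section \<open>s\<close> near the point with coordinate \<open>y\<close>, where
  \<open>\<psi>\<close> is the inverse of a chart and \<open>e\<close> a local trivialization.\<close>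

definition rep :: "('e::real_normed_vector \<Rightarrow> 'a) \<Rightarrow> ('a \<Rightarrow> 'f::real_normed_vector \<Rightarrow> 'v) \<Rightarrow> 'e \<Rightarrow>
    ('a \<Rightarrow> 'v) \<Rightarrow> ('e \<Rightarrow> 'f) \<Rightarrow> bool" where
  "rep \<psi> e y s \<sigma> \<longleftrightarrow> smooth_at y \<sigma> \<and> (\<forall>\<^sub>F z in nhds y. s (\<psi> z) = e (\<psi> z) (\<sigma> z))"

lemma rep_smooth: "rep \<psi> e y s \<sigma> \<Longrightarrow> smooth_at y \<sigma>"
  unfolding rep_def by blast

lemma rep_eventually: "rep \<psi> e y s \<sigma> \<Longrightarrow> \<forall>\<^sub>F z in nhds y. rep \<psi> e z s \<sigma>"
  unfolding rep_def using smooth_at_eventually eventually_eventually eventually_conj by blast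

lemma rep_at: "rep \<psi> e y s \<sigma> \<Longrightarrow> s (\<psi> y) = e (\<psi> y) (\<sigma> y)"
  unfolding rep_def by (blast dest: eventually_nhds_x_imp_x)

section \<open>Sections and their local representatives\<close>

locale smooth_bundle = smooth_atlas M for M :: "('a, 'e::euclidean_space) atlas" +
  fixes V :: "('a, 'v::real_vector, 'f::euclidean_space) vbundle"
  assumes vb: "vector_bundle M V"
begin

lemma triv_openin: "(W, e) \<in> triv V \<Longrightarrow> openin (atlas_topology M) W"
  and triv_linear: "(W, e) \<in> triv V \<Longrightarrow> x \<in> W \<Longrightarrow> linear (e x)"
  and triv_inj: "(W, e) \<in> triv V \<Longrightarrow> x \<in> W \<Longrightarrow> inj (e x)"
  and triv_range: "(W, e) \<in> triv V \<Longrightarrow> x \<in> W \<Longrightarrow> range (e x) = fib V x"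
  and triv_cover: "(\<Union>(U, e)\<in>triv V. U) = carrier M"
  using vb unfolding vector_bundle_def by blast+

lemma triv_transition:
  "(W, e) \<in> triv V \<Longrightarrow> (W', d) \<in> triv V \<Longrightarrow> x \<in> W \<Longrightarrow> x \<in> W' \<Longrightarrow>
   smooth_near M x (\<lambda>x. inv (d x) (e x u))"
  using vb unfolding vector_bundle_def smooth_fun_iff by fast

lemma triv_inv [simp]: "(W, e) \<in> triv V \<Longrightarrow> x \<in> W \<Longrightarrow> inv (e x) (e x u) = u"
  using triv_inj by (simp add: inv_f_f)

lemma triv_fib [simp]: "(W, e) \<in> triv V \<Longrightarrow> x \<in> W \<Longrightarrow> e x u \<in> fib V x"
  using triv_range by blast

lemma inv_triv [simp]: "(W, e) \<in> triv V \<Longrightarrow> x \<in> W \<Longrightarrow> v \<in> fib V x \<Longrightarrow> e x (inv (e x) v) = v"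
  using triv_range by (metis f_inv_into_f)

lemma trivE:
  assumes "x \<in> carrier M" obtains W e where "(W, e) \<in> triv V" "x \<in> W"
  using assms triv_cover by blast

text \<open>\<open>inv (d x)\<close> is a genuine inverse only on \<open>fib V x\<close>. Linearity
  of the composite comes from the common range of the two trivializations.\<close>

lemma linear_transition:
  assumes "(W, e) \<in> triv V" "(W', d) \<in> triv V" "x \<in> W" "x \<in> W'"
  shows "linear (\<lambda>u. inv (d x) (e x u))"
proof -
  have "e x (a + b) = d x (inv (d x) (e x a) + inv (d x) (e x b))" for a b
    using assms by (simp add: linear_add[OF triv_linear])
  moreover have "e x (r *\<^sub>R a) = d x (r *\<^sub>R inv (d x) (e x a))" for r a
    using assms by (simp add: linear_scale[OF triv_linear])
  ultimately show ?thesis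
    using assms by (intro linearI) (metis triv_inv)+
qed

text \<open>One chart and one trivialization suffice: passing to another trivialization multiplies
  the representative by the transition matrix, a smooth family of linear maps.\<close>

lemma section_near_iff:
  assumes c: "(U, \<phi>) \<in> M" and t: "(W, e) \<in> triv V" and x: "x \<in> U" "x \<in> W"
  shows "smooth_section_near M V x s \<longleftrightarrow> (\<exists>\<sigma>. rep (inv_into U \<phi>) e (\<phi> x) s \<sigma>)"
proof
  assume "smooth_section_near M V x s"
  then obtain W' where W': "x \<in> W'" "openin (atlas_topology M) W'" "\<And>x. x \<in> W' \<Longrightarrow> s x \<in> fib V x"
    "smooth_fun M (W \<inter> W') (\<lambda>x. inv (e x) (s x))"
    unfolding smooth_section_near_def smooth_section_def using t by blast
  then have "smooth_near M x (\<lambda>x. inv (e x) (s x))"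
    using x unfolding smooth_near_def by blast
  then have sm: "smooth_at (\<phi> x) (\<lambda>y. inv (e (inv_into U \<phi> y)) (s (inv_into U \<phi> y)))"
    unfolding smooth_near_iff[OF c x(1)] comp_def .
  have "\<forall>\<^sub>F y in nhds (\<phi> x). s (inv_into U \<phi> y) =
      e (inv_into U \<phi> y) (inv (e (inv_into U \<phi> y)) (s (inv_into U \<phi> y)))"
    using eventually_coordinate[OF c x(1) W'(2,1)] eventually_coordinate[OF c x(1) triv_openin[OF t] x(2)]
    by eventually_elim (use t W' in simp)
  with sm show "\<exists>\<sigma>. rep (inv_into U \<phi>) e (\<phi> x) s \<sigma>"
    unfolding rep_def by blast
next
  assume "\<exists>\<sigma>. rep (inv_into U \<phi>) e (\<phi> x) s \<sigma>"
  then obtain \<sigma> where \<sigma>: "rep (inv_into U \<phi>) e (\<phi> x) s \<sigma>" by blast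
  have "\<forall>\<^sub>F y in nhds (\<phi> x). rep (inv_into U \<phi>) e (\<phi> (inv_into U \<phi> y)) s \<sigma> \<and> inv_into U \<phi> y \<in> W"
    using eventually_coordinate[OF c x(1) triv_openin[OF t] x(2)] rep_eventually[OF \<sigma>]
    by eventually_elim simp
  then obtain N where N: "openin (atlas_topology M) N" "x \<in> N" "N \<subseteq> U"
    "\<And>q. q \<in> N \<Longrightarrow> rep (inv_into U \<phi>) e (\<phi> q) s \<sigma> \<and> q \<in> W"
    using neighbourhood_coordinate[OF c x(1), of "\<lambda>q. rep (inv_into U \<phi>) e (\<phi> q) s \<sigma> \<and> q \<in> W"] by blast
  have "smooth_section M V N s"
    unfolding smooth_section_def
  proof safe
    fix q assume q: "q \<in> N"
    then have "s q = e q (\<sigma> (\<phi> q))"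
      using rep_at[OF conjunct1[OF N(4)[OF q]]] N(3) c by (simp add: subset_iff)
    then show "s q \<in> fib V q"
      using t N(4)[OF q] by simp
  next
    fix W' d assume d: "(W', d) \<in> triv V"
    show "smooth_fun M (W' \<inter> N) (\<lambda>x. inv (d x) (s x))"
      unfolding smooth_fun_iff
    proof safe
      show "openin (atlas_topology M) (W' \<inter> N)"
        using triv_openin[OF d] N(1) by blast
    next
      fix q assume q: "q \<in> W'" "q \<in> N"
      then have qU: "q \<in> U" "q \<in> W" using N by auto
      note ev = eventually_coordinate[OF c qU(1) triv_openin[OF t] qU(2)]
        eventually_coordinate[OF c qU(1) triv_openin[OF d] q(1)]
      have "\<forall>\<^sub>F y in nhds (\<phi> q). linear (\<lambda>u. inv (d (inv_into U \<phi> y)) (e (inv_into U \<phi> y) u))"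
        using ev by eventually_elim (use linear_transition[OF t d] in blast)
      moreover have "smooth_at (\<phi> q) (\<lambda>y. inv (d (inv_into U \<phi> y)) (e (inv_into U \<phi> y) u))" for u
        using triv_transition[OF t d qU(2) q(1)] unfolding smooth_near_iff[OF c qU(1)] comp_def .
      ultimately have "smooth_at (\<phi> q) (\<lambda>y. inv (d (inv_into U \<phi> y)) (e (inv_into U \<phi> y) (\<sigma> y)))"
        by (rule smooth_at_family(1)) (use N(4)[OF q(2)] rep_smooth in blast)
      moreover have "\<forall>\<^sub>F y in nhds (\<phi> q). inv (d (inv_into U \<phi> y)) (e (inv_into U \<phi> y) (\<sigma> y)) =
          inv (d (inv_into U \<phi> y)) (s (inv_into U \<phi> y))"
        using N(4)[OF q(2)] unfolding rep_def by (auto elim: eventually_mono)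
      ultimately show "smooth_near M q (\<lambda>x. inv (d x) (s x))"
        unfolding smooth_near_iff[OF c qU(1)] comp_def by (rule smooth_at_transfer)
    qed
  qed (rule N(1))
  then show "smooth_section_near M V x s"
    unfolding smooth_section_near_def using N(2) by blast
qed

lemma section_nearD:
  assumes "smooth_section_near M V x s"
  shows "s x \<in> fib V x" "x \<in> carrier M"
  using assms unfolding smooth_section_near_def smooth_section_def openin_iff by blast+

lemma smooth_section_iff:
  "smooth_section M V N s \<longleftrightarrow> openin (atlas_topology M) N \<and> (\<forall>x\<in>N. smooth_section_near M V x s)"
proof
  assume "smooth_section M V N s"
  then show "openin (atlas_topology M) N \<and> (\<forall>x\<in>N. smooth_section_near M V x s)"
    unfolding smooth_section_near_def smooth_section_def by blast
next
  assume N: "openin (atlas_topology M) N \<and> (\<forall>x\<in>N. smooth_section_near M V x s)"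
  have "smooth_near M x (\<lambda>x. inv (e x) (s x))" if t: "(W, e) \<in> triv V" and x: "x \<in> W" "x \<in> N" for W e x
  proof -
    obtain W' where "x \<in> W'" "smooth_fun M (W \<inter> W') (\<lambda>x. inv (e x) (s x))"
      using N x t unfolding smooth_section_near_def smooth_section_def by blast
    then show ?thesis
      unfolding smooth_near_def using x by blast
  qed
  then show "smooth_section M V N s"
    unfolding smooth_section_def smooth_fun_iff using N section_nearD triv_openin by blast
qed

lemma constant_section_near:
  assumes "(W, e) \<in> triv V" "x \<in> W"
  shows "smooth_section_near M V x (\<lambda>y. e y u)"
proof -
  obtain U \<phi> where c: "(U, \<phi>) \<in> M" "x \<in> U"
    using assms triv_openin unfolding openin_iff carrier_def by blast
  then show ?thesis
    unfolding section_near_iff[OF c(1) assms(1) c(2) assms(2)] rep_def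
    by (intro exI[of _ "\<lambda>_. u"]) simp
qed

end

lemma (in smooth_atlas) bundleI: "vector_bundle M V \<Longrightarrow> smooth_bundle M V"
  by unfold_locales

section \<open>The tangent bundle as a vector bundle\<close>

context smooth_atlas
begin

lemma dir_deriv_apply:
  "smooth_near M p f \<Longrightarrow> dir_deriv M (U, \<phi>) p u f = fd (f \<circ> inv_into U \<phi>) (\<phi> p) u"
  by (simp add: dir_deriv_def)

lemma dir_deriv_linear:
  assumes c: "(U, \<phi>) \<in> M" "p \<in> U"
  shows "linear (dir_deriv M (U, \<phi>) p)"
proof -
  have "linear (fd (f \<circ> inv_into U \<phi>) (\<phi> p))" if "smooth_near M p f" for f :: "'a \<Rightarrow> real"
    using that linear_fd unfolding smooth_near_iff[OF c] by blast
  then show ?thesis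
    by (intro linearI) (auto simp: dir_deriv_def fun_eq_iff plus_fun_def scaleR_fun_def linear_add linear_scale)
qed

lemma smooth_near_chart:
  assumes "(U, \<phi>) \<in> M" "(W, \<theta>) \<in> M" "p \<in> U" "p \<in> W"
  shows "smooth_near M p (\<lambda>q. \<phi> q \<bullet> b)"
  unfolding smooth_near_iff[OF assms(2,4)] comp_def
  by (intro smooth_at_intros transition_smooth_at[OF assms(2,1,4,3)])

text \<open>Coordinate functions recover the components of a tangent vector, which is given only as
  a functional. This yields injectivity of \<open>dir_deriv\<close>.\<close>

lemma dir_deriv_coordinate:
  assumes c: "(U, \<phi>) \<in> M" "p \<in> U"
  shows "dir_deriv M (U, \<phi>) p u (\<lambda>q. \<phi> q \<bullet> b) = u \<bullet> b"
proof -
  have "\<forall>\<^sub>F y in nhds (\<phi> p). ((\<lambda>q. \<phi> q \<bullet> b) \<circ> inv_into U \<phi>) y = y \<bullet> b"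
    using eventually_chart[OF c] by eventually_elim simp
  then have "fd ((\<lambda>q. \<phi> q \<bullet> b) \<circ> inv_into U \<phi>) (\<phi> p) u = fd (\<lambda>y. y \<bullet> b) (\<phi> p) u"
    using fd_cong by metis
  also have "\<dots> = u \<bullet> b"
    by (simp add: fd_inner smooth_at_intros)
  finally show ?thesis
    using smooth_near_chart[OF c(1) c(1) c(2) c(2)] by (simp add: dir_deriv_apply)
qed

lemma dir_deriv_inj: "(U, \<phi>) \<in> M \<Longrightarrow> p \<in> U \<Longrightarrow> inj (dir_deriv M (U, \<phi>) p)"
proof (rule injI, rule euclidean_eqI)
  fix u v b assume "(U, \<phi>) \<in> M" "p \<in> U" and eq: "dir_deriv M (U, \<phi>) p u = dir_deriv M (U, \<phi>) p v"
  then show "u \<bullet> b = v \<bullet> b"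
    using dir_deriv_coordinate[of U \<phi> p u b] dir_deriv_coordinate[of U \<phi> p v b] by simp
qed

text \<open>The chain rule: components change by the Jacobian of the transition map. On functions
  that are not smooth near \<open>p\<close> both sides take the default value
  \<open>0\<close>.\<close>

lemma dir_deriv_transition:
  assumes c: "(U, \<phi>) \<in> M" "p \<in> U" and d: "(W, \<theta>) \<in> M" "p \<in> W"
  shows "dir_deriv M (W, \<theta>) p (fd (\<lambda>y. \<theta> (inv_into U \<phi> y)) (\<phi> p) u) = dir_deriv M (U, \<phi>) p u"
proof
  fix f
  show "dir_deriv M (W, \<theta>) p (fd (\<lambda>y. \<theta> (inv_into U \<phi> y)) (\<phi> p) u) f = dir_deriv M (U, \<phi>) p u f"
  proof (cases "smooth_near M p f")
    case True
    have "\<forall>\<^sub>F y in nhds (\<phi> p). (f \<circ> inv_into U \<phi>) y = (f \<circ> inv_into W \<theta>) (\<theta> (inv_into U \<phi> y))"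
      using eventually_coordinate[OF c chart_openin[OF d(1)] d(2)]
      by eventually_elim (use d in simp)
    then have "fd (f \<circ> inv_into U \<phi>) (\<phi> p) u = fd (\<lambda>y. (f \<circ> inv_into W \<theta>) (\<theta> (inv_into U \<phi> y))) (\<phi> p) u"
      using fd_cong by metis
    also have "\<dots> = fd (f \<circ> inv_into W \<theta>) (\<theta> p) (fd (\<lambda>y. \<theta> (inv_into U \<phi> y)) (\<phi> p) u)"
      by (subst fd_compose[where f = "f \<circ> inv_into W \<theta>" and g = "\<lambda>y. \<theta> (inv_into U \<phi> y)"])
        (use True smooth_near_iff[OF d, of f] transition_smooth_at[OF c(1) d(1) c(2) d(2)] c in simp_all)
    finally show ?thesis
      using True by (simp add: dir_deriv_apply)
  qed (simp add: dir_deriv_def)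
qed

lemma tangent_space_range:
  assumes "(U, \<phi>) \<in> M" "p \<in> U"
  shows "tangent_space M p = range (dir_deriv M (U, \<phi>) p)"
proof
  show "tangent_space M p \<subseteq> range (dir_deriv M (U, \<phi>) p)"
  proof
    fix v assume "v \<in> tangent_space M p"
    then obtain W \<theta> u where "(W, \<theta>) \<in> M" "p \<in> W" "v = dir_deriv M (W, \<theta>) p u"
      unfolding tangent_bundle_def by auto
    then show "v \<in> range (dir_deriv M (U, \<phi>) p)"
      using dir_deriv_transition[OF _ _ assms] by (metis rangeI)
  qed
  show "range (dir_deriv M (U, \<phi>) p) \<subseteq> tangent_space M p"
    unfolding tangent_bundle_def using assms by auto
qed

lemma vector_bundleI:
  assumes "(\<Union>(U, e)\<in>triv V. U) = carrier M"
    and o: "\<And>U e. (U, e) \<in> triv V \<Longrightarrow> openin (atlas_topology M) U"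
    and "\<And>U e x. (U, e) \<in> triv V \<Longrightarrow> x \<in> U \<Longrightarrow> linear (e x) \<and> inj (e x) \<and> range (e x) = fib V x"
    and "\<And>U e W d x u. (U, e) \<in> triv V \<Longrightarrow> (W, d) \<in> triv V \<Longrightarrow> x \<in> U \<Longrightarrow> x \<in> W \<Longrightarrow>
      smooth_near M x (\<lambda>x. inv (d x) (e x u))"
  shows "vector_bundle M V"
proof -
  have "smooth_fun M (U \<inter> W) (\<lambda>x. inv (d x) (e x u))" if "(U, e) \<in> triv V" "(W, d) \<in> triv V" for U e W d u
    unfolding smooth_fun_iff using assms(4)[OF that] o[OF that(1)] o[OF that(2)] by (simp add: openin_Int)
  then show ?thesis
    unfolding vector_bundle_def using assms(1-3) by blast
qed

text \<open>The transition matrix is the Jacobian of the transition map; its columns are directional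
  derivatives of a smooth map.\<close>

lemma vector_bundle_tangent: "vector_bundle M (tangent_bundle M)"
proof (rule vector_bundleI)
  show "(\<Union>(U, e)\<in>triv (tangent_bundle M). U) = carrier M"
    by (auto simp: tangent_bundle_def carrier_def)
next
  fix U e assume "(U, e) \<in> triv (tangent_bundle M)"
  then obtain \<phi> where "e = dir_deriv M (U, \<phi>)" "(U, \<phi>) \<in> M"
    by (auto simp: tangent_bundle_def)
  then show "openin (atlas_topology M) U"
    "\<And>x. x \<in> U \<Longrightarrow> linear (e x) \<and> inj (e x) \<and> range (e x) = tangent_space M x"
    using chart_openin dir_deriv_linear dir_deriv_inj tangent_space_range by blast+
next
  fix U e W d p u
  assume "(U, e) \<in> triv (tangent_bundle M)" "(W, d) \<in> triv (tangent_bundle M)" and p: "p \<in> U" "p \<in> W"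
  then obtain \<phi> \<theta> where a: "e = dir_deriv M (U, \<phi>)" "(U, \<phi>) \<in> M"
    and b: "d = dir_deriv M (W, \<theta>)" "(W, \<theta>) \<in> M"
    by (auto simp: tangent_bundle_def)
  have ev: "\<forall>\<^sub>F y in nhds (\<phi> p). fd (\<lambda>y. \<theta> (inv_into U \<phi> y)) y u =
     ((\<lambda>x. inv (d x) (e x u)) \<circ> inv_into U \<phi>) y"
    using eventually_coordinate[OF a(2) p(1) chart_openin[OF b(2)] p(2)]
  proof eventually_elim
    case (elim y)
    then have "e (inv_into U \<phi> y) u = d (inv_into U \<phi> y) (fd (\<lambda>y. \<theta> (inv_into U \<phi> y)) y u)"
      using dir_deriv_transition[OF a(2) _ b(2), of "inv_into U \<phi> y" u] a b by simp
    then show ?case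
      using dir_deriv_inj[OF b(2)] elim b by (simp add: inv_f_f)
  qed
  show "smooth_near M p (\<lambda>x. inv (d x) (e x u))"
    unfolding smooth_near_iff[OF a(2) p(1)] smooth_at_cong[OF ev, symmetric]
    by (intro smooth_at_intros transition_smooth_at[OF a(2) b(2) p])
qed

end

section \<open>Dual bundles and direct sums\<close>

definition dual_frame ::
  "('a, 'v::real_vector, 'f::euclidean_space) vbundle \<Rightarrow> ('a \<Rightarrow> 'f \<Rightarrow> 'v) \<Rightarrow> 'a \<Rightarrow> 'f \<Rightarrow> 'v \<Rightarrow> real" where
  "dual_frame V e = (\<lambda>x u v. if v \<in> fib V x then u \<bullet> inv (e x) v else 0)"

lemma triv_dual_bundle: "triv (dual_bundle V) = (\<lambda>(U, e). (U, dual_frame V e)) ` triv V"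
  and fib_dual_bundle: "fib (dual_bundle V) x = dual_space (fib V x)"
  by (simp_all add: dual_bundle_def dual_frame_def)

lemma triv_sum_bundle: "triv (sum_bundle V W) =
    (\<lambda>((U, e), (U', e')). (U \<inter> U', \<lambda>x. map_prod (e x) (e' x))) ` (triv V \<times> triv W)"
  and fib_sum_bundle: "fib (sum_bundle V W) x = fib V x \<times> fib W x"
  by (simp_all add: sum_bundle_def map_prod_def)

context smooth_bundle
begin

lemma dual_frame_apply [simp]:
  "(W, e) \<in> triv V \<Longrightarrow> x \<in> W \<Longrightarrow> dual_frame V e x u (e x w) = u \<bullet> w"
  by (simp add: dual_frame_def)

lemma dual_frame_linear:
  assumes "(W, e) \<in> triv V" "x \<in> W"
  shows "linear (dual_frame V e x)"
  by (rule linearI) (auto simp: dual_frame_def fun_eq_iff plus_fun_def scaleR_fun_def inner_add_left)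

lemma dual_frame_inj:
  assumes "(W, e) \<in> triv V" "x \<in> W"
  shows "inj (dual_frame V e x)"
proof (rule injI, rule euclidean_eqI)
  fix u v b assume eq: "dual_frame V e x u = dual_frame V e x v"
  show "u \<bullet> b = v \<bullet> b"
    using dual_frame_apply[OF assms, of u b] dual_frame_apply[OF assms, of v b] eq by simp
qed

lemma dual_frame_range:
  assumes t: "(W, e) \<in> triv V" "x \<in> W"
  shows "range (dual_frame V e x) = dual_space (fib V x)"
proof safe
  fix u
  have "e x a + e x b = e x (a + b)" "c *\<^sub>R e x a = e x (c *\<^sub>R a)" for a b c
    using linear_add[OF triv_linear[OF t]] linear_scale[OF triv_linear[OF t]] by simp_all
  then have "dual_frame V e x u (e x a + e x b) = u \<bullet> a + u \<bullet> b"
    "dual_frame V e x u (c *\<^sub>R e x a) = c * (u \<bullet> a)" for a b c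
    using t by (simp_all add: inner_add_right)
  moreover have "dual_frame V e x u v = 0" if "v \<notin> range (e x)" for v
    using that triv_range[OF t] by (simp add: dual_frame_def)
  ultimately show "dual_frame V e x u \<in> dual_space (fib V x)"
    unfolding dual_space_def triv_range[OF t, symmetric] using t by auto
next
  fix f assume f: "f \<in> dual_space (fib V x)"
  have lin: "linear (\<lambda>w. f (e x w))"
  proof (rule linearI)
    show "f (e x (a + b)) = f (e x a) + f (e x b)" for a b
      using f t by (simp add: dual_space_def linear_add[OF triv_linear[OF t]])
    show "f (e x (r *\<^sub>R a)) = r *\<^sub>R f (e x a)" for a r
      using f t by (simp add: dual_space_def linear_scale[OF triv_linear[OF t]])
  qed
  \<comment> \<open>The coefficients of \<open>f\<close> in the dual frame are its values on the
    frame vectors \<open>e x b\<close>.\<close>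
  have "f = dual_frame V e x (\<Sum>b\<in>Basis. f (e x b) *\<^sub>R b)"
  proof
    fix v
    show "f v = dual_frame V e x (\<Sum>b\<in>Basis. f (e x b) *\<^sub>R b) v"
    proof (cases "v \<in> fib V x")
      case True
      then have "f v = f (e x (inv (e x) v))"
        using t by simp
      also have "\<dots> = (\<Sum>b\<in>Basis. f (e x b) *\<^sub>R b) \<bullet> inv (e x) v"
        by (subst linear_expand[OF lin]) (simp add: inner_sum_left inner_sum_right inner_commute mult.commute)
      finally show ?thesis
        using True by (simp add: dual_frame_def)
    next
      case False
      then show ?thesis using f by (simp add: dual_frame_def dual_space_def)
    qed
  qed
  then show "f \<in> range (dual_frame V e x)" by blast
qed

lemma vector_bundle_dual: "vector_bundle M (dual_bundle V)"
proof (rule vector_bundleI)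
  show "(\<Union>(U, e)\<in>triv (dual_bundle V). U) = carrier M"
    unfolding triv_cover[symmetric] by (auto simp: triv_dual_bundle)
next
  fix U e assume "(U, e) \<in> triv (dual_bundle V)"
  then obtain e' where "e = dual_frame V e'" "(U, e') \<in> triv V"
    by (auto simp: triv_dual_bundle)
  then show "openin (atlas_topology M) U"
    "\<And>x. x \<in> U \<Longrightarrow> linear (e x) \<and> inj (e x) \<and> range (e x) = fib (dual_bundle V) x"
    using triv_openin dual_frame_linear dual_frame_inj dual_frame_range
    by (simp_all add: fib_dual_bundle)
next
  fix U e' W d' p u
  assume "(U, e') \<in> triv (dual_bundle V)" "(W, d') \<in> triv (dual_bundle V)" and p: "p \<in> U" "p \<in> W"
  then obtain e d where a: "e' = dual_frame V e" "(U, e) \<in> triv V"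
    and b: "d' = dual_frame V d" "(W, d) \<in> triv V"
    by (auto simp: triv_dual_bundle)
  \<comment> \<open>Between dual frames the transition matrix is the transpose of
    \<open>\<lambda>w. inv (e x) (d x w)\<close>, the transition in the opposite direction.\<close>
  have eq: "inv (d' x) (e' x u) = (\<Sum>b\<in>Basis. (u \<bullet> inv (e x) (d x b)) *\<^sub>R b)"
    if x: "x \<in> U" "x \<in> W" for x u
  proof -
    have "e' x u = d' x (\<Sum>b\<in>Basis. (u \<bullet> inv (e x) (d x b)) *\<^sub>R b)"
    proof
      fix v
      show "e' x u v = d' x (\<Sum>b\<in>Basis. (u \<bullet> inv (e x) (d x b)) *\<^sub>R b) v"
      proof (cases "v \<in> fib V x")
        case True
        have "u \<bullet> inv (e x) (d x w) = (\<Sum>b\<in>Basis. (u \<bullet> inv (e x) (d x b)) *\<^sub>R b) \<bullet> w" for w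
          by (subst linear_expand[OF linear_transition[OF b(2) a(2) x(2,1)]])
            (simp add: inner_sum_left inner_sum_right inner_commute mult.commute)
        from this[of "inv (d x) v"] show ?thesis
          unfolding a b dual_frame_def using True x b(2) by simp
      qed (simp add: dual_frame_def a b)
    qed
    then show ?thesis
      using dual_frame_inj[OF b(2) x(2)] b(1) by (simp add: inv_f_f)
  qed
  obtain C \<phi> where c: "(C, \<phi>) \<in> M" "p \<in> C"
    using p a(2) triv_openin unfolding openin_iff carrier_def by blast
  have ev: "\<forall>\<^sub>F y in nhds (\<phi> p).
     ((\<lambda>x. inv (d' x) (e' x u)) \<circ> inv_into C \<phi>) y =
     (\<Sum>b\<in>Basis. (u \<bullet> ((\<lambda>x. inv (e x) (d x b)) \<circ> inv_into C \<phi>) y) *\<^sub>R b)"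
    using eventually_coordinate[OF c triv_openin[OF a(2)] p(1)]
      eventually_coordinate[OF c triv_openin[OF b(2)] p(2)]
    by eventually_elim (simp add: eq)
  show "smooth_near M p (\<lambda>x. inv (d' x) (e' x u))"
    unfolding smooth_near_iff[OF c] smooth_at_cong[OF ev]
    by (intro smooth_at_intros triv_transition[OF b(2) a(2) p(2,1), unfolded smooth_near_iff[OF c]])
qed

end

lemma inv_map_prod:
  assumes "inj f" "inj g" "a \<in> range f" "b \<in> range g"
  shows "inv (map_prod f g) (a, b) = (inv f a, inv g b)"
  using assms inv_f_f[OF prod.inj_map[OF assms(1,2)], of "(inv f a, inv g b)"] by (simp add: f_inv_into_f)

lemma vector_bundle_sum:
  fixes V :: "('a, 'v::real_vector, 'f::euclidean_space) vbundle"
    and W :: "('a, 'w::real_vector, 'g::euclidean_space) vbundle"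
    and M :: "('a, 'e::euclidean_space) atlas"
  assumes "smooth_bundle M V" "smooth_bundle M W"
  shows "vector_bundle M (sum_bundle V W)"
proof -
  interpret V: smooth_bundle M V by fact
  interpret W: smooth_bundle M W by fact
  have lin: "linear (map_prod f g)" if "linear f" "linear g"
    for f :: "'f \<Rightarrow> 'v" and g :: "'g \<Rightarrow> 'w"
    using that by (intro linearI) (auto simp: linear_add linear_scale)
  show ?thesis
  proof (rule V.vector_bundleI)
    have "(\<Union>(U, e)\<in>triv (sum_bundle V W). U) = (\<Union>(U, e)\<in>triv V. U) \<inter> (\<Union>(U, e)\<in>triv W. U)"
      by (auto simp: triv_sum_bundle)
    then show "(\<Union>(U, e)\<in>triv (sum_bundle V W). U) = carrier M"
      using V.triv_cover W.triv_cover by simp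
  next
    fix Y e assume "(Y, e) \<in> triv (sum_bundle V W)"
    then obtain U e1 U' e2 where a: "Y = U \<inter> U'" "e = (\<lambda>x. map_prod (e1 x) (e2 x))"
      "(U, e1) \<in> triv V" "(U', e2) \<in> triv W"
      by (auto simp: triv_sum_bundle)
    then show "openin (atlas_topology M) Y"
      using V.triv_openin W.triv_openin by (simp add: openin_Int)
    fix x assume x: "x \<in> Y"
    have "range (map_prod (e1 x) (e2 x)) = fib V x \<times> fib W x"
      using map_prod_surj_on[of "e1 x" UNIV "fib V x" "e2 x" UNIV "fib W x"]
        V.triv_range W.triv_range a x by simp
    then show "linear (e x) \<and> inj (e x) \<and> range (e x) = fib (sum_bundle V W) x"
      using V.triv_inj W.triv_inj V.triv_linear W.triv_linear a x
      by (simp add: fib_sum_bundle lin prod.inj_map)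
  next
    fix Y1 e Y2 d p u
    assume "(Y1, e) \<in> triv (sum_bundle V W)" "(Y2, d) \<in> triv (sum_bundle V W)" "p \<in> Y1" "p \<in> Y2"
    then obtain U e1 U' e2 Y d1 Y' d2 where
      a: "e = (\<lambda>x. map_prod (e1 x) (e2 x))" "(U, e1) \<in> triv V" "(U', e2) \<in> triv W" and
      b: "d = (\<lambda>x. map_prod (d1 x) (d2 x))" "(Y, d1) \<in> triv V" "(Y', d2) \<in> triv W" and
      p: "p \<in> U" "p \<in> U'" "p \<in> Y" "p \<in> Y'"
      by (auto simp: triv_sum_bundle)
    obtain C \<phi> where c: "(C, \<phi>) \<in> M" "p \<in> C"
      using p a(2) V.triv_openin unfolding V.openin_iff carrier_def by blast
    have ev: "\<forall>\<^sub>F y in nhds (\<phi> p). ((\<lambda>x. inv (d x) (e x u)) \<circ> inv_into C \<phi>) y =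
       (((\<lambda>x. inv (d1 x) (e1 x (fst u))) \<circ> inv_into C \<phi>) y, ((\<lambda>x. inv (d2 x) (e2 x (snd u))) \<circ> inv_into C \<phi>) y)"
      using V.eventually_coordinate[OF c V.triv_openin[OF a(2)] p(1)]
        V.eventually_coordinate[OF c V.triv_openin[OF b(2)] p(3)]
        V.eventually_coordinate[OF c W.triv_openin[OF a(3)] p(2)]
        V.eventually_coordinate[OF c W.triv_openin[OF b(3)] p(4)]
    proof eventually_elim
      case (elim y)
      let ?x = "inv_into C \<phi> y"
      have "e1 ?x v \<in> range (d1 ?x)" "e2 ?x v' \<in> range (d2 ?x)" for v v'
        using V.triv_range[OF a(2)] V.triv_range[OF b(2)] W.triv_range[OF a(3)] W.triv_range[OF b(3)]
          elim by blast+
      then show ?case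
        using V.triv_inj[OF b(2)] W.triv_inj[OF b(3)] elim a b
        by (simp add: inv_map_prod map_prod_def[of "e1 _"] case_prod_beta del: V.triv_fib W.triv_fib)
    qed
    show "smooth_near M p (\<lambda>x. inv (d x) (e x u))"
      unfolding V.smooth_near_iff[OF c] smooth_at_cong[OF ev]
      by (intro smooth_at_intros V.triv_transition[OF a(2) b(2) p(1,3), unfolded V.smooth_near_iff[OF c]]
        W.triv_transition[OF a(3) b(3) p(2,4), unfolded V.smooth_near_iff[OF c]])
  qed
qed

section \<open>The Courant bracket in a chart\<close>

definition double_frame ::
  "('a, 'v::real_vector, 'f::euclidean_space) vbundle \<Rightarrow> ('a \<Rightarrow> 'f \<Rightarrow> 'v) \<Rightarrow> 'a \<Rightarrow> 'f \<times> 'f \<Rightarrow> 'v \<times> ('v \<Rightarrow> real)" where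
  "double_frame V e = (\<lambda>x. map_prod (e x) (dual_frame V e x))"

lemma (in smooth_bundle) double_bundle: "smooth_bundle M (double_bundle V)"
  by (intro bundleI vector_bundle_sum vector_bundle_dual vb)

lemma (in smooth_bundle) triv_double:
  assumes "(W, e) \<in> triv V"
  shows "(W, double_frame V e) \<in> triv (double_bundle V)"
proof -
  have "((W, e), (W, dual_frame V e)) \<in> triv V \<times> triv (dual_bundle V)"
    using assms by (auto simp: triv_dual_bundle)
  from imageI[OF this, of "\<lambda>((U, e), (U', e')). (U \<inter> U', \<lambda>x. map_prod (e x) (e' x))"]
  show ?thesis
    by (simp add: triv_sum_bundle double_frame_def)
qed

lemma double_frame_apply: "double_frame V e x a = (e x (fst a), dual_frame V e x (snd a))"
  by (simp add: double_frame_def map_prod_def case_prod_beta)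

text \<open>This is \<open>-2\<close> times \<open>pairing\<close> in the coordinates of a frame and
  its dual frame (\<open>pairing_double_frame\<close>); orthogonality is not affected by the
  factor.\<close>

definition cpair :: "'f::euclidean_space \<times> 'f \<Rightarrow> 'f \<times> 'f \<Rightarrow> real" where
  "cpair a b = snd a \<bullet> fst b + snd b \<bullet> fst a"

lemma cpair_add_left: "cpair (a + b) c = cpair a c + cpair b c"
  and cpair_add_right: "cpair a (b + c) = cpair a b + cpair a c"
  and cpair_diff_left: "cpair (a - b) c = cpair a c - cpair b c"
  and cpair_minus_right: "cpair a (- c) = - cpair a c"
  and cpair_scaleR_left: "cpair (r *\<^sub>R a) c = r * cpair a c"
  and cpair_scaleR_right: "cpair a (r *\<^sub>R c) = r * cpair a c"
  by (simp_all add: cpair_def inner_add_left inner_add_right inner_diff_left inner_diff_right algebra_simps)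

lemma cpair_commute: "cpair a b = cpair b a"
  by (simp add: cpair_def)

text \<open>Nondegeneracy. Equations between brackets can be checked after pairing with an arbitrary
  vector.\<close>

lemma cpair_eqI:
  assumes "\<And>c. cpair a c = cpair b c" shows "a = b"
proof -
  have "fst a \<bullet> w = fst b \<bullet> w" for w
    using assms[of "(0, w)"] by (simp add: cpair_def inner_commute)
  moreover have "snd a \<bullet> w = snd b \<bullet> w" for w
    using assms[of "(w, 0)"] by (simp add: cpair_def)
  ultimately show ?thesis
    using vector_eq_rdot by (blast intro: prod_eqI)
qed

lemma bilinear_cpair: "bilinear cpair"
  unfolding bilinear_def
  by (intro conjI allI linearI)
    (simp_all only: cpair_add_left cpair_add_right cpair_scaleR_left cpair_scaleR_right real_scaleR_def)

lemmas smooth_at_cpair = smooth_at_bilinear[OF bilinear_cpair[unfolded bilinear_conv_bounded_bilinear]]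
  and fd_cpair = fd_bilinear[OF bilinear_cpair[unfolded bilinear_conv_bounded_bilinear]]

text \<open>By Cartan's formula the Lie derivatives and the exact term of the Courant bracket combine
  into derivatives of the two sections, up to a correction that only involves the pairing.\<close>

definition ccourant :: "('e::euclidean_space \<Rightarrow> 'e \<times> 'e) \<Rightarrow> ('e \<Rightarrow> 'e \<times> 'e) \<Rightarrow> 'e \<Rightarrow> 'e \<times> 'e" where
  "ccourant \<sigma> \<tau> x = fd \<tau> x (fst (\<sigma> x)) - fd \<sigma> x (fst (\<tau> x)) +
    (0, \<Sum>b\<in>Basis. ((cpair (fd \<sigma> x b) (\<tau> x) - cpair (\<sigma> x) (fd \<tau> x b)) / 2) *\<^sub>R b)"

text \<open>The basis sum in \<open>ccourant\<close> is the covector that represents the linear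
  functional \<open>?h\<close>; paired with \<open>z\<close> it returns the value of
  \<open>?h\<close> on the vector part of \<open>z\<close>.\<close>

lemma cpair_ccourant:
  assumes "smooth_at x \<sigma>" "smooth_at x \<tau>"
  shows "cpair (ccourant \<sigma> \<tau> x) z = cpair (fd \<tau> x (fst (\<sigma> x))) z - cpair (fd \<sigma> x (fst (\<tau> x))) z
    + (cpair (fd \<sigma> x (fst z)) (\<tau> x) - cpair (\<sigma> x) (fd \<tau> x (fst z))) / 2"
proof -
  let ?h = "\<lambda>w. (cpair (fd \<sigma> x w) (\<tau> x) - cpair (\<sigma> x) (fd \<tau> x w)) / 2"
  have "linear ?h"
    using linear_fd[OF assms(1)] linear_fd[OF assms(2)]
    by (intro linearI) (simp_all add: linear_add linear_scale cpair_add_left cpair_add_right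
      cpair_scaleR_left cpair_scaleR_right add_divide_distrib diff_divide_distrib algebra_simps)
  from linear_expand[OF this, of "fst z"]
  have "?h (fst z) = (\<Sum>b\<in>Basis. ?h b *\<^sub>R b) \<bullet> fst z"
    by (simp add: inner_sum_left inner_sum_right inner_commute mult.commute)
  then have "cpair (0, \<Sum>b\<in>Basis. ?h b *\<^sub>R b) z = ?h (fst z)"
    by (simp add: cpair_def)
  then show ?thesis
    unfolding ccourant_def cpair_add_left cpair_diff_left by simp
qed

lemma smooth_at_ccourant:
  assumes "smooth_at x \<sigma>" "smooth_at x \<tau>"
  shows "smooth_at x (ccourant \<sigma> \<tau>)"
proof -
  have *: "ccourant \<sigma> \<tau> = (\<lambda>x. fd \<tau> x (fst (\<sigma> x)) - fd \<sigma> x (fst (\<tau> x)) +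
    (0, \<Sum>b\<in>Basis. ((1/2) *\<^sub>R (cpair (fd \<sigma> x b) (\<tau> x) - cpair (\<sigma> x) (fd \<tau> x b))) *\<^sub>R b))"
    by (simp add: ccourant_def fun_eq_iff)
  show ?thesis
    unfolding * by (intro smooth_at_intros smooth_at_cpair assms)
qed

lemma rep_cong_eventually:
  assumes "rep \<psi> e y s \<sigma>" "\<forall>\<^sub>F z in nhds y. s (\<psi> z) = t (\<psi> z)"
  shows "rep \<psi> e y t \<sigma>"
  using assms eventually_elim2 unfolding rep_def by (smt (verit, best) eventually_mono eventually_conj)

section \<open>Lie brackets, Lie derivatives and the Courant bracket in coordinates\<close>

context smooth_atlas
begin

sublocale TM: smooth_bundle M "tangent_bundle M"
  by (intro bundleI vector_bundle_tangent)

lemma triv_tangent: "(U, \<phi>) \<in> M \<Longrightarrow> (U, dir_deriv M (U, \<phi>)) \<in> triv (tangent_bundle M)"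
  by (auto simp: tangent_bundle_def)

lemma smooth_near_eventually:
  assumes c: "(U, \<phi>) \<in> M" "p \<in> U" and f: "smooth_near M p f"
  shows "\<forall>\<^sub>F y in nhds (\<phi> p). smooth_near M (inv_into U \<phi> y) f \<and> smooth_at y (f \<circ> inv_into U \<phi>)"
proof -
  have "smooth_at (\<phi> p) (f \<circ> inv_into U \<phi>)"
    using f unfolding smooth_near_iff[OF c] .
  from smooth_at_eventually[OF this] eventually_chart[OF c] show ?thesis
    by eventually_elim (simp add: smooth_near_iff[OF c(1)])
qed

lemma derivation_rep:
  assumes c: "(U, \<phi>) \<in> M" "p \<in> U" and f: "smooth_near M p f"
    and X: "rep (inv_into U \<phi>) (dir_deriv M (U, \<phi>)) (\<phi> p) X \<xi>"
  shows "\<forall>\<^sub>F y in nhds (\<phi> p). ((\<lambda>q. X q f) \<circ> inv_into U \<phi>) y = fd (f \<circ> inv_into U \<phi>) y (\<xi> y)"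
    and "smooth_near M p (\<lambda>q. X q f)"
proof -
  have ev: "\<forall>\<^sub>F y in nhds (\<phi> p). X (inv_into U \<phi> y) = dir_deriv M (U, \<phi>) (inv_into U \<phi> y) (\<xi> y)"
    using X unfolding rep_def by blast
  show *: "\<forall>\<^sub>F y in nhds (\<phi> p). ((\<lambda>q. X q f) \<circ> inv_into U \<phi>) y = fd (f \<circ> inv_into U \<phi>) y (\<xi> y)"
    using smooth_near_eventually[OF c f] eventually_chart[OF c] ev
    by eventually_elim (simp add: dir_deriv_apply)
  show "smooth_near M p (\<lambda>q. X q f)"
    unfolding smooth_near_iff[OF c] smooth_at_cong[OF *]
    using f rep_smooth[OF X] unfolding smooth_near_iff[OF c] by (rule smooth_at_fd(1))
qed

lemma rep_at_chart:
  assumes "(U, \<phi>) \<in> M" "p \<in> U" "rep (inv_into U \<phi>) e (\<phi> p) s \<sigma>"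
  shows "s p = e p (\<sigma> (\<phi> p))"
  using rep_at[OF assms(3)] assms(1,2) by simp

lemma derivation_twice:
  assumes c: "(U, \<phi>) \<in> M" "p \<in> U" and f: "smooth_near M p f"
    and X: "rep (inv_into U \<phi>) (dir_deriv M (U, \<phi>)) (\<phi> p) X \<xi>"
  shows "dir_deriv M (U, \<phi>) p u (\<lambda>q. X q f) =
    fd (\<lambda>y. fd (f \<circ> inv_into U \<phi>) y (\<xi> (\<phi> p))) (\<phi> p) u + fd (f \<circ> inv_into U \<phi>) (\<phi> p) (fd \<xi> (\<phi> p) u)"
  unfolding dir_deriv_apply[OF derivation_rep(2)[OF assms]] fd_cong[OF derivation_rep(1)[OF assms]]
  by (rule smooth_at_fd(2)[OF f[unfolded smooth_near_iff[OF c]] rep_smooth[OF X]])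

text \<open>The second derivatives of the test function cancel by \<open>fd_symmetric\<close>, which
  leaves a first-order operator.\<close>

lemma lie_bracket_rep:
  assumes c: "(U, \<phi>) \<in> M" "p \<in> U"
    and X: "rep (inv_into U \<phi>) (dir_deriv M (U, \<phi>)) (\<phi> p) X \<xi>"
    and Y: "rep (inv_into U \<phi>) (dir_deriv M (U, \<phi>)) (\<phi> p) Y \<eta>"
  shows "lie_bracket M X Y p =
    dir_deriv M (U, \<phi>) p (fd \<eta> (\<phi> p) (\<xi> (\<phi> p)) - fd \<xi> (\<phi> p) (\<eta> (\<phi> p)))"
proof
  fix f :: "'a \<Rightarrow> real"
  let ?g = "f \<circ> inv_into U \<phi>"
  show "lie_bracket M X Y p f =
    dir_deriv M (U, \<phi>) p (fd \<eta> (\<phi> p) (\<xi> (\<phi> p)) - fd \<xi> (\<phi> p) (\<eta> (\<phi> p))) f"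
  proof (cases "smooth_near M p f")
    case True
    have g: "smooth_at (\<phi> p) ?g"
      using True unfolding smooth_near_iff[OF c] .
    have "lie_bracket M X Y p f = X p (\<lambda>q. Y q f) - Y p (\<lambda>q. X q f)"
      using True by (simp add: lie_bracket_def)
    also have "\<dots> = fd ?g (\<phi> p) (fd \<eta> (\<phi> p) (\<xi> (\<phi> p))) - fd ?g (\<phi> p) (fd \<xi> (\<phi> p) (\<eta> (\<phi> p)))"
      unfolding rep_at_chart[OF c X] rep_at_chart[OF c Y]
        derivation_twice[OF c True X] derivation_twice[OF c True Y]
      using fd_symmetric[OF g, of "\<xi> (\<phi> p)" "\<eta> (\<phi> p)"] by simp
    also have "\<dots> = fd ?g (\<phi> p) (fd \<eta> (\<phi> p) (\<xi> (\<phi> p)) - fd \<xi> (\<phi> p) (\<eta> (\<phi> p)))"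
      by (simp add: linear_diff[OF linear_fd[OF g]])
    finally show ?thesis
      by (simp only: dir_deriv_apply[OF True])
  qed (simp add: lie_bracket_def dir_deriv_def)
qed

abbreviation "coframe U \<phi> \<equiv> dual_frame (tangent_bundle M) (dir_deriv M (U, \<phi>))"

lemma coframe_apply:
  "(U, \<phi>) \<in> M \<Longrightarrow> p \<in> U \<Longrightarrow> coframe U \<phi> p a (dir_deriv M (U, \<phi>) p w) = a \<bullet> w"
  using TM.dual_frame_apply[OF triv_tangent] .

lemma contraction_rep:
  assumes c: "(U, \<phi>) \<in> M" "p \<in> U"
    and \<alpha>: "rep (inv_into U \<phi>) (coframe U \<phi>) (\<phi> p) \<alpha> a"
    and Y: "rep (inv_into U \<phi>) (dir_deriv M (U, \<phi>)) (\<phi> p) Y \<eta>"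
  shows "\<forall>\<^sub>F y in nhds (\<phi> p). ((\<lambda>q. \<alpha> q (Y q)) \<circ> inv_into U \<phi>) y = a y \<bullet> \<eta> y"
    and "smooth_near M p (\<lambda>q. \<alpha> q (Y q))"
proof -
  have "\<forall>\<^sub>F y in nhds (\<phi> p). Y (inv_into U \<phi> y) = dir_deriv M (U, \<phi>) (inv_into U \<phi> y) (\<eta> y)"
    "\<forall>\<^sub>F y in nhds (\<phi> p). \<alpha> (inv_into U \<phi> y) = coframe U \<phi> (inv_into U \<phi> y) (a y)"
    using Y \<alpha> unfolding rep_def by blast+
  then show *: "\<forall>\<^sub>F y in nhds (\<phi> p). ((\<lambda>q. \<alpha> q (Y q)) \<circ> inv_into U \<phi>) y = a y \<bullet> \<eta> y"
    using eventually_chart[OF c]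
    by eventually_elim (use c coframe_apply in simp)
  show "smooth_near M p (\<lambda>q. \<alpha> q (Y q))"
    unfolding smooth_near_iff[OF c] smooth_at_cong[OF *]
    using rep_smooth[OF \<alpha>] rep_smooth[OF Y] by (rule smooth_at_inner)
qed

text \<open>The definition is a description over all extensions \<open>Y\<close> of the given
  vector. The derivative of \<open>Y\<close> along \<open>X\<close> contributes equally to
  \<open>X(\<alpha>(Y))\<close> and to \<open>\<alpha>([X,Y])\<close>, so it drops out of the
  difference and only the value of \<open>Y\<close> at \<open>p\<close> matters.\<close>

lemma lie_derivative_rep:
  assumes c: "(U, \<phi>) \<in> M" "p \<in> U"
    and X: "rep (inv_into U \<phi>) (dir_deriv M (U, \<phi>)) (\<phi> p) X \<xi>"
    and \<alpha>: "rep (inv_into U \<phi>) (coframe U \<phi>) (\<phi> p) \<alpha> a"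
  shows "lie_derivative M X \<alpha> p (dir_deriv M (U, \<phi>) p w) =
    fd a (\<phi> p) (\<xi> (\<phi> p)) \<bullet> w + a (\<phi> p) \<bullet> fd \<xi> (\<phi> p) w" (is "_ = ?r")
proof -
  let ?v = "dir_deriv M (U, \<phi>) p w"
  let ?P = "\<lambda>Y. smooth_section_near M (tangent_bundle M) p Y \<and> Y p = ?v"
  have *: "?r = X p (\<lambda>q. \<alpha> q (Y q)) - \<alpha> p (lie_bracket M X Y p)" if PY: "?P Y" for Y
  proof -
    obtain \<eta> where Y: "rep (inv_into U \<phi>) (dir_deriv M (U, \<phi>)) (\<phi> p) Y \<eta>"
      using iffD1[OF TM.section_near_iff[OF c(1) triv_tangent[OF c(1)] c(2) c(2)] conjunct1[OF PY]]
      by (rule exE)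
    have \<eta>: "\<eta> (\<phi> p) = w"
      using PY rep_at_chart[OF c Y] dir_deriv_inj[OF c] by (metis injD)
    have "X p (\<lambda>q. \<alpha> q (Y q)) = fd (\<lambda>y. a y \<bullet> \<eta> y) (\<phi> p) (\<xi> (\<phi> p))"
      unfolding rep_at_chart[OF c X] dir_deriv_apply[OF contraction_rep(2)[OF c \<alpha> Y]]
        fd_cong[OF contraction_rep(1)[OF c \<alpha> Y]] ..
    also have "\<dots> = a (\<phi> p) \<bullet> fd \<eta> (\<phi> p) (\<xi> (\<phi> p)) + fd a (\<phi> p) (\<xi> (\<phi> p)) \<bullet> w"
      using fd_inner[OF rep_smooth[OF \<alpha>] rep_smooth[OF Y]] \<eta> by simp
    finally show ?thesis
      unfolding lie_bracket_rep[OF c X Y] rep_at_chart[OF c \<alpha>] coframe_apply[OF c] \<eta>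
      by (simp add: inner_diff_right)
  qed
  \<comment> \<open>Without an admissible extension every \<open>r\<close> would satisfy the
    description; the field with constant components is one.\<close>
  have ex: "?P (\<lambda>q. dir_deriv M (U, \<phi>) q w)"
    using TM.constant_section_near[OF triv_tangent] c by blast
  have "?v \<in> tangent_space M p"
    using tangent_space_range[OF c] by blast
  then have "lie_derivative M X \<alpha> p ?v =
    (THE r. \<forall>Y. ?P Y \<longrightarrow> r = X p (\<lambda>q. \<alpha> q (Y q)) - \<alpha> p (lie_bracket M X Y p))"
    by (simp add: lie_derivative_def)
  also have "\<dots> = ?r"
  proof (rule the_equality)
    show "\<forall>Y. ?P Y \<longrightarrow> ?r = X p (\<lambda>q. \<alpha> q (Y q)) - \<alpha> p (lie_bracket M X Y p)"
      using * by (intro allI impI)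
    fix r assume "\<forall>Y. ?P Y \<longrightarrow> r = X p (\<lambda>q. \<alpha> q (Y q)) - \<alpha> p (lie_bracket M X Y p)"
    from mp[OF spec[OF this] ex] show "r = ?r"
      unfolding *[OF ex] .
  qed
  finally show ?thesis .
qed

lemma ext_deriv_rep:
  assumes c: "(U, \<phi>) \<in> M" "p \<in> U" and f: "smooth_near M p f"
  shows "ext_deriv M f p (dir_deriv M (U, \<phi>) p w) = fd (f \<circ> inv_into U \<phi>) (\<phi> p) w"
  using tangent_space_range[OF c] dir_deriv_apply[OF f] by (auto simp: ext_deriv_def)

abbreviation "gframe U \<phi> \<equiv> double_frame (tangent_bundle M) (dir_deriv M (U, \<phi>))"

lemma triv_gframe: "(U, \<phi>) \<in> M \<Longrightarrow> (U, gframe U \<phi>) \<in> triv (double_bundle (tangent_bundle M))"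
  by (intro TM.triv_double triv_tangent)

sublocale TTM: smooth_bundle M "double_bundle (tangent_bundle M)"
  by (rule TM.double_bundle)

lemma rep_gframe:
  assumes "rep \<psi> (gframe U \<phi>) y s \<sigma>"
  shows "rep \<psi> (dir_deriv M (U, \<phi>)) y (fst \<circ> s) (\<lambda>z. fst (\<sigma> z))"
    and "rep \<psi> (coframe U \<phi>) y (snd \<circ> s) (\<lambda>z. snd (\<sigma> z))"
  using assms unfolding rep_def double_frame_apply
  by (auto intro!: smooth_at_fst smooth_at_snd elim!: eventually_mono)

lemma courant_at:
  assumes c: "(U, \<phi>) \<in> M" "p \<in> U"
    and s: "rep (inv_into U \<phi>) (gframe U \<phi>) (\<phi> p) s \<sigma>"
    and t: "rep (inv_into U \<phi>) (gframe U \<phi>) (\<phi> p) t \<tau>"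
  shows "courant M s t p = gframe U \<phi> p (ccourant \<sigma> \<tau> (\<phi> p))"
proof -
  note X = rep_gframe(1)[OF s] and \<xi> = rep_gframe(2)[OF s]
    and Y = rep_gframe(1)[OF t] and \<eta> = rep_gframe(2)[OF t]
  let ?x = "\<phi> p"
  note sm = rep_smooth[OF s] rep_smooth[OF t]
  define h where "h = (\<lambda>q. (snd \<circ> s) q ((fst \<circ> t) q) - (snd \<circ> t) q ((fst \<circ> s) q))"
  have h1: "\<forall>\<^sub>F y in nhds ?x. (h \<circ> inv_into U \<phi>) y = snd (\<sigma> y) \<bullet> fst (\<tau> y) - snd (\<tau> y) \<bullet> fst (\<sigma> y)"
    using contraction_rep(1)[OF c \<xi> Y] contraction_rep(1)[OF c \<eta> X]
    by eventually_elim (simp add: h_def)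
  have h2: "smooth_near M p h"
    unfolding smooth_near_iff[OF c] smooth_at_cong[OF h1] by (intro smooth_at_intros sm)
  have "courant M s t p = (lie_bracket M (fst \<circ> s) (fst \<circ> t) p,
      lie_derivative M (fst \<circ> s) (snd \<circ> t) p - lie_derivative M (fst \<circ> t) (snd \<circ> s) p
      + (1/2) *\<^sub>R ext_deriv M h p)"
    by (simp add: courant_def Let_def h_def)
  also have "\<dots> = (dir_deriv M (U, \<phi>) p (fst (ccourant \<sigma> \<tau> ?x)), coframe U \<phi> p (snd (ccourant \<sigma> \<tau> ?x)))"
  proof (rule arg_cong2[where f = Pair])
    show "lie_bracket M (fst \<circ> s) (fst \<circ> t) p = dir_deriv M (U, \<phi>) p (fst (ccourant \<sigma> \<tau> ?x))"
      unfolding lie_bracket_rep[OF c X Y] by (simp add: ccourant_def fd_fst sm)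
    show "lie_derivative M (fst \<circ> s) (snd \<circ> t) p - lie_derivative M (fst \<circ> t) (snd \<circ> s) p
      + (1/2) *\<^sub>R ext_deriv M h p = coframe U \<phi> p (snd (ccourant \<sigma> \<tau> ?x))" (is "?l = ?r")
    proof
      fix v
      show "?l v = ?r v"
      proof (cases "v \<in> tangent_space M p")
        case True
        then obtain w where v: "v = dir_deriv M (U, \<phi>) p w"
          using tangent_space_range[OF c] by blast
        have "?l v = fd (\<lambda>z. snd (\<tau> z)) ?x (fst (\<sigma> ?x)) \<bullet> w + snd (\<tau> ?x) \<bullet> fd (\<lambda>z. fst (\<sigma> z)) ?x w
          - (fd (\<lambda>z. snd (\<sigma> z)) ?x (fst (\<tau> ?x)) \<bullet> w + snd (\<sigma> ?x) \<bullet> fd (\<lambda>z. fst (\<tau> z)) ?x w)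
          + fd (\<lambda>y. snd (\<sigma> y) \<bullet> fst (\<tau> y) - snd (\<tau> y) \<bullet> fst (\<sigma> y)) ?x w / 2"
          by (simp add: v plus_fun_def fun_diff_def scaleR_fun_def lie_derivative_rep[OF c X \<eta>]
            lie_derivative_rep[OF c Y \<xi>]
            ext_deriv_rep[OF c h2] fd_cong[OF h1])
        \<comment> \<open>Pairing with \<open>(w, 0)\<close> extracts the value of the covector part
          on \<open>w\<close>. The product rule for the exact term turns the two Lie derivatives
          into the halves in \<open>ccourant\<close>.\<close>
        also have "\<dots> = cpair (ccourant \<sigma> \<tau> ?x) (w, 0)"
          unfolding cpair_ccourant[OF sm]
          by (simp add: fd_diff fd_inner fd_fst fd_snd smooth_at_intros sm cpair_def inner_commute field_simps)
        also have "\<dots> = ?r v"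
          by (simp add: v coframe_apply[OF c] cpair_def)
        finally show ?thesis .
      qed (simp add: lie_derivative_def ext_deriv_def dual_frame_def plus_fun_def fun_diff_def scaleR_fun_def)
    qed
  qed
  finally show ?thesis
    by (simp add: double_frame_apply)
qed

lemma courant_rep:
  assumes c: "(U, \<phi>) \<in> M" "p \<in> U"
    and s: "rep (inv_into U \<phi>) (gframe U \<phi>) (\<phi> p) s \<sigma>"
    and t: "rep (inv_into U \<phi>) (gframe U \<phi>) (\<phi> p) t \<tau>"
  shows "rep (inv_into U \<phi>) (gframe U \<phi>) (\<phi> p) (courant M s t) (ccourant \<sigma> \<tau>)"
proof -
  have "\<forall>\<^sub>F y in nhds (\<phi> p). courant M s t (inv_into U \<phi> y) = gframe U \<phi> (inv_into U \<phi> y) (ccourant \<sigma> \<tau> y)"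
    using rep_eventually[OF s] rep_eventually[OF t] eventually_chart[OF c]
  proof eventually_elim
    case (elim y)
    then show ?case
      using courant_at[OF c(1), of "inv_into U \<phi> y" s \<sigma> t \<tau>] by simp
  qed
  then show ?thesis
    unfolding rep_def using smooth_at_ccourant[OF rep_smooth[OF s] rep_smooth[OF t]] by simp
qed

lemma courant_section_near:
  assumes "smooth_section_near M (double_bundle (tangent_bundle M)) p s"
    "smooth_section_near M (double_bundle (tangent_bundle M)) p t"
  shows "smooth_section_near M (double_bundle (tangent_bundle M)) p (courant M s t)"
proof -
  obtain U \<phi> where c: "(U, \<phi>) \<in> M" "p \<in> U"
    using TTM.section_nearD(2)[OF assms(1)] carrierE by blast
  show ?thesis
    using assms courant_rep[OF c]
    unfolding TTM.section_near_iff[OF c(1) triv_gframe[OF c(1)] c(2) c(2)] by blast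
qed

end

text \<open>Doubled vectors are handled as single variables from here on, so quantifiers over them
  must not be split into components.\<close>

declare split_paired_All [simp del]

section \<open>Integrability at a point\<close>

lemma (in smooth_bundle) section_near_combine:
  assumes "smooth_section_near M V x s" "smooth_section_near M V x t"
  shows "smooth_section_near M V x (\<lambda>y. s y + t y)" and "smooth_section_near M V x (\<lambda>y. s y - t y)"
proof -
  have "x \<in> carrier M" using section_nearD(2)[OF assms(1)] .
  then obtain U \<phi> W e where c: "(U, \<phi>) \<in> M" "x \<in> U" and t: "(W, e) \<in> triv V" "x \<in> W"
    by (meson carrierE trivE)
  note iff = section_near_iff[OF c(1) t(1) c(2) t(2)]
  obtain \<sigma> \<tau> where \<sigma>: "rep (inv_into U \<phi>) e (\<phi> x) s \<sigma>" and \<tau>: "rep (inv_into U \<phi>) e (\<phi> x) t \<tau>"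
    using assms unfolding iff by blast
  have ev: "\<forall>\<^sub>F y in nhds (\<phi> x). linear (e (inv_into U \<phi> y)) \<and>
      s (inv_into U \<phi> y) = e (inv_into U \<phi> y) (\<sigma> y) \<and> t (inv_into U \<phi> y) = e (inv_into U \<phi> y) (\<tau> y)"
    using eventually_coordinate[OF c triv_openin[OF t(1)] t(2)] conjunct2[OF \<sigma>[unfolded rep_def]]
      conjunct2[OF \<tau>[unfolded rep_def]]
    by eventually_elim (use triv_linear[OF t(1)] in blast)
  have "rep (inv_into U \<phi>) e (\<phi> x) (\<lambda>y. s y + t y) (\<lambda>y. \<sigma> y + \<tau> y)"
    unfolding rep_def using rep_smooth[OF \<sigma>] rep_smooth[OF \<tau>] ev
    by (auto intro: smooth_at_add elim!: eventually_mono simp: linear_add)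
  then show "smooth_section_near M V x (\<lambda>y. s y + t y)"
    unfolding iff by blast
  have "rep (inv_into U \<phi>) e (\<phi> x) (\<lambda>y. s y - t y) (\<lambda>y. \<sigma> y - \<tau> y)"
    unfolding rep_def using rep_smooth[OF \<sigma>] rep_smooth[OF \<tau>] ev
    by (auto intro: smooth_at_diff elim!: eventually_mono simp: linear_diff)
  then show "smooth_section_near M V x (\<lambda>y. s y - t y)"
    unfolding iff by blast
qed

lemma (in smooth_bundle) openin_fun_eventually:
  assumes "(U, \<phi>) \<in> M" "x \<in> U" "openin (atlas_topology M) W" "x \<in> W" "\<And>q. q \<in> W \<Longrightarrow> s q = t q"
  shows "\<forall>\<^sub>F y in nhds (\<phi> x). s (inv_into U \<phi> y) = t (inv_into U \<phi> y)"
  using eventually_coordinate[OF assms(1-4)] by eventually_elim (use assms(5) in blast)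

text \<open>The bracket of \<open>J s + i s\<close> and \<open>J t + i t\<close> has real part
  \<open>[J s, J t] - [s, t]\<close> and imaginary part \<open>[J s, t] + [s, J t]\<close>. The
  condition is one half of the eigenvector equation for this bracket at \<open>p\<close>; the other
  half follows by applying \<open>J\<close>.\<close>

definition integrable_at ::
  "('a, 'e::euclidean_space) atlas \<Rightarrow> ('a \<Rightarrow> 'a gtvec \<Rightarrow> 'a gtvec) \<Rightarrow> 'a \<Rightarrow> bool" where
  "integrable_at M J p \<longleftrightarrow>
    (\<forall>s t. smooth_section_near M (double_bundle (tangent_bundle M)) p s \<longrightarrow>
           smooth_section_near M (double_bundle (tangent_bundle M)) p t \<longrightarrow>
       J p (courant M s t p - courant M (\<lambda>x. J x (s x)) (\<lambda>x. J x (t x)) p) =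
       courant M s (\<lambda>x. J x (t x)) p + courant M (\<lambda>x. J x (s x)) t p)"

text \<open>\<open>K\<close> is the matrix of \<open>J\<close> in the coordinates of the chart \<open>(U, \<phi>)\<close> near \<open>p\<close>.\<close>

definition gacs_form ::
  "('a, 'e::euclidean_space) atlas \<Rightarrow> 'a set \<Rightarrow> ('a \<Rightarrow> 'e) \<Rightarrow> ('a \<Rightarrow> 'a gtvec \<Rightarrow> 'a gtvec) \<Rightarrow>
   ('e \<Rightarrow> 'e \<times> 'e \<Rightarrow> 'e \<times> 'e) \<Rightarrow> 'a \<Rightarrow> bool" where
  "gacs_form M U \<phi> J K p \<longleftrightarrow>
    (\<forall>\<^sub>F y in nhds (\<phi> p). linear (K y) \<and> (\<forall>z. K y (K y z) = - z) \<and>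
       (\<forall>z. J (inv_into U \<phi> y) (double_frame (tangent_bundle M) (dir_deriv M (U, \<phi>)) (inv_into U \<phi> y) z) =
            double_frame (tangent_bundle M) (dir_deriv M (U, \<phi>)) (inv_into U \<phi> y) (K y z))) \<and>
    (\<forall>z. smooth_at (\<phi> p) (\<lambda>y. K y z))"

context smooth_atlas
begin

lemma gacs_form_rep:
  assumes K: "gacs_form M U \<phi> J K p" and s: "rep (inv_into U \<phi>) (gframe U \<phi>) (\<phi> p) s \<sigma>"
  shows "rep (inv_into U \<phi>) (gframe U \<phi>) (\<phi> p) (\<lambda>x. J x (s x)) (\<lambda>y. K y (\<sigma> y))"
  unfolding rep_def
proof
  have "\<forall>\<^sub>F y in nhds (\<phi> p). linear (K y)"
    using K unfolding gacs_form_def by (auto elim: eventually_mono)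
  then show "smooth_at (\<phi> p) (\<lambda>y. K y (\<sigma> y))"
    by (rule smooth_at_family(1)) (use K rep_smooth[OF s] in \<open>auto simp only: gacs_form_def\<close>)
  show "\<forall>\<^sub>F z in nhds (\<phi> p). J (inv_into U \<phi> z) (s (inv_into U \<phi> z)) = gframe U \<phi> (inv_into U \<phi> z) (K z (\<sigma> z))"
    using conjunct1[OF K[unfolded gacs_form_def]] conjunct2[OF s[unfolded rep_def]]
    by eventually_elim simp
qed

lemma gacs_form_section:
  assumes c: "(U, \<phi>) \<in> M" "p \<in> U" and K: "gacs_form M U \<phi> J K p"
    and s: "smooth_section_near M (double_bundle (tangent_bundle M)) p s"
  shows "smooth_section_near M (double_bundle (tangent_bundle M)) p (\<lambda>x. J x (s x))"
  using s gacs_form_rep[OF K] unfolding TTM.section_near_iff[OF c(1) triv_gframe[OF c(1)] c(2) c(2)] by blast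

lemma gframe_combine:
  assumes c: "(U, \<phi>) \<in> M" "p \<in> U"
  shows "gframe U \<phi> p (a + b) = gframe U \<phi> p a + gframe U \<phi> p b"
    and "gframe U \<phi> p (a - b) = gframe U \<phi> p a - gframe U \<phi> p b"
    and "gframe U \<phi> p (- a) = - gframe U \<phi> p a"
  using TTM.triv_linear[OF triv_gframe[OF c(1)] c(2)] by (simp_all add: linear_add linear_diff linear_neg)

lemma gacs_form_at:
  assumes c: "(U, \<phi>) \<in> M" "p \<in> U" and K: "gacs_form M U \<phi> J K p"
  shows "J p (gframe U \<phi> p z) = gframe U \<phi> p (K (\<phi> p) z)" "linear (K (\<phi> p))" "K (\<phi> p) (K (\<phi> p) z) = - z"
  using eventually_nhds_x_imp_x[OF conjunct1[OF K[unfolded gacs_form_def]]] c by simp_all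

lemma gacs_form_linear:
  assumes c: "(U, \<phi>) \<in> M" "p \<in> U" and K: "gacs_form M U \<phi> J K p"
    and a: "a \<in> fib (double_bundle (tangent_bundle M)) p" and b: "b \<in> fib (double_bundle (tangent_bundle M)) p"
  shows "J p (a - b) = J p a - J p b" "J p (- a) = - J p a" "J p (J p a) = - a"
proof -
  obtain u v where u: "a = gframe U \<phi> p u" and v: "b = gframe U \<phi> p v"
    using a b TTM.triv_range[OF triv_gframe[OF c(1)] c(2)] by blast
  note l = gacs_form_at(2)[OF c K]
  show "J p (a - b) = J p a - J p b" "J p (- a) = - J p a" "J p (J p a) = - a"
    unfolding u v gframe_combine[OF c, symmetric] gacs_form_at[OF c K]
    by (simp_all add: linear_diff[OF l] linear_neg[OF l])
qed

text \<open>Every pair of smooth coordinate functions is realized by sections near \<open>p\<close>,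
  so quantifying over sections amounts to quantifying over representatives.\<close>

lemma integrable_at_iff:
  assumes c: "(U, \<phi>) \<in> M" "p \<in> U" and K: "gacs_form M U \<phi> J K p"
  shows "integrable_at M J p \<longleftrightarrow>
    (\<forall>\<sigma> \<tau>. smooth_at (\<phi> p) \<sigma> \<longrightarrow> smooth_at (\<phi> p) \<tau> \<longrightarrow>
       K (\<phi> p) (ccourant \<sigma> \<tau> (\<phi> p) - ccourant (\<lambda>y. K y (\<sigma> y)) (\<lambda>y. K y (\<tau> y)) (\<phi> p)) =
       ccourant \<sigma> (\<lambda>y. K y (\<tau> y)) (\<phi> p) + ccourant (\<lambda>y. K y (\<sigma> y)) \<tau> (\<phi> p))"
    (is "_ \<longleftrightarrow> (\<forall>\<sigma> \<tau>. _ \<longrightarrow> _ \<longrightarrow> ?N \<sigma> \<tau>)")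
proof -
  note iff = TTM.section_near_iff[OF c(1) triv_gframe[OF c(1)] c(2) c(2)]
  have key: "J p (courant M s t p - courant M (\<lambda>x. J x (s x)) (\<lambda>x. J x (t x)) p) =
       courant M s (\<lambda>x. J x (t x)) p + courant M (\<lambda>x. J x (s x)) t p \<longleftrightarrow> ?N \<sigma> \<tau>"
    if s: "rep (inv_into U \<phi>) (gframe U \<phi>) (\<phi> p) s \<sigma>" and t: "rep (inv_into U \<phi>) (gframe U \<phi>) (\<phi> p) t \<tau>"
    for s t \<sigma> \<tau>
    unfolding courant_at[OF c s t] courant_at[OF c gacs_form_rep[OF K s] gacs_form_rep[OF K t]]
      courant_at[OF c s gacs_form_rep[OF K t]] courant_at[OF c gacs_form_rep[OF K s] t]
      gframe_combine[OF c, symmetric] gacs_form_at(1)[OF c K]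
    using TTM.triv_inj[OF triv_gframe[OF c(1)] c(2)] by (simp add: inj_eq)
  show ?thesis
  proof
    assume l: "integrable_at M J p"
    show "\<forall>\<sigma> \<tau>. smooth_at (\<phi> p) \<sigma> \<longrightarrow> smooth_at (\<phi> p) \<tau> \<longrightarrow> ?N \<sigma> \<tau>"
    proof (intro allI impI)
      fix \<sigma> \<tau> :: "'e \<Rightarrow> 'e \<times> 'e" assume sm: "smooth_at (\<phi> p) \<sigma>" "smooth_at (\<phi> p) \<tau>"
      have r: "rep (inv_into U \<phi>) (gframe U \<phi>) (\<phi> p) (\<lambda>q. gframe U \<phi> q (\<sigma> (\<phi> q))) \<sigma>"
        if "smooth_at (\<phi> p) \<sigma>" for \<sigma> :: "'e \<Rightarrow> 'e \<times> 'e"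
        unfolding rep_def using that eventually_chart[OF c] by (auto elim!: eventually_mono)
      show "?N \<sigma> \<tau>"
        using l key[OF r[OF sm(1)] r[OF sm(2)]] r[OF sm(1)] r[OF sm(2)]
        unfolding integrable_at_def iff by blast
    qed
  next
    assume r: "\<forall>\<sigma> \<tau>. smooth_at (\<phi> p) \<sigma> \<longrightarrow> smooth_at (\<phi> p) \<tau> \<longrightarrow> ?N \<sigma> \<tau>"
    show "integrable_at M J p"
      unfolding integrable_at_def iff
    proof (intro allI impI)
      fix s t assume "\<exists>\<sigma>. rep (inv_into U \<phi>) (gframe U \<phi>) (\<phi> p) s \<sigma>"
        "\<exists>\<sigma>. rep (inv_into U \<phi>) (gframe U \<phi>) (\<phi> p) t \<sigma>"
      then obtain \<sigma> \<tau> where s: "rep (inv_into U \<phi>) (gframe U \<phi>) (\<phi> p) s \<sigma>"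
        and t: "rep (inv_into U \<phi>) (gframe U \<phi>) (\<phi> p) t \<tau>" by blast
      show "J p (courant M s t p - courant M (\<lambda>x. J x (s x)) (\<lambda>x. J x (t x)) p) =
       courant M s (\<lambda>x. J x (t x)) p + courant M (\<lambda>x. J x (s x)) t p"
        unfolding key[OF s t] using r rep_smooth[OF s] rep_smooth[OF t] by blast
    qed
  qed
qed

text \<open>The bracket is built from global functions such as \<open>\<lambda>q. Y q f\<close>, so
  its dependence on germs alone is not visible in the definition. It follows from the coordinate
  formula, since sections that agree near \<open>p\<close> share their representatives. It is
  applied where \<open>a = J b\<close> holds only on an open set.\<close>

lemma courant_cong:
  assumes "smooth_section_near M (double_bundle (tangent_bundle M)) p s"
    "smooth_section_near M (double_bundle (tangent_bundle M)) p t"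
    and W: "openin (atlas_topology M) W" "p \<in> W"
    and eq: "\<And>q. q \<in> W \<Longrightarrow> s q = s' q" "\<And>q. q \<in> W \<Longrightarrow> t q = t' q"
  shows "courant M s t p = courant M s' t' p"
proof -
  obtain U \<phi> where c: "(U, \<phi>) \<in> M" "p \<in> U"
    using TTM.section_nearD(2)[OF assms(1)] carrierE by blast
  obtain \<sigma> \<tau> where s: "rep (inv_into U \<phi>) (gframe U \<phi>) (\<phi> p) s \<sigma>"
    and t: "rep (inv_into U \<phi>) (gframe U \<phi>) (\<phi> p) t \<tau>"
    using assms(1,2) unfolding TTM.section_near_iff[OF c(1) triv_gframe[OF c(1)] c(2) c(2)] by blast
  have s': "rep (inv_into U \<phi>) (gframe U \<phi>) (\<phi> p) s' \<sigma>"
    using s TTM.openin_fun_eventually[OF c W eq(1)] by (rule rep_cong_eventually)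
  have t': "rep (inv_into U \<phi>) (gframe U \<phi>) (\<phi> p) t' \<tau>"
    using t TTM.openin_fun_eventually[OF c W eq(2)] by (rule rep_cong_eventually)
  show ?thesis
    unfolding courant_at[OF c s t] courant_at[OF c s' t'] ..
qed

text \<open>The \<open>(+i)\<close>-eigensections are the sections \<open>J b + i b\<close> with \<open>b\<close> real.\<close>

lemma integrable_gacs_iff:
  assumes form: "\<And>p. p \<in> carrier M \<Longrightarrow> \<exists>U \<phi> K. (U, \<phi>) \<in> M \<and> p \<in> U \<and> gacs_form M U \<phi> J K p"
  shows "integrable_gacs M J \<longleftrightarrow> (\<forall>p\<in>carrier M. integrable_at M J p)"
proof -
  let ?E = "double_bundle (tangent_bundle M)"
  let ?S = "smooth_section_near M ?E"
  have J_section: "?S p (\<lambda>x. J x (s x))" if "?S p s" for p s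
    using form[OF TTM.section_nearD(2)[OF that]] gacs_form_section that by blast
  have J_lin: "J p (a - b) = J p a - J p b" "J p (- a) = - J p a" "J p (J p a) = - a"
    if "p \<in> carrier M" "a \<in> fib ?E p" "b \<in> fib ?E p" for p a b
    using form[OF that(1)] gacs_form_linear that(2,3) by meson+
  show ?thesis
  proof
    assume int: "integrable_gacs M J"
    show "\<forall>p\<in>carrier M. integrable_at M J p"
      unfolding integrable_at_def
    proof (intro ballI allI impI)
      fix p s t assume p: "p \<in> carrier M" and s: "?S p s" and t: "?S p t"
      obtain W W' where W: "p \<in> W" "smooth_section M ?E W s" "p \<in> W'" "smooth_section M ?E W' t"
        using s t unfolding smooth_section_near_def by blast
      let ?O = "W \<inter> W'"
      have near: "openin (atlas_topology M) ?O" "\<And>x. x \<in> ?O \<Longrightarrow> ?S x s" "\<And>x. x \<in> ?O \<Longrightarrow> ?S x t"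
        using W unfolding TTM.smooth_section_iff by auto
      have eig: "eigen_section M J ?O (\<lambda>x. (J x (u x), u x))" if u: "\<And>x. x \<in> ?O \<Longrightarrow> ?S x u" for u
        unfolding eigen_section_def TTM.smooth_section_iff
        using near(1) J_section[OF u] u J_lin(3)[OF TTM.section_nearD(2)[OF u] TTM.section_nearD(1)[OF u]
          TTM.section_nearD(1)[OF u]] by (simp add: comp_def)
      have "eigen_section M J ?O (courant_complex M (\<lambda>x. (J x (s x), s x)) (\<lambda>x. (J x (t x), t x)))"
        using int eig[of s] eig[of t] near unfolding integrable_gacs_def by blast
      then have "J p (courant M (\<lambda>x. J x (s x)) (\<lambda>x. J x (t x)) p - courant M s t p) =
          - (courant M (\<lambda>x. J x (s x)) t p + courant M s (\<lambda>x. J x (t x)) p)"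
        unfolding eigen_section_def using W by (auto simp: courant_complex_def comp_def Let_def)
      moreover have fib: "courant M (\<lambda>x. J x (s x)) (\<lambda>x. J x (t x)) p \<in> fib ?E p" "courant M s t p \<in> fib ?E p"
        using courant_section_near s t J_section TTM.section_nearD(1) by blast+
      ultimately show "J p (courant M s t p - courant M (\<lambda>x. J x (s x)) (\<lambda>x. J x (t x)) p) =
          courant M s (\<lambda>x. J x (t x)) p + courant M (\<lambda>x. J x (s x)) t p"
        unfolding J_lin(1)[OF p fib] J_lin(1)[OF p fib(2,1)] by (simp add: algebra_simps)
    qed
  next
    assume int: "\<forall>p\<in>carrier M. integrable_at M J p"
    show "integrable_gacs M J"
      unfolding integrable_gacs_def
    proof (intro allI impI)
      fix O' s t assume "eigen_section M J O' s \<and> eigen_section M J O' t"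
      then have es: "eigen_section M J O' s" and et: "eigen_section M J O' t" by auto
      define a b c d where abcd: "a = fst \<circ> s" "b = snd \<circ> s" "c = fst \<circ> t" "d = snd \<circ> t"
      have o: "openin (atlas_topology M) O'"
        and near: "\<And>x. x \<in> O' \<Longrightarrow> ?S x a" "\<And>x. x \<in> O' \<Longrightarrow> ?S x b" "\<And>x. x \<in> O' \<Longrightarrow> ?S x c" "\<And>x. x \<in> O' \<Longrightarrow> ?S x d"
        and ab: "\<And>x. x \<in> O' \<Longrightarrow> a x = J x (b x)" and cd: "\<And>x. x \<in> O' \<Longrightarrow> c x = J x (d x)"
        using es et unfolding eigen_section_def TTM.smooth_section_iff abcd by auto
      let ?P = "\<lambda>x. courant M a c x - courant M b d x" and ?Q = "\<lambda>x. courant M a d x + courant M b c x"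
      have cc: "courant_complex M s t = (\<lambda>x. (?P x, ?Q x))"
        by (simp add: courant_complex_def abcd fun_eq_iff Let_def)
      note sec = courant_section_near[OF near(1,3)] courant_section_near[OF near(2,4)]
        courant_section_near[OF near(1,4)] courant_section_near[OF near(2,3)]
      have PQ: "?S x ?P" "?S x ?Q" if "x \<in> O'" for x
        using TTM.section_near_combine(2)[OF sec(1,2)] TTM.section_near_combine(1)[OF sec(3,4)] that by simp_all
      moreover have "J x (?P x) = - ?Q x" "J x (?Q x) = ?P x" if x: "x \<in> O'" for x
      proof -
        have xc: "x \<in> carrier M" using TTM.section_nearD(2)[OF near(1)[OF x]] .
        note n = near[OF x] J_section[OF near(2)[OF x]] J_section[OF near(4)[OF x]]
        have eqs: "courant M a c x = courant M (\<lambda>x. J x (b x)) (\<lambda>x. J x (d x)) x"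
          "courant M a d x = courant M (\<lambda>x. J x (b x)) d x"
          "courant M b c x = courant M b (\<lambda>x. J x (d x)) x"
          by (rule courant_cong[OF n(1) n(3) o x ab cd] courant_cong[OF n(1) n(4) o x ab refl]
              courant_cong[OF n(2) n(3) o x refl cd]; assumption)+
        have fib: "courant M a c x \<in> fib ?E x" "courant M b d x \<in> fib ?E x" "?P x \<in> fib ?E x"
          using TTM.section_nearD(1)[OF sec(1)] TTM.section_nearD(1)[OF sec(2)] TTM.section_nearD(1)[OF PQ(1)] x
          by simp_all
        have "J x (courant M b d x - courant M a c x) = ?Q x"
          using int xc n(2,4) unfolding integrable_at_def eqs by (simp add: add.commute)
        then show *: "J x (?P x) = - ?Q x"
          unfolding J_lin(1)[OF xc fib(1,2)] J_lin(1)[OF xc fib(2,1)] by (simp add: algebra_simps)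
        have "?Q x \<in> fib ?E x"
          using TTM.section_nearD(1)[OF PQ(2)[OF x]] .
        \<comment> \<open>The second eigenvector equation results from the first by applying
          \<open>J\<close>, whose square is \<open>-1\<close>.\<close>
        then have "- J x (?Q x) = - ?P x"
          using J_lin(2)[OF xc, of "?Q x"] J_lin(3)[OF xc fib(3), of "?P x"] fib(3) * by simp
        then show "J x (?Q x) = ?P x"
          by (metis minus_minus)
      qed
      ultimately show "eigen_section M J O' (courant_complex M s t)"
        unfolding eigen_section_def TTM.smooth_section_iff cc using o by (simp add: comp_def)
    qed
  qed
qed

end

section \<open>The moving frame of a flat connection\<close>

lemma eventually_nhds_fst:
  assumes "\<forall>\<^sub>F x' in nhds x. P x'"
  shows "\<forall>\<^sub>F p in nhds (x, y). P (fst p)"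
proof -
  obtain S where "open S" "x \<in> S" "\<And>z. z \<in> S \<Longrightarrow> P z"
    using assms unfolding eventually_nhds by blast
  then show ?thesis
    unfolding eventually_nhds by (intro exI[of _ "S \<times> UNIV"]) (auto intro: open_Times)
qed

lemma smooth_at_fst_compose:
  fixes f :: "'e::euclidean_space \<Rightarrow> 'b::real_normed_vector" and p :: "'e \<times> 'f::euclidean_space"
  assumes "smooth_at (fst p) f"
  shows "smooth_at p (\<lambda>q. f (fst q))" and "fd (\<lambda>q. f (fst q)) p w = fd f (fst p) (fst w)"
proof -
  show "smooth_at p (\<lambda>q. f (fst q))"
    by (rule smooth_at_compose[where g = fst, OF assms smooth_at_linear'[OF bounded_linear_fst]])
  show "fd (\<lambda>q. f (fst q)) p w = fd f (fst p) (fst w)"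
    using fd_compose[where g = fst, OF assms smooth_at_linear'[OF bounded_linear_fst]]
      fd_bounded_linear[OF bounded_linear_fst smooth_at_id, of p w] by simp
qed

type_synonym ('f, 'e) mvec = "('f \<times> 'e) \<times> ('f \<times> 'e)"

text \<open>The components in \<open>V\<close>, \<open>T\<^sub>M\<close>, \<open>V\<^sup>*\<close> and \<open>T\<^sub>M\<^sup>*\<close>.\<close>

definition vc :: "('f, 'e) mvec \<Rightarrow> 'f" where "vc \<sigma> = fst (fst \<sigma>)"
definition tm :: "('f, 'e) mvec \<Rightarrow> 'e" where "tm \<sigma> = snd (fst \<sigma>)"
definition fc :: "('f, 'e) mvec \<Rightarrow> 'f" where "fc \<sigma> = fst (snd \<sigma>)"
definition tc :: "('f, 'e) mvec \<Rightarrow> 'e" where "tc \<sigma> = snd (snd \<sigma>)"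

lemmas components = vc_def tm_def fc_def tc_def

lemma cpair_components: "cpair \<sigma> \<tau> = fc \<sigma> \<bullet> vc \<tau> + tc \<sigma> \<bullet> tm \<tau> + fc \<tau> \<bullet> vc \<sigma> + tc \<tau> \<bullet> tm \<sigma>"
  by (simp add: cpair_def components inner_prod_def)

text \<open>\<open>A x t v\<close> is the connection form at \<open>x\<close>, evaluated at the tangent vector \<open>t\<close> and
  applied to \<open>v\<close>.\<close>

type_synonym ('e, 'f) cform = "'e \<Rightarrow> 'e \<Rightarrow> 'f \<Rightarrow> 'f"

definition conn_coords :: "('e::euclidean_space, 'f::euclidean_space) cform \<Rightarrow> 'e \<Rightarrow> bool" where
  "conn_coords A x \<longleftrightarrow> (\<forall>\<^sub>F y in nhds x. bilinear (A y)) \<and> (\<forall>t v. smooth_at x (\<lambda>y. A y t v))"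

text \<open>Vanishing of the curvature \<open>dA + A \<and> A\<close>, evaluated on
  \<open>h\<close>, \<open>t\<close> and applied to \<open>v\<close>.\<close>

definition flat_coords :: "('e::euclidean_space, 'f::euclidean_space) cform \<Rightarrow> 'e \<Rightarrow> bool" where
  "flat_coords A x \<longleftrightarrow> (\<forall>h t v. fd (\<lambda>y. A y t v) x h - fd (\<lambda>y. A y h v) x t
     + A x h (A x t v) - A x t (A x h v) = 0)"

text \<open>The transpose of \<open>\<lambda>t. B t y\<close> (see \<open>conn_adj_inner\<close>),
  written as a basis sum so that its smooth dependence on the base point is visible. It compensates
  the vertical part of horizontal lifts when covectors are evaluated on them.\<close>

definition conn_adj :: "('e::euclidean_space \<Rightarrow> 'f \<Rightarrow> 'f::euclidean_space) \<Rightarrow> 'f \<Rightarrow> 'f \<Rightarrow> 'e" where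
  "conn_adj B y f = (\<Sum>b\<in>Basis. (f \<bullet> B b y) *\<^sub>R b)"

text \<open>The splitting \<open>F\<close> in coordinates is \<open>mcoframe\<close>, its inverse is \<open>mframe\<close>.\<close>

definition mframe :: "('e::euclidean_space, 'f::euclidean_space) cform \<Rightarrow> 'e \<times> 'f \<Rightarrow>
    ('f, 'e) mvec \<Rightarrow> ('e \<times> 'f) \<times> ('e \<times> 'f)" where
  "mframe A p \<sigma> = ((tm \<sigma>, vc \<sigma> - A (fst p) (tm \<sigma>) (snd p)),
                   (tc \<sigma> + conn_adj (A (fst p)) (snd p) (fc \<sigma>), fc \<sigma>))"

definition mcoframe :: "('e::euclidean_space, 'f::euclidean_space) cform \<Rightarrow> 'e \<times> 'f \<Rightarrow>
    ('e \<times> 'f) \<times> ('e \<times> 'f) \<Rightarrow> ('f, 'e) mvec" where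
  "mcoframe A p z = ((snd (fst z) + A (fst p) (fst (fst z)) (snd p), fst (fst z)),
                     (snd (snd z), fst (snd z) - conn_adj (A (fst p)) (snd p) (snd (snd z))))"

lemma mframe_mcoframe [simp]: "mframe A p (mcoframe A p z) = z"
  and mcoframe_mframe [simp]: "mcoframe A p (mframe A p \<sigma>) = \<sigma>"
  by (simp_all add: mframe_def mcoframe_def components prod_eq_iff)

lemma bilinear_simps:
  assumes "bilinear B"
  shows "B (a + b) c = B a c + B b c" "B a (c + d) = B a c + B a d"
    "B (a - b) c = B a c - B b c" "B a (c - d) = B a c - B a d"
    "B (r *\<^sub>R a) c = r *\<^sub>R B a c" "B a (r *\<^sub>R c) = r *\<^sub>R B a c"
    "B (- a) c = - B a c" "B a (- c) = - B a c"
  using assms by (simp_all add: bilinear_ladd bilinear_radd bilinear_lsub bilinear_rsub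
    bilinear_lmul bilinear_rmul bilinear_lneg bilinear_rneg)

lemma conn_adj_inner:
  assumes "bilinear B" shows "conn_adj B y f \<bullet> t = f \<bullet> B t y"
proof -
  have "linear (\<lambda>t. f \<bullet> B t y)"
    by (intro linearI) (simp_all add: bilinear_simps[OF assms] inner_add_right)
  from linear_expand[OF this, of t] show ?thesis
    by (simp add: conn_adj_def inner_sum_left inner_commute[of t] mult.commute)
qed

lemma cpair_mframe:
  assumes "bilinear (A (fst p))"
  shows "cpair (mframe A p \<sigma>) z = tc \<sigma> \<bullet> fst (fst z) + fc \<sigma> \<bullet> A (fst p) (fst (fst z)) (snd p)
    + fc \<sigma> \<bullet> snd (fst z) + fst (snd z) \<bullet> tm \<sigma> + snd (snd z) \<bullet> (vc \<sigma> - A (fst p) (tm \<sigma>) (snd p))"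
  by (simp add: mframe_def cpair_def inner_prod_def inner_add_left conn_adj_inner[OF assms])

text \<open>Vectors and covectors are transformed by a map and its inverse transpose, so the pairing
  is preserved: the \<open>conn_adj\<close> term cancels the vertical part of the horizontal
  lift.\<close>

lemma cpair_mframe_mframe:
  assumes "bilinear (A (fst p))"
  shows "cpair (mframe A p \<sigma>) (mframe A p \<tau>) = cpair \<sigma> \<tau>"
  unfolding cpair_mframe[of A p, OF assms]
  by (simp add: mframe_def cpair_components inner_add_left inner_diff_right conn_adj_inner[OF assms])

lemma linear_mframe:
  assumes "bilinear (A (fst p))" shows "linear (mframe A p)" "linear (mcoframe A p)"
proof -
  have [simp]: "conn_adj (A (fst p)) y (a + b) = conn_adj (A (fst p)) y a + conn_adj (A (fst p)) y b"
    "conn_adj (A (fst p)) y (r *\<^sub>R a) = r *\<^sub>R conn_adj (A (fst p)) y a" for y a b r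
    by (simp_all add: conn_adj_def inner_add_left scaleR_add_left sum.distrib scaleR_sum_right)
  show "linear (mframe A p)" "linear (mcoframe A p)"
    by (intro linearI; simp add: mframe_def mcoframe_def components bilinear_simps[OF assms] algebra_simps)+
qed

text \<open>The derivative of the frame field \<open>\<lambda>q. mframe A q \<sigma>\<close> along
  \<open>w\<close>, paired with \<open>z\<close> (see \<open>cpair_fd_mframe\<close>). For
  \<open>z\<close> in the form \<open>mframe A (x, y) c\<close> it is skew in
  \<open>\<sigma>\<close> and \<open>c\<close>, because the frame is orthogonal.\<close>

definition omega :: "('e::euclidean_space, 'f::euclidean_space) cform \<Rightarrow> 'e \<Rightarrow> 'f \<Rightarrow> 'e \<times> 'f \<Rightarrow>
    ('f, 'e) mvec \<Rightarrow> ('e \<times> 'f) \<times> ('e \<times> 'f) \<Rightarrow> real" where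
  "omega A x y w \<sigma> z = fc \<sigma> \<bullet> (fd (\<lambda>u. A u (fst (fst z)) y) x (fst w) + A x (fst (fst z)) (snd w))
     - snd (snd z) \<bullet> (fd (\<lambda>u. A u (tm \<sigma>) y) x (fst w) + A x (tm \<sigma>) (snd w))"

context
  fixes A :: "('e::euclidean_space, 'f::euclidean_space) cform" and x :: 'e
  assumes conn: "conn_coords A x"
begin

lemma bilinear_near: "\<forall>\<^sub>F p in nhds (x, y). bilinear (A (fst p))"
  using conn unfolding conn_coords_def by (intro eventually_nhds_fst) blast

lemma bilinear_at: "bilinear (A x)"
  using eventually_nhds_x_imp_x conn unfolding conn_coords_def by blast

lemma conn_smooth:
  shows "smooth_at (x, y) (\<lambda>p. A (fst p) t (snd p))"
    and "fd (\<lambda>p. A (fst p) t (snd p)) (x, y) w = fd (\<lambda>z. A z t y) x (fst w) + A x t (snd w)"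
proof -
  have lin: "\<forall>\<^sub>F p in nhds (x, y). linear (A (fst p) t)"
    using bilinear_near by eventually_elim (simp add: bilinear_def)
  have sm: "smooth_at x (\<lambda>z. A z t v)" for v
    using conn unfolding conn_coords_def by blast
  have sm': "smooth_at (x, y) (\<lambda>p. A (fst p) t v)" for v
    using smooth_at_fst_compose(1)[of "(x, y)" "\<lambda>z. A z t v"] sm by simp
  note f = smooth_at_family[OF lin sm' smooth_at_linear'[OF bounded_linear_snd]]
  show "smooth_at (x, y) (\<lambda>p. A (fst p) t (snd p))"
    by (rule f)
  show "fd (\<lambda>p. A (fst p) t (snd p)) (x, y) w = fd (\<lambda>z. A z t y) x (fst w) + A x t (snd w)"
    unfolding f(2) using smooth_at_fst_compose(2)[of "(x, y)" "\<lambda>z. A z t y" w] sm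
      fd_bounded_linear[OF bounded_linear_snd smooth_at_id, of "(x, y)" w] by simp
qed

lemma mframe_smooth: "smooth_at (x, y) (\<lambda>p. mframe A p \<sigma>)" "smooth_at (x, y) (\<lambda>p. mcoframe A p z)"
  unfolding mframe_def mcoframe_def conn_adj_def
  by (intro smooth_at_intros conn_smooth)+

text \<open>With \<open>z\<close> fixed, pairing commutes with differentiation, and by
  \<open>cpair_mframe\<close> only the two terms containing \<open>A\<close> vary with the
  point.\<close>

lemma cpair_fd_mframe: "cpair (fd (\<lambda>q. mframe A q \<sigma>) (x, y) w) z = omega A x y w \<sigma> z"
proof -
  have ev: "\<forall>\<^sub>F q in nhds (x, y). cpair (mframe A q \<sigma>) z =
    tc \<sigma> \<bullet> fst (fst z) + fc \<sigma> \<bullet> A (fst q) (fst (fst z)) (snd q)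
    + fc \<sigma> \<bullet> snd (fst z) + fst (snd z) \<bullet> tm \<sigma> + snd (snd z) \<bullet> (vc \<sigma> - A (fst q) (tm \<sigma>) (snd q))"
    using bilinear_near[of y] by (rule eventually_mono) (rule cpair_mframe)
  have "cpair (fd (\<lambda>q. mframe A q \<sigma>) (x, y) w) z = fd (\<lambda>q. cpair (mframe A q \<sigma>) z) (x, y) w"
    unfolding fd_cpair[OF mframe_smooth(1) smooth_at_const] by (simp add: cpair_def)
  also note fd_cong[OF ev]
  also have "fd (\<lambda>q. tc \<sigma> \<bullet> fst (fst z) + fc \<sigma> \<bullet> A (fst q) (fst (fst z)) (snd q)
    + fc \<sigma> \<bullet> snd (fst z) + fst (snd z) \<bullet> tm \<sigma> + snd (snd z) \<bullet> (vc \<sigma> - A (fst q) (tm \<sigma>) (snd q))) (x, y) w =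
      omega A x y w \<sigma> z"
    by (simp add: fd_add fd_diff fd_inner smooth_at_intros conn_smooth omega_def inner_diff_right)
  finally show ?thesis .
qed

end

section \<open>Brackets in the moving frame and the Nijenhuis tensor\<close>

definition torsion1 :: "('e \<Rightarrow> 'f \<Rightarrow> 'f::euclidean_space) \<Rightarrow> ('f, 'e) mvec \<Rightarrow>
    ('f, 'e) mvec \<Rightarrow> ('f, 'e) mvec \<Rightarrow> real" where
  "torsion1 B a b c = fc a \<bullet> (B (tm b) (vc c) - B (tm c) (vc b))"

text \<open>For the connection form at a point, this is the Courant bracket of the frame fields with
  constant components \<open>a\<close> and \<open>b\<close>, paired with that of \<open>c\<close>.
  For constant components the covariant derivative of \<open>v\<close> along \<open>t\<close> is
  \<open>B t v\<close>.\<close>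

definition torsion :: "('e \<Rightarrow> 'f \<Rightarrow> 'f::euclidean_space) \<Rightarrow> ('f, 'e) mvec \<Rightarrow>
    ('f, 'e) mvec \<Rightarrow> ('f, 'e) mvec \<Rightarrow> real" where
  "torsion B a b c = torsion1 B a b c + torsion1 B b c a + torsion1 B c a b"

text \<open>By flatness the terms that depend on the fibre coordinate \<open>y\<close> cancel.\<close>

lemma torsion_omega:
  fixes A :: "('e::euclidean_space, 'f::euclidean_space) cform" and y :: 'f
  assumes conn: "conn_coords A x" and flat: "flat_coords A x"
  defines "\<Omega> \<equiv> \<lambda>a b c. omega A x y (fst (mframe A (x, y) a)) b (mframe A (x, y) c)"
  shows "\<Omega> a b c - \<Omega> b a c + (\<Omega> c a b - \<Omega> c b a) / 2 = torsion (A x) a b c"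
proof -
  note B = bilinear_simps[OF bilinear_at[OF conn]]
  have F: "f \<bullet> fd (\<lambda>u. A u t y) x h = f \<bullet> fd (\<lambda>u. A u h y) x t - f \<bullet> A x h (A x t y) + f \<bullet> A x t (A x h y)"
    for f h t
  proof -
    have "fd (\<lambda>u. A u t y) x h = fd (\<lambda>u. A u h y) x t - A x h (A x t y) + A x t (A x h y)"
      using flat unfolding flat_coords_def by (auto simp: algebra_simps eq_diff_eq)
    then show ?thesis
      by (simp add: inner_diff_right inner_add_right)
  qed
  show ?thesis
    unfolding \<Omega>_def omega_def mframe_def torsion_def torsion1_def
    using F[of "fc a" "tm b" "tm c"] F[of "fc b" "tm a" "tm c"] F[of "fc c" "tm a" "tm b"]
    by (simp add: B inner_diff_right inner_add_right field_simps)
qed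

text \<open>The Courant bracket of two sections in the moving frame, paired with \<open>c\<close>.
  Only the values \<open>a\<close>, \<open>b\<close> and the derivatives \<open>S\<close>,
  \<open>T\<close> of the components at one point enter; \<open>d\<close> is the anchor, sending
  components to a tangent vector. As a parameter it can be
  \<open>\<lambda>a. fst (mframe A (x, y) a)\<close> on the total space and \<open>tm\<close> on the
  base.\<close>

definition bracket_form where
  "bracket_form B d S a T b c =
     cpair (T (d a)) c - cpair (S (d b)) c + (cpair (S (d c)) b - cpair a (T (d c))) / 2 + torsion B a b c"

text \<open>Differentiating \<open>mframe A q (\<sigma> q)\<close> yields a derivative of the frame
  and one of the components. The first kind adds up to \<open>torsion\<close> by
  \<open>torsion_omega\<close>; in the second the frame disappears from the pairing by
  orthogonality.\<close>

lemma cpair_ccourant_mframe: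
  assumes conn: "conn_coords A x" and flat: "flat_coords A x"
    and sm: "smooth_at (x, y) \<sigma>" "smooth_at (x, y) \<tau>"
  shows "cpair (ccourant (\<lambda>q. mframe A q (\<sigma> q)) (\<lambda>q. mframe A q (\<tau> q)) (x, y)) (mframe A (x, y) c) =
    bracket_form (A x) (\<lambda>a. fst (mframe A (x, y) a)) (fd \<sigma> (x, y)) (\<sigma> (x, y)) (fd \<tau> (x, y)) (\<tau> (x, y)) c"
proof -
  let ?p = "(x, y)"
  have lin: "\<forall>\<^sub>F p in nhds ?p. linear (mframe A p)"
    using bilinear_near[OF conn, of y] by eventually_elim (simp add: linear_mframe)
  note fam = smooth_at_family[OF lin mframe_smooth(1)[OF conn]]
  have orth: "cpair (mframe A ?p a) (mframe A ?p b) = cpair a b" for a b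
    using cpair_mframe_mframe[of A ?p] bilinear_at[OF conn] by simp
  have fdm: "cpair (fd (\<lambda>q. mframe A q (\<rho> q)) ?p w) (mframe A ?p a) =
      omega A x y w (\<rho> ?p) (mframe A ?p a) + cpair (fd \<rho> ?p w) a" if "smooth_at ?p \<rho>" for \<rho> w a
    unfolding fam(2)[OF that] cpair_add_left orth cpair_fd_mframe[OF conn] ..
  show ?thesis
    unfolding cpair_ccourant[OF fam(1)[OF sm(1)] fam(1)[OF sm(2)]] fdm[OF sm(1)] fdm[OF sm(2)]
      cpair_commute[of "mframe A ?p (\<sigma> ?p)"] bracket_form_def cpair_commute[of "\<sigma> ?p"]
      torsion_omega[OF conn flat, where y = y, symmetric]
    by (simp add: field_simps)
qed

definition acs_coords ::
  "('e::euclidean_space \<Rightarrow> ('f::euclidean_space, 'e) mvec \<Rightarrow> ('f, 'e) mvec) \<Rightarrow> 'e \<Rightarrow> bool" where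
  "acs_coords K x \<longleftrightarrow>
    (\<forall>\<^sub>F y in nhds x. linear (K y) \<and> (\<forall>z. K y (K y z) = - z) \<and> (\<forall>z w. cpair (K y z) (K y w) = cpair z w)) \<and>
    (\<forall>z. smooth_at x (\<lambda>y. K y z))"

text \<open>The Nijenhuis tensor of \<open>J\<close> on sections \<open>a\<close>, \<open>b\<close> pulled back from the base, paired
  with \<open>c\<close>, up to sign.\<close>

definition nijenhuis_form where
  "nijenhuis_form A K x a b c =
    (let DK = (\<lambda>a h. fd (\<lambda>y. K y a) x h); O' = (\<lambda>h. 0) in
     bracket_form (A x) tm O' a O' b (K x c)
     - bracket_form (A x) tm (DK a) (K x a) (DK b) (K x b) (K x c)
     + bracket_form (A x) tm O' a (DK b) (K x b) c
     + bracket_form (A x) tm (DK a) (K x a) O' b c)"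

text \<open>The Nijenhuis expression is tensorial: the derivatives \<open>S\<close> and \<open>T\<close> of the two sections
  cancel because \<open>K\<close> is orthogonal with square \<open>- 1\<close>.\<close>

lemma bracket_form_cancel:
  assumes lin: "linear K" and sq: "\<And>z. K (K z) = - z" and orth: "\<And>z w. cpair (K z) (K w) = cpair z w"
  shows "bracket_form B d S a T b (K c)
    - bracket_form B d (\<lambda>w. P w + K (S w)) (K a) (\<lambda>w. Q w + K (T w)) (K b) (K c)
    + bracket_form B d S a (\<lambda>w. Q w + K (T w)) (K b) c
    + bracket_form B d (\<lambda>w. P w + K (S w)) (K a) T b c =
    bracket_form B d (\<lambda>w. 0) a (\<lambda>w. 0) b (K c) - bracket_form B d P (K a) Q (K b) (K c)
    + bracket_form B d (\<lambda>w. 0) a Q (K b) c + bracket_form B d P (K a) (\<lambda>w. 0) b c"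
proof -
  have skew: "cpair (K u) v = - cpair u (K v)" for u v
    using orth[of u "K v"] by (simp add: sq cpair_minus_right)
  have z: "cpair 0 u = 0" "cpair u 0 = 0" for u :: "('a \<times> 'b) \<times> ('a \<times> 'b)"
    by (simp_all add: cpair_def)
  show ?thesis
    unfolding bracket_form_def cpair_add_left cpair_add_right orth
    by (simp add: skew sq cpair_minus_right z field_simps)
qed

text \<open>Every section is a frame combination with components given by \<open>mcoframe\<close>,
  and by \<open>bracket_form_cancel\<close> only their values at the point matter. The right-hand
  side does not mention the fibre coordinate \<open>y\<close>, which makes integrability a condition
  on the base.\<close>

lemma nijenhuis_total:
  assumes conn: "conn_coords A x" and flat: "flat_coords A x" and K: "acs_coords K x"
  defines "Kt \<equiv> \<lambda>q z. mframe A q (K (fst q) (mcoframe A q z))"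
  shows "(\<forall>s t. smooth_at (x, y) s \<longrightarrow> smooth_at (x, y) t \<longrightarrow>
      Kt (x, y) (ccourant s t (x, y) - ccourant (\<lambda>q. Kt q (s q)) (\<lambda>q. Kt q (t q)) (x, y)) =
      ccourant s (\<lambda>q. Kt q (t q)) (x, y) + ccourant (\<lambda>q. Kt q (s q)) t (x, y)) \<longleftrightarrow>
    (\<forall>a b c. nijenhuis_form A K x a b c = 0)" (is "(\<forall>s t. _ \<longrightarrow> _ \<longrightarrow> ?N s t) \<longleftrightarrow> _")
proof -
  let ?p = "(x, y)"
  have Kx: "linear (K x)" "\<And>z. K x (K x z) = - z" "\<And>z w. cpair (K x z) (K x w) = cpair z w"
    using eventually_nhds_x_imp_x[OF conjunct1[OF K[unfolded acs_coords_def]]] by blast+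
  have skew: "cpair (K x u) v = - cpair u (K x v)" for u v
    using Kx(3)[of u "K x v"] by (simp add: Kx(2) cpair_minus_right)
  have Ksm: "smooth_at x (\<lambda>y. K y z)" for z
    using K unfolding acs_coords_def by blast
  have Kfst: "smooth_at ?p (\<lambda>q. K (fst q) z)" "fd (\<lambda>q. K (fst q) z) ?p w = fd (\<lambda>y. K y z) x (fst w)" for z w
    using smooth_at_fst_compose[of ?p "\<lambda>y. K y z"] Ksm by simp_all
  have "\<forall>\<^sub>F y in nhds x. linear (K y)"
    using K unfolding acs_coords_def by (auto elim: eventually_mono)
  then have Klin: "\<forall>\<^sub>F q in nhds ?p. linear (K (fst q))"
    by (rule eventually_nhds_fst)
  note Kfam = smooth_at_family[OF Klin Kfst(1)]
  have orth: "cpair (mframe A ?p a) (mframe A ?p b) = cpair a b" for a b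
    using cpair_mframe_mframe[of A ?p] bilinear_at[OF conn] by simp
  have eq_iff: "a = b \<longleftrightarrow> (\<forall>c. cpair a (mframe A ?p c) = cpair b (mframe A ?p c))" for a b
  proof
    assume *: "\<forall>c. cpair a (mframe A ?p c) = cpair b (mframe A ?p c)"
    show "a = b"
      by (rule cpair_eqI) (use *[THEN spec, of "mcoframe A ?p _"] in simp)
  qed simp
  have key: "?N (\<lambda>q. mframe A q (\<sigma> q)) (\<lambda>q. mframe A q (\<tau> q)) \<longleftrightarrow>
      (\<forall>c. nijenhuis_form A K x (\<sigma> ?p) (\<tau> ?p) c = 0)"
    if sm: "smooth_at ?p \<sigma>" "smooth_at ?p \<tau>" for \<sigma> \<tau>
  proof -
    let ?s = "\<lambda>q. mframe A q (\<sigma> q)" and ?t = "\<lambda>q. mframe A q (\<tau> q)"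
    let ?Ks = "\<lambda>q. mframe A q (K (fst q) (\<sigma> q))" and ?Kt = "\<lambda>q. mframe A q (K (fst q) (\<tau> q))"
    have "Kt q (?s q) = ?Ks q" "Kt q (?t q) = ?Kt q" for q
      by (simp_all add: Kt_def)
    then have "?N ?s ?t \<longleftrightarrow>
      Kt ?p (ccourant ?s ?t ?p - ccourant ?Ks ?Kt ?p) = ccourant ?s ?Kt ?p + ccourant ?Ks ?t ?p"
      by simp
    also have "\<dots> \<longleftrightarrow> (\<forall>c. cpair (Kt ?p (ccourant ?s ?t ?p - ccourant ?Ks ?Kt ?p)) (mframe A ?p c) =
        cpair (ccourant ?s ?Kt ?p + ccourant ?Ks ?t ?p) (mframe A ?p c))"
      by (rule eq_iff)
    also have "\<dots> \<longleftrightarrow> (\<forall>c. nijenhuis_form A K x (\<sigma> ?p) (\<tau> ?p) c = 0)"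
    proof (intro all_cong1)
      fix c
      \<comment> \<open>Being orthogonal with square \<open>-1\<close>, \<open>K\<close> is skew and
        moves onto the test vector; hence the arguments \<open>K x c\<close> in
        \<open>nijenhuis_form\<close>.\<close>
      have "cpair (Kt ?p u) (mframe A ?p c) = - cpair u (mframe A ?p (K x c))" for u
        unfolding Kt_def orth using skew orth[of "mcoframe A ?p u" "K x c"] by simp
      then have "cpair (Kt ?p (ccourant ?s ?t ?p - ccourant ?Ks ?Kt ?p)) (mframe A ?p c) =
          - (cpair (ccourant ?s ?t ?p) (mframe A ?p (K x c))
            - cpair (ccourant ?Ks ?Kt ?p) (mframe A ?p (K x c)))"
        by (simp add: cpair_diff_left)
      moreover have "fd (\<lambda>q. K (fst q) (\<sigma> q)) ?p = (\<lambda>w. fd (\<lambda>y. K y (\<sigma> ?p)) x (fst w) + K x (fd \<sigma> ?p w))"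
        "fd (\<lambda>q. K (fst q) (\<tau> q)) ?p = (\<lambda>w. fd (\<lambda>y. K y (\<tau> ?p)) x (fst w) + K x (fd \<tau> ?p w))"
        using Kfam(2)[OF sm(1)] Kfam(2)[OF sm(2)] Kfst(2) by (simp_all add: fun_eq_iff)
      \<comment> \<open>The derivatives of \<open>K\<close> are pulled back from the base and see
        only the base part of the anchor, which is \<open>tm\<close>. So the anchor of the total
        space may replace \<open>tm\<close>.\<close>
      moreover have "nijenhuis_form A K x (\<sigma> ?p) (\<tau> ?p) c =
        bracket_form (A x) (\<lambda>a. fst (mframe A ?p a)) (\<lambda>w. 0) (\<sigma> ?p) (\<lambda>w. 0) (\<tau> ?p) (K x c)
        - bracket_form (A x) (\<lambda>a. fst (mframe A ?p a)) (\<lambda>w. fd (\<lambda>y. K y (\<sigma> ?p)) x (fst w)) (K x (\<sigma> ?p))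
            (\<lambda>w. fd (\<lambda>y. K y (\<tau> ?p)) x (fst w)) (K x (\<tau> ?p)) (K x c)
        + bracket_form (A x) (\<lambda>a. fst (mframe A ?p a)) (\<lambda>w. 0) (\<sigma> ?p)
            (\<lambda>w. fd (\<lambda>y. K y (\<tau> ?p)) x (fst w)) (K x (\<tau> ?p)) c
        + bracket_form (A x) (\<lambda>a. fst (mframe A ?p a)) (\<lambda>w. fd (\<lambda>y. K y (\<sigma> ?p)) x (fst w)) (K x (\<sigma> ?p))
            (\<lambda>w. 0) (\<tau> ?p) c"
        unfolding nijenhuis_form_def Let_def bracket_form_def by (simp add: mframe_def)
      ultimately show "cpair (Kt ?p (ccourant ?s ?t ?p - ccourant ?Ks ?Kt ?p)) (mframe A ?p c) =
          cpair (ccourant ?s ?Kt ?p + ccourant ?Ks ?t ?p) (mframe A ?p c) \<longleftrightarrow>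
        nijenhuis_form A K x (\<sigma> ?p) (\<tau> ?p) c = 0"
        unfolding cpair_add_left cpair_ccourant_mframe[OF conn flat sm]
          cpair_ccourant_mframe[OF conn flat Kfam(1)[OF sm(1)] Kfam(1)[OF sm(2)]]
          cpair_ccourant_mframe[OF conn flat sm(1) Kfam(1)[OF sm(2)]]
            cpair_ccourant_mframe[OF conn flat Kfam(1)[OF sm(1)] sm(2)]
        using bracket_form_cancel[OF Kx, of "A x" "\<lambda>a. fst (mframe A ?p a)" "fd \<sigma> ?p" "\<sigma> ?p" "fd \<tau> ?p" "\<tau> ?p" c
            "\<lambda>w. fd (\<lambda>y. K y (\<sigma> ?p)) x (fst w)" "\<lambda>w. fd (\<lambda>y. K y (\<tau> ?p)) x (fst w)"]
        by simp linarith
    qed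
    finally show ?thesis .
  qed
  show ?thesis
  proof
    assume l: "\<forall>s t. smooth_at ?p s \<longrightarrow> smooth_at ?p t \<longrightarrow> ?N s t"
    show "\<forall>a b c. nijenhuis_form A K x a b c = 0"
    proof (intro allI)
      fix a b c
      have "?N (\<lambda>q. mframe A q a) (\<lambda>q. mframe A q b)"
        using l mframe_smooth(1)[OF conn] by blast
      then show "nijenhuis_form A K x a b c = 0"
        using key[of "\<lambda>_. a" "\<lambda>_. b"] smooth_at_const by blast
    qed
  next
    assume r: "\<forall>a b c. nijenhuis_form A K x a b c = 0"
    show "\<forall>s t. smooth_at ?p s \<longrightarrow> smooth_at ?p t \<longrightarrow> ?N s t"
    proof (intro allI impI)
      fix s t :: "'a \<times> 'b \<Rightarrow> ('a \<times> 'b) \<times> ('a \<times> 'b)"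
      assume st: "smooth_at ?p s" "smooth_at ?p t"
      have lin: "\<forall>\<^sub>F p in nhds ?p. linear (mcoframe A p)"
        using bilinear_near[OF conn, of y] by eventually_elim (simp add: linear_mframe)
      note fam = smooth_at_family(1)[OF lin mframe_smooth(2)[OF conn]]
      show "?N s t"
        using key[OF fam[OF st(1)] fam[OF st(2)]] r by simp
    qed
  qed
qed

section \<open>The interchange of a bundle and its dual in coordinates\<close>

definition dswap :: "('f, 'e) mvec \<Rightarrow> ('f, 'e) mvec" where
  "dswap a = ((fc a, tm a), (vc a, tc a))"

lemma dswap_components [simp]: "vc (dswap a) = fc a" "fc (dswap a) = vc a" "tm (dswap a) = tm a"
  "tc (dswap a) = tc a"
  by (simp_all add: dswap_def components)

lemma dswap_twice [simp]: "dswap (dswap a) = a"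
  by (simp add: dswap_def components)

lemma dswap_0 [simp]: "dswap 0 = 0"
  by (simp add: dswap_def components zero_prod_def)

lemma cpair_dswap: "cpair (dswap a) (dswap b) = cpair a b"
  by (simp add: cpair_components inner_commute)

lemma linear_dswap: "linear dswap"
  by (intro linearI) (simp_all add: dswap_def components)

lemma bounded_linear_dswap:
  "bounded_linear (dswap :: ('f::euclidean_space \<times> 'e::euclidean_space) \<times> ('f \<times> 'e) \<Rightarrow> _)"
  using linear_dswap linear_conv_bounded_linear by blast

text \<open>The form \<open>- A^T\<close> for the inner product; it belongs to the dual connection
  in the dual frame (\<open>conn_form_dual\<close>).\<close>

definition dual_form :: "('e, 'f::euclidean_space) cform \<Rightarrow> ('e, 'f) cform" where
  "dual_form A y t v = - (\<Sum>b\<in>Basis. (v \<bullet> A y t b) *\<^sub>R b)"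

lemma dual_form_inner:
  assumes "bilinear (A y)" shows "dual_form A y t v \<bullet> w = - (v \<bullet> A y t w)"
proof -
  have "linear (\<lambda>w. v \<bullet> A y t w)"
    by (intro linearI) (simp_all add: bilinear_simps[OF assms] inner_add_right)
  from linear_expand[OF this, of w] show ?thesis
    by (simp add: dual_form_def inner_sum_left inner_commute[of w] mult.commute)
qed

lemma bilinear_dual_form:
  assumes "bilinear (A y)" shows "bilinear (dual_form A y)"
  unfolding bilinear_def
  by (intro conjI allI linearI)
    (simp_all add: dual_form_def bilinear_simps[OF assms] inner_add_right inner_add_left
      scaleR_add_left sum.distrib scaleR_sum_right)

lemma conn_coords_dual:
  assumes "conn_coords A x" shows "conn_coords (dual_form A) x"
proof -
  have sm: "smooth_at x (\<lambda>y. A y t v)" for t v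
    using assms unfolding conn_coords_def by blast
  have "\<forall>\<^sub>F y in nhds x. bilinear (dual_form A y)"
    using conjunct1[OF assms[unfolded conn_coords_def]] by (rule eventually_mono) (rule bilinear_dual_form)
  moreover have "smooth_at x (\<lambda>y. dual_form A y t v)" for t v
    unfolding dual_form_def by (intro smooth_at_intros sm)
  ultimately show ?thesis
    unfolding conn_coords_def by blast
qed

text \<open>The curvature of \<open>- A^T\<close> is minus the transpose of the curvature of
  \<open>A\<close>: the two signs in a product cancel, and transposition reverses its factors, which
  changes the sign of the commutator.\<close>

lemma flat_coords_dual:
  assumes conn: "conn_coords A x" and flat: "flat_coords A x"
  shows "flat_coords (dual_form A) x"
  unfolding flat_coords_def
proof (intro allI, rule vector_eq_rdot[THEN iffD1], intro allI)
  fix h t v w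
  have sm: "smooth_at x (\<lambda>y. A y t v)" "smooth_at x (\<lambda>y. dual_form A y t v)" for t v
    using conn conn_coords_dual[OF conn] unfolding conn_coords_def by blast+
  note B = dual_form_inner[of A, OF bilinear_at[OF conn]]
  have D: "fd (\<lambda>y. dual_form A y t v) x h \<bullet> w = - (v \<bullet> fd (\<lambda>y. A y t w) x h)" for h t
  proof -
    have "\<forall>\<^sub>F y in nhds x. dual_form A y t v \<bullet> w = - (v \<bullet> A y t w)"
      using conjunct1[OF conn[unfolded conn_coords_def]] by (rule eventually_mono) (rule dual_form_inner)
    from fd_cong[OF this] have "fd (\<lambda>y. dual_form A y t v \<bullet> w) x h = fd (\<lambda>y. - (v \<bullet> A y t w)) x h"
      by simp
    then show ?thesis
      by (simp add: fd_inner fd_uminus smooth_at_intros sm)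
  qed
  have "v \<bullet> (fd (\<lambda>y. A y t w) x h - fd (\<lambda>y. A y h w) x t + A x h (A x t w) - A x t (A x h w)) = 0"
    using flat unfolding flat_coords_def by simp
  then show "(fd (\<lambda>y. dual_form A y t v) x h - fd (\<lambda>y. dual_form A y h v) x t
      + dual_form A x h (dual_form A x t v) - dual_form A x t (dual_form A x h v)) \<bullet> w = 0 \<bullet> w"
    by (simp add: inner_diff_left inner_add_left inner_diff_right inner_add_right B D)
qed

text \<open>The summands \<open>torsion1\<close> are not invariant one by one. In the dual one for
  \<open>a b c\<close>, moving the form to the other factor gives \<open>fc b \<bullet> A x (tm c)
  (vc a) - fc c \<bullet> A x (tm b) (vc a)\<close>. These products occur with the same signs in the
  original summands for \<open>b c a\<close> and \<open>c a b\<close>, so the cyclic sum is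
  unchanged.\<close>

lemma torsion_dual:
  assumes "bilinear (A x)"
  shows "torsion (dual_form A x) (dswap a) (dswap b) (dswap c) = torsion (A x) a b c"
proof -
  have "u \<bullet> dual_form A x t v = - (v \<bullet> A x t u)" for u t v
    using dual_form_inner[of A x, OF assms] by (simp add: inner_commute)
  then show ?thesis
    by (simp add: torsion_def torsion1_def inner_diff_right)
qed

lemma bracket_form_dual:
  assumes "bilinear (A x)"
  shows "bracket_form (dual_form A x) tm (\<lambda>h. dswap (S h)) (dswap a) (\<lambda>h. dswap (T h)) (dswap b) (dswap c) =
    bracket_form (A x) tm S a T b c"
  by (simp add: bracket_form_def cpair_dswap torsion_dual[of A x, OF assms])

lemma acs_coords_swap:
  assumes "acs_coords K x" shows "acs_coords (\<lambda>y z. dswap (K y (dswap z))) x"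
proof -
  have "linear (\<lambda>z. dswap (k (dswap z)))" if "linear k" for k
    using linear_compose[OF linear_compose[OF linear_dswap that] linear_dswap] by (simp add: comp_def)
  then have "\<forall>\<^sub>F y in nhds x. linear (\<lambda>z. dswap (K y (dswap z))) \<and>
    (\<forall>z. dswap (K y (dswap (dswap (K y (dswap z))))) = - z) \<and>
      (\<forall>z w. cpair (dswap (K y (dswap z))) (dswap (K y (dswap w))) = cpair z w)"
    using conjunct1[OF assms[unfolded acs_coords_def]]
    by (auto elim!: eventually_mono simp: cpair_dswap linear_neg[OF linear_dswap])
  moreover have "smooth_at x (\<lambda>y. dswap (K y (dswap z)))" for z
    using conjunct2[OF assms[unfolded acs_coords_def]] by (intro smooth_at_linear[OF bounded_linear_dswap]) simp
  ultimately show ?thesis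
    unfolding acs_coords_def by simp
qed

text \<open>\<open>dswap\<close> is a fixed linear involution that preserves \<open>cpair\<close>
  and \<open>tm\<close> and commutes with derivatives, so the four bracket forms agree one by
  one.\<close>

lemma nijenhuis_form_dual:
  assumes conn: "conn_coords A x" and K: "acs_coords K x"
  shows "nijenhuis_form (dual_form A) (\<lambda>y z. dswap (K y (dswap z))) x (dswap a) (dswap b) (dswap c) =
    nijenhuis_form A K x a b c"
proof -
  have D: "fd (\<lambda>y. dswap (K y z)) x = (\<lambda>h. dswap (fd (\<lambda>y. K y z) x h))" for z
    using fd_bounded_linear[OF bounded_linear_dswap conjunct2[OF K[unfolded acs_coords_def], THEN spec]]
    by (simp add: fun_eq_iff)
  note b = bracket_form_dual[of A x, OF bilinear_at[OF conn]]
  show ?thesis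
    unfolding nijenhuis_form_def Let_def dswap_twice D
    using b[of "\<lambda>h. 0" a "\<lambda>h. 0" b "K x c"] b[of "fd (\<lambda>y. K y a) x" "K x a" "fd (\<lambda>y. K y b) x" "K x b" "K x c"]
      b[of "\<lambda>h. 0" a "fd (\<lambda>y. K y b) x" "K x b" c] b[of "fd (\<lambda>y. K y a) x" "K x a" "\<lambda>h. 0" b c]
    by simp
qed

section \<open>Charts of the total space\<close>

context smooth_bundle
begin

definition tdom :: "'a set \<Rightarrow> 'a set \<Rightarrow> ('a \<times> 'v) set" where
  "tdom U W = Sigma (U \<inter> W) (fib V)"

definition tchart :: "('a \<Rightarrow> 'e) \<Rightarrow> ('a \<Rightarrow> 'f \<Rightarrow> 'v) \<Rightarrow> 'a \<times> 'v \<Rightarrow> 'e \<times> 'f" where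
  "tchart \<phi> e = (\<lambda>(x, v). (\<phi> x, inv (e x) v))"

lemma total_spaceI: "(U, \<phi>) \<in> M \<Longrightarrow> (W, e) \<in> triv V \<Longrightarrow> (tdom U W, tchart \<phi> e) \<in> total_space M V"
  unfolding total_space_def tdom_def tchart_def by (rule image_eqI[of _ _ "((U, \<phi>), (W, e))"]) auto

lemma total_spaceE:
  assumes "(X, \<theta>) \<in> total_space M V"
  obtains U \<phi> W e where "(U, \<phi>) \<in> M" "(W, e) \<in> triv V" "X = tdom U W" "\<theta> = tchart \<phi> e"
  using assms unfolding total_space_def tdom_def tchart_def by auto

lemma open_chart_triv:
  "(U, \<phi>) \<in> M \<Longrightarrow> openin (atlas_topology M) W \<Longrightarrow> open (\<phi> ` (U \<inter> W))"
  unfolding openin_iff by (auto simp: Int_commute)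

context
  fixes U \<phi> W e
  assumes c: "(U, \<phi>) \<in> M" and t: "(W, e) \<in> triv V"
begin

lemma tchart_inj: "inj_on (tchart \<phi> e) (tdom U W)"
proof (rule inj_onI, clarify)
  fix x v y w
  assume *: "(x, v) \<in> tdom U W" "(y, w) \<in> tdom U W" "tchart \<phi> e (x, v) = tchart \<phi> e (y, w)"
  then have "x = y"
    using chart_inj[OF c] by (auto simp: tchart_def tdom_def inj_on_def)
  then show "x = y \<and> v = w"
    using * inv_triv[OF t] by (auto simp: tchart_def tdom_def) metis
qed

lemma tchart_image: 
  assumes "X \<subseteq> U \<inter> W"
  shows "tchart \<phi> e ` (Sigma X (fib V)) = \<phi> ` X \<times> UNIV"
proof (rule set_eqI, clarify)
  fix y z
  have "(y, z) \<in> tchart \<phi> e ` (Sigma X (fib V))" if "x \<in> X" "y = \<phi> x" for x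
    using that assms t by (intro image_eqI[of _ _ "(x, e x z)"]) (auto simp: tchart_def)
  then show "(y, z) \<in> tchart \<phi> e ` (Sigma X (fib V)) \<longleftrightarrow> (y, z) \<in> \<phi> ` X \<times> UNIV"
    by (auto simp: tchart_def)
qed

lemma tchart_open: "open (tchart \<phi> e ` tdom U W)"
  unfolding tdom_def tchart_image[OF order_refl]
  using open_chart_triv[OF c triv_openin[OF t]] by (intro open_Times) auto

lemma tchart_inv:
  assumes "x \<in> U" "x \<in> W"
  shows "inv_into (tdom U W) (tchart \<phi> e) (\<phi> x, z) = (x, e x z)"
proof -
  have "(x, e x z) \<in> tdom U W" "tchart \<phi> e (x, e x z) = (\<phi> x, z)"
    using assms t by (auto simp: tdom_def tchart_def)
  then show ?thesis
    using inv_into_f_f[OF tchart_inj] by metis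
qed

lemma eventually_tchart:
  assumes "x \<in> U" "x \<in> W"
  shows "\<forall>\<^sub>F q in nhds (\<phi> x, z). fst q \<in> \<phi> ` U \<and> inv_into U \<phi> (fst q) \<in> U \<and> inv_into U \<phi> (fst q) \<in> W \<and>
    \<phi> (inv_into U \<phi> (fst q)) = fst q \<and>
    inv_into (tdom U W) (tchart \<phi> e) q = (inv_into U \<phi> (fst q), e (inv_into U \<phi> (fst q)) (snd q))"
  using eventually_nhds_fst[OF eventually_coordinate[OF c assms(1) triv_openin[OF t] assms(2)]]
proof eventually_elim
  case (elim q)
  then show ?case
    using tchart_inv[of "inv_into U \<phi> (fst q)" "snd q"] by simp
qed

end

lemma frame_change:
  assumes c: "(U, \<phi>) \<in> M" "x \<in> U" and t: "(W, e) \<in> triv V" "x \<in> W" and t': "(W', d) \<in> triv V" "x \<in> W'"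
  shows "\<forall>\<^sub>F y in nhds (\<phi> x). linear (\<lambda>u. inv (d (inv_into U \<phi> y)) (e (inv_into U \<phi> y) u))"
    and "smooth_at (\<phi> x) (\<lambda>y. inv (d (inv_into U \<phi> y)) (e (inv_into U \<phi> y) u))"
proof -
  show "\<forall>\<^sub>F y in nhds (\<phi> x). linear (\<lambda>u. inv (d (inv_into U \<phi> y)) (e (inv_into U \<phi> y) u))"
    using eventually_coordinate[OF c triv_openin[OF t(1)] t(2)]
      eventually_coordinate[OF c triv_openin[OF t'(1)] t'(2)]
    by eventually_elim (use linear_transition[OF t(1) t'(1)] in blast)
  show "smooth_at (\<phi> x) (\<lambda>y. inv (d (inv_into U \<phi> y)) (e (inv_into U \<phi> y) u))"
    using triv_transition[OF t(1) t'(1) t(2) t'(2)] unfolding smooth_near_iff[OF c] comp_def .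
qed

lemma frame_change_total:
  assumes c: "(U, \<phi>) \<in> M" "x \<in> U" and t: "(W, e) \<in> triv V" "x \<in> W" and t': "(W', d) \<in> triv V" "x \<in> W'"
  shows "smooth_at (\<phi> x, z) (\<lambda>q. inv (d (inv_into U \<phi> (fst q))) (e (inv_into U \<phi> (fst q)) (snd q)))"
    and "fd (\<lambda>q. inv (d (inv_into U \<phi> (fst q))) (e (inv_into U \<phi> (fst q)) (snd q))) (\<phi> x, z) w =
      fd (\<lambda>y. inv (d (inv_into U \<phi> y)) (e (inv_into U \<phi> y) z)) (\<phi> x) (fst w) + inv (d x) (e x (snd w))"
proof -
  note fc = frame_change[OF assms]
  have sm: "smooth_at (\<phi> x, z) (\<lambda>q. inv (d (inv_into U \<phi> (fst q))) (e (inv_into U \<phi> (fst q)) u))" for u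
    using smooth_at_fst_compose(1)[of "(\<phi> x, z)"
      "\<lambda>y. inv (d (inv_into U \<phi> y)) (e (inv_into U \<phi> y) u)"] fc(2) by simp
  note fam = smooth_at_family[OF eventually_nhds_fst[OF fc(1)] sm smooth_at_linear'[OF bounded_linear_snd]]
  show "smooth_at (\<phi> x, z) (\<lambda>q. inv (d (inv_into U \<phi> (fst q))) (e (inv_into U \<phi> (fst q)) (snd q)))"
    by (rule fam)
  show "fd (\<lambda>q. inv (d (inv_into U \<phi> (fst q))) (e (inv_into U \<phi> (fst q)) (snd q))) (\<phi> x, z) w =
      fd (\<lambda>y. inv (d (inv_into U \<phi> y)) (e (inv_into U \<phi> y) z)) (\<phi> x) (fst w) + inv (d x) (e x (snd w))"
    unfolding fam(2) using smooth_at_fst_compose(2)[of "(\<phi> x, z)"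
      "\<lambda>y. inv (d (inv_into U \<phi> y)) (e (inv_into U \<phi> y) z)" w] fc(2)
      fd_bounded_linear[OF bounded_linear_snd smooth_at_id, of "(\<phi> x, z)" w] c by simp
qed

text \<open>A transition map consists of the base transition and a change of frame applied to the
  fibre coordinate. The image of an overlap is an open set of the base chart times the whole model
  fibre.\<close>

lemma total_atlas: "smooth_atlas (total_space M V)"
proof
  fix X \<theta> assume "(X, \<theta>) \<in> total_space M V"
  then show "inj_on \<theta> X" "open (\<theta> ` X)"
    using total_spaceE tchart_inj tchart_open by metis+
next
  fix X \<theta> Y \<eta> assume "(X, \<theta>) \<in> total_space M V" "(Y, \<eta>) \<in> total_space M V"
  then obtain U \<phi> W e U' \<phi>' W' d where
    c: "(U, \<phi>) \<in> M" and t: "(W, e) \<in> triv V" and X: "X = tdom U W" "\<theta> = tchart \<phi> e" and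
    c': "(U', \<phi>') \<in> M" and t': "(W', d) \<in> triv V" and Y: "Y = tdom U' W'" "\<eta> = tchart \<phi>' d"
    by (elim total_spaceE)
  let ?Z = "U \<inter> (W \<inter> (U' \<inter> W'))"
  have XY: "X \<inter> Y = Sigma ?Z (fib V)"
    unfolding X Y tdom_def by auto
  have im: "\<theta> ` (X \<inter> Y) = \<phi> ` ?Z \<times> UNIV"
    unfolding X(2) XY by (rule tchart_image[OF c t]) auto
  have "open (\<phi> ` ?Z)"
    by (intro open_chart_triv[OF c] openin_Int triv_openin[OF t] triv_openin[OF t'] chart_openin[OF c'])
  then show o: "open (\<theta> ` (X \<inter> Y))"
    unfolding im by (intro open_Times) auto
  show "smooth_on (\<theta> ` (X \<inter> Y)) (\<eta> \<circ> inv_into X \<theta>)"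
    unfolding smooth_on_iff_smooth_at[OF o] unfolding im
  proof safe
    fix x z assume x: "x \<in> U" "x \<in> W" "x \<in> U'" "x \<in> W'"
    have "smooth_at (\<phi> x, z) (\<lambda>q. (\<phi>' (inv_into U \<phi> (fst q)),
        inv (d (inv_into U \<phi> (fst q))) (e (inv_into U \<phi> (fst q)) (snd q))))"
      using smooth_at_fst_compose(1)[of "(\<phi> x, z)"
        "\<lambda>y. \<phi>' (inv_into U \<phi> y)"] transition_smooth_at[OF c c' x(1,3)]
      by (intro smooth_at_Pair frame_change_total(1)[OF c x(1) t x(2) t' x(4)]) simp
    moreover have "\<forall>\<^sub>F q in nhds (\<phi> x, z). (\<phi>' (inv_into U \<phi> (fst q)),
        inv (d (inv_into U \<phi> (fst q))) (e (inv_into U \<phi> (fst q)) (snd q))) = (\<eta> \<circ> inv_into X \<theta>) q"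
      using eventually_tchart[OF c t x(1,2)] unfolding X Y
      by eventually_elim (simp add: tchart_def)
    ultimately show "smooth_at (\<phi> x, z) (\<eta> \<circ> inv_into X \<theta>)"
      by (rule smooth_at_transfer)
  qed
qed

end

section \<open>Connection forms\<close>

text \<open>\<open>A\<close> is the connection form of \<open>D\<close> at \<open>x\<close> with respect to a chart \<open>(U, \<phi>)\<close> and a frame \<open>e\<close>.\<close>

definition conn_form ::
  "('a, 'e::euclidean_space) atlas \<Rightarrow> ('a, 'v::real_vector) conn \<Rightarrow> 'a set \<Rightarrow> ('a \<Rightarrow> 'e) \<Rightarrow>
   ('a \<Rightarrow> 'f::euclidean_space \<Rightarrow> 'v) \<Rightarrow> ('e, 'f) cform \<Rightarrow> 'a \<Rightarrow> bool" where
  "conn_form M D U \<phi> e A x \<longleftrightarrow> conn_coords A (\<phi> x) \<and> flat_coords A (\<phi> x) \<and>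
    (\<forall>s \<sigma> h. rep (inv_into U \<phi>) e (\<phi> x) s \<sigma> \<longrightarrow>
      D x (dir_deriv M (U, \<phi>) x h) s = e x (fd \<sigma> (\<phi> x) h + A (\<phi> x) h (\<sigma> (\<phi> x))))"

lemma rep_const:
  "rep \<psi> e y (\<lambda>q. e q v) (\<lambda>_. v)"
  by (simp add: rep_def)

context smooth_bundle
begin

context
  fixes D U \<phi> W e
  assumes conn: "connection M V D" and c: "(U, \<phi>) \<in> M" and t: "(W, e) \<in> triv V"
begin

definition conn_matrix :: "('e, 'f) cform" where
  "conn_matrix y h v = inv (e (inv_into U \<phi> y))
     (D (inv_into U \<phi> y) (dir_deriv M (U, \<phi>) (inv_into U \<phi> y) h) (\<lambda>q. e q v))"

lemma connection_props:
  assumes x: "x \<in> carrier M" and s: "smooth_section_near M V x s" and v: "v \<in> tangent_space M x"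
  shows "D x v s \<in> fib V x"
    and "w \<in> tangent_space M x \<Longrightarrow> D x (v + w) s = D x v s + D x w s"
    and "D x (r *\<^sub>R v) s = r *\<^sub>R D x v s"
    and "smooth_section_near M V x s' \<Longrightarrow> D x v (\<lambda>y. s y + s' y) = D x v s + D x v s'"
    and "smooth_near M x f \<Longrightarrow> D x v (\<lambda>y. f y *\<^sub>R s y) = v f *\<^sub>R s x + f x *\<^sub>R D x v s"
    and "openin (atlas_topology M) O' \<Longrightarrow> x \<in> O' \<Longrightarrow> (\<And>y. y \<in> O' \<Longrightarrow> s'' y = s y) \<Longrightarrow> D x v s'' = D x v s"
proof -
  note P = conjunct1[OF conn[unfolded connection_def], THEN bspec, OF x, THEN spec, THEN mp, OF s]
  show "D x v s \<in> fib V x"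
    by (rule P[THEN conjunct1, rule_format, OF v])
  show "w \<in> tangent_space M x \<Longrightarrow> D x (v + w) s = D x v s + D x w s"
    by (rule P[THEN conjunct2, THEN conjunct1, rule_format, OF v])
  show "D x (r *\<^sub>R v) s = r *\<^sub>R D x v s"
    by (rule P[THEN conjunct2, THEN conjunct2, THEN conjunct1, rule_format, OF v])
  show "smooth_section_near M V x s' \<Longrightarrow> D x v (\<lambda>y. s y + s' y) = D x v s + D x v s'"
    by (rule P[THEN conjunct2, THEN conjunct2, THEN conjunct2, THEN conjunct1, rule_format, OF v])
  show "smooth_near M x f \<Longrightarrow> D x v (\<lambda>y. f y *\<^sub>R s y) = v f *\<^sub>R s x + f x *\<^sub>R D x v s"
    by (rule P[THEN conjunct2, THEN conjunct2, THEN conjunct2, THEN conjunct2, THEN conjunct1, rule_format, OF v])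
  show "D x v s'' = D x v s" if "openin (atlas_topology M) O'" "x \<in> O'" "\<And>y. y \<in> O' \<Longrightarrow> s'' y = s y"
  proof -
    note Q = P[THEN conjunct2, THEN conjunct2, THEN conjunct2, THEN conjunct2, THEN conjunct2, THEN bspec, OF v]
    show ?thesis
      by (rule Q[THEN spec[of _ s''], THEN spec[of _ O'], THEN mp]) (intro conjI ballI that)
  qed
qed

lemma connection_smooth:
  "smooth_section M (tangent_bundle M) O' X \<Longrightarrow> smooth_section M V O' s \<Longrightarrow> smooth_section M V O' (\<lambda>x. D x (X x) s)"
  using conjunct2[OF conn[unfolded connection_def], rule_format, OF conjI] .

context
  fixes x assumes x: "x \<in> U" "x \<in> W"
begin

lemma xc: "x \<in> carrier M"
  using chart_carrier[OF c x(1)] .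

lemma dir_deriv_tangent: "dir_deriv M (U, \<phi>) x h \<in> tangent_space M x"
  using tangent_space_range[OF c x(1)] by blast

lemmas e_section = constant_section_near[OF t x(2)]

lemma conn_matrix_frame: "D x (dir_deriv M (U, \<phi>) x h) (\<lambda>q. e q v) = e x (conn_matrix (\<phi> x) h v)"
  using connection_props(1)[OF xc e_section dir_deriv_tangent] t x c by (simp add: conn_matrix_def)

lemma bilinear_conn_matrix: "bilinear (conn_matrix (\<phi> x))"
proof -
  note D = connection_props[OF xc e_section dir_deriv_tangent]
  note lin = triv_linear[OF t x(2)] and dlin = dir_deriv_linear[OF c x(1)]
  have inj: "a = b" if "e x a = e x b" for a b
    using that triv_inj[OF t x(2)] by (simp add: inj_eq)
  \<comment> \<open>Linearity of \<open>e q\<close> is available only for \<open>q\<close> in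
    \<open>W\<close>, so the two sections agree merely near \<open>x\<close>; the locality of the
    connection bridges the gap.\<close>
  have loc: "D x (dir_deriv M (U, \<phi>) x h) (\<lambda>q. e q (a + b)) = D x (dir_deriv M (U, \<phi>) x h) (\<lambda>q. e q a + e q b)"
    "D x (dir_deriv M (U, \<phi>) x h) (\<lambda>q. e q (r *\<^sub>R a)) =
      D x (dir_deriv M (U, \<phi>) x h) (\<lambda>q. r *\<^sub>R e q a)" for h a b r
    by (rule D(6)[OF triv_openin[OF t] x(2), symmetric]; simp add: linear_add[OF triv_linear[OF t]]
      linear_scale[OF triv_linear[OF t]])+
  \<comment> \<open>Homogeneity in the section will come from the Leibniz rule with a constant
    function, whose derivative vanishes.\<close>
  have r0: "dir_deriv M (U, \<phi>) x h (\<lambda>q. r) = 0" for h r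
  proof -
    have "smooth_near M x (\<lambda>q. r)"
      unfolding smooth_near_iff[OF c x(1)] by (simp add: comp_def)
    then show ?thesis
      by (simp add: dir_deriv_apply comp_def)
  qed
  have rs: "smooth_near M x (\<lambda>q. r)" for r :: real
    unfolding smooth_near_iff[OF c x(1)] by (simp add: comp_def)
  show ?thesis
    unfolding bilinear_def
  proof (intro conjI allI linearI; rule inj)
    fix h k v r
    show "e x (conn_matrix (\<phi> x) h (v + k)) = e x (conn_matrix (\<phi> x) h v + conn_matrix (\<phi> x) h k)" for k
      by (simp add: linear_add[OF lin] conn_matrix_frame[symmetric] loc D(4)[OF e_section])
    show "e x (conn_matrix (\<phi> x) h (r *\<^sub>R v)) = e x (r *\<^sub>R conn_matrix (\<phi> x) h v)"
      by (simp add: linear_scale[OF lin] conn_matrix_frame[symmetric] loc D(5)[OF rs] r0)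
    show "e x (conn_matrix (\<phi> x) (h + k) v) = e x (conn_matrix (\<phi> x) h v + conn_matrix (\<phi> x) k v)" for k
      by (simp add: linear_add[OF lin] linear_add[OF dlin] conn_matrix_frame[symmetric]
        D(2)[OF dir_deriv_tangent])
    show "e x (conn_matrix (\<phi> x) (r *\<^sub>R h) v) = e x (r *\<^sub>R conn_matrix (\<phi> x) h v)"
      by (simp add: linear_scale[OF lin] linear_scale[OF dlin] conn_matrix_frame[symmetric] D(3))
  qed
qed

end

lemma conn_matrix_smooth:
  assumes x: "x \<in> U" "x \<in> W"
  shows "smooth_at (\<phi> x) (\<lambda>y. conn_matrix y h v)"
proof -
  have o: "openin (atlas_topology M) (U \<inter> W)"
    using chart_openin[OF c] triv_openin[OF t] by blast
  have "smooth_section M (tangent_bundle M) (U \<inter> W) (\<lambda>x. dir_deriv M (U, \<phi>) x h)"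
    unfolding TM.smooth_section_iff using o TM.constant_section_near[OF triv_tangent[OF c]] by simp
  moreover have "smooth_section M V (U \<inter> W) (\<lambda>x. e x v)"
    unfolding smooth_section_iff using o constant_section_near[OF t] by simp
  ultimately have "smooth_section_near M V x (\<lambda>x. D x (dir_deriv M (U, \<phi>) x h) (\<lambda>x. e x v))"
    using connection_smooth x unfolding smooth_section_iff by blast
  then obtain \<sigma> where \<sigma>: "rep (inv_into U \<phi>) e (\<phi> x) (\<lambda>x. D x (dir_deriv M (U, \<phi>) x h) (\<lambda>x. e x v)) \<sigma>"
    unfolding section_near_iff[OF c t x] by blast
  have "\<forall>\<^sub>F y in nhds (\<phi> x). \<sigma> y = conn_matrix y h v"
    using conjunct2[OF \<sigma>[unfolded rep_def]] eventually_coordinate[OF c x(1) triv_openin[OF t] x(2)]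
    by eventually_elim (simp add: conn_matrix_def triv_inv[OF t])
  then show ?thesis
    by (rule smooth_at_transfer[OF rep_smooth[OF \<sigma>]])
qed

lemma conn_coords_matrix:
  assumes x: "x \<in> U" "x \<in> W"
  shows "conn_coords conn_matrix (\<phi> x)"
proof -
  have "\<forall>\<^sub>F y in nhds (\<phi> x). bilinear (conn_matrix y)"
    using eventually_coordinate[OF c x(1) triv_openin[OF t] x(2)]
  proof eventually_elim
    case (elim y)
    then show ?case using bilinear_conn_matrix[of "inv_into U \<phi> y"] by simp
  qed
  then show ?thesis
    unfolding conn_coords_def using conn_matrix_smooth[OF x] by blast
qed

text \<open>The section is expanded in the frame near \<open>x\<close>. In the Leibniz rule the
  derivatives of the coefficients add up to \<open>fd \<sigma>\<close>, those of the frame vectors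
  to the connection matrix.\<close>

lemma conn_matrix_rep:
  assumes x: "x \<in> U" "x \<in> W" and s: "rep (inv_into U \<phi>) e (\<phi> x) s \<sigma>"
  shows "D x (dir_deriv M (U, \<phi>) x h) s = e x (fd \<sigma> (\<phi> x) h + conn_matrix (\<phi> x) h (\<sigma> (\<phi> x)))"
proof -
  let ?v = "dir_deriv M (U, \<phi>) x h" and ?f = "\<lambda>b q. \<sigma> (\<phi> q) \<bullet> b"
  have \<sigma>: "smooth_at (\<phi> x) \<sigma>" using rep_smooth[OF s] .
  have ev: "\<forall>\<^sub>F y in nhds (\<phi> x). ?f b (inv_into U \<phi> y) = \<sigma> y \<bullet> b" for b
    using eventually_chart[OF c x(1)] by eventually_elim simp
  have fs: "smooth_near M x (?f b)" for b
    unfolding smooth_near_iff[OF c x(1)] comp_def smooth_at_cong[OF ev] by (intro smooth_at_intros \<sigma>)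
  have vf: "?v (?f b) = fd \<sigma> (\<phi> x) h \<bullet> b" for b
    using fd_cong[OF ev] \<sigma> by (simp add: dir_deriv_apply[OF fs] comp_def fd_inner)
  have fe: "smooth_section_near M V x (\<lambda>q. ?f b q *\<^sub>R e q b)" for b
    unfolding section_near_iff[OF c t x]
  proof
    show "rep (inv_into U \<phi>) e (\<phi> x) (\<lambda>q. ?f b q *\<^sub>R e q b) (\<lambda>y. (\<sigma> y \<bullet> b) *\<^sub>R b)"
      unfolding rep_def
    proof
      show "smooth_at (\<phi> x) (\<lambda>y. (\<sigma> y \<bullet> b) *\<^sub>R b)" by (intro smooth_at_intros \<sigma>)
      show "\<forall>\<^sub>F y in nhds (\<phi> x). ?f b (inv_into U \<phi> y) *\<^sub>R e (inv_into U \<phi> y) b =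
        e (inv_into U \<phi> y) ((\<sigma> y \<bullet> b) *\<^sub>R b)"
        using eventually_coordinate[OF c x(1) triv_openin[OF t] x(2)]
        by eventually_elim (simp add: linear_scale[OF triv_linear[OF t]])
    qed
  qed
  note D = connection_props[OF xc[OF x]]
  note tan = dir_deriv_tangent[OF x]
  \<comment> \<open>The empty sum, for the induction over the basis. Additivity gives
    \<open>D 0 = D 0 + D 0\<close>.\<close>
  have zero: "smooth_section_near M V x (\<lambda>q. 0)" "D x ?v (\<lambda>q. 0) = 0"
  proof -
    show z: "smooth_section_near M V x (\<lambda>q. 0)"
      using section_near_combine(2)[OF fe[of 0] fe[of 0]] by simp
    show "D x ?v (\<lambda>q. 0) = 0"
      using D(4)[OF z tan z] by simp
  qed
  have sum: "smooth_section_near M V x (\<lambda>q. \<Sum>b\<in>B. ?f b q *\<^sub>R e q b) \<and>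
      D x ?v (\<lambda>q. \<Sum>b\<in>B. ?f b q *\<^sub>R e q b) = (\<Sum>b\<in>B. D x ?v (\<lambda>q. ?f b q *\<^sub>R e q b))" if "finite B" for B
    using that
  proof induction
    case empty
    then show ?case using zero by simp
  next
    case (insert b B)
    then show ?case
      using section_near_combine(1)[OF fe[of b]] D(4)[OF fe[of b] tan] by simp
  qed
  have "\<forall>\<^sub>F y in nhds (\<phi> x). s (inv_into U \<phi> y) = (\<Sum>b\<in>Basis. ?f b (inv_into U \<phi> y) *\<^sub>R e (inv_into U \<phi> y) b)"
    using conjunct2[OF s[unfolded rep_def]] eventually_coordinate[OF c x(1) triv_openin[OF t] x(2)]
  proof eventually_elim
    case (elim y)
    then show ?case
      using linear_expand[OF triv_linear[OF t], of "inv_into U \<phi> y" "\<sigma> y"] by simp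
  qed
  from neighbourhood_coordinate[OF c x(1), where P = "\<lambda>q. s q = (\<Sum>b\<in>Basis. ?f b q *\<^sub>R e q b)", OF this]
  obtain O' where O': "openin (atlas_topology M) O'" "x \<in> O'" "O' \<subseteq> U"
    "\<And>q. q \<in> O' \<Longrightarrow> s q = (\<Sum>b\<in>Basis. ?f b q *\<^sub>R e q b)" by blast
  have "D x ?v s = D x ?v (\<lambda>q. \<Sum>b\<in>Basis. ?f b q *\<^sub>R e q b)"
    using D(6)[OF conjunct1[OF sum] tan O'(1,2,4)] by simp
  also have "\<dots> = (\<Sum>b\<in>Basis. (fd \<sigma> (\<phi> x) h \<bullet> b) *\<^sub>R e x b + (\<sigma> (\<phi> x) \<bullet> b) *\<^sub>R e x (conn_matrix (\<phi> x) h b))"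
    using sum[OF finite_Basis] D(5)[OF constant_section_near[OF t x(2)] tan fs]
      by (simp add: vf conn_matrix_frame[OF x])
  also have "\<dots> = e x (fd \<sigma> (\<phi> x) h) + e x (conn_matrix (\<phi> x) h (\<sigma> (\<phi> x)))"
  proof -
    have "linear (conn_matrix (\<phi> x) h)"
      using bilinear_conn_matrix[OF x] by (simp add: bilinear_def)
    from linear_expand[OF linear_compose[OF this triv_linear[OF t x(2)]], of "\<sigma> (\<phi> x)"]
    show ?thesis
      using linear_expand[OF triv_linear[OF t x(2)], of "fd \<sigma> (\<phi> x) h"] by (simp add: sum.distrib comp_def)
  qed
  finally show ?thesis
    by (simp add: linear_add[OF triv_linear[OF t x(2)]])
qed

text \<open>Flatness is applied to coordinate fields and a section with constant components.
  Coordinate fields commute, so the bracket term is a derivative along the zero vector and the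
  curvature of the matrix remains.\<close>

lemma conn_form_matrix:
  assumes x: "x \<in> U" "x \<in> W" and flat: "flat M V D"
  shows "conn_form M D U \<phi> e conn_matrix x"
proof -
  have "flat_coords conn_matrix (\<phi> x)"
    unfolding flat_coords_def
  proof (intro allI)
    fix h k v
    let ?X = "\<lambda>h x. dir_deriv M (U, \<phi>) x h" and ?s = "\<lambda>x. e x v"
    have o: "openin (atlas_topology M) (U \<inter> W)"
      using chart_openin[OF c] triv_openin[OF t] by blast
    have X: "smooth_section M (tangent_bundle M) (U \<inter> W) (?X h)" for h
      unfolding TM.smooth_section_iff using o TM.constant_section_near[OF triv_tangent[OF c]] by simp
    have s: "smooth_section M V (U \<inter> W) ?s"
      unfolding smooth_section_iff using o constant_section_near[OF t] by simp
    have "\<forall>\<^sub>F y in nhds (\<phi> x). D (inv_into U \<phi> y) (?X h (inv_into U \<phi> y)) ?s =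
      e (inv_into U \<phi> y) (conn_matrix y h v)" for h
      using eventually_coordinate[OF c x(1) triv_openin[OF t] x(2)]
    proof eventually_elim
      case (elim y)
      then show ?case
        using conn_matrix_frame[of "inv_into U \<phi> y"] by simp
    qed
    then have r: "rep (inv_into U \<phi>) e (\<phi> x) (\<lambda>q. D q (?X h q) ?s) (\<lambda>y. conn_matrix y h v)" for h
      unfolding rep_def using conn_matrix_smooth[OF x] by blast
    have "lie_bracket M (?X h) (?X k) x = ?X 0 x"
      using lie_bracket_rep[OF c x(1) rep_const rep_const] by simp
    then have "D x (lie_bracket M (?X h) (?X k) x) ?s = e x (conn_matrix (\<phi> x) 0 v)"
      by (simp add: conn_matrix_frame[OF x])
    also have "\<dots> = 0"
      using bilinear_lzero[OF bilinear_conn_matrix[OF x]] linear_0[OF triv_linear[OF t x(2)]] by simp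
    finally have "D x (?X h x) (\<lambda>q. D q (?X k q) ?s) - D x (?X k x) (\<lambda>q. D q (?X h q) ?s) = 0"
      using flat[unfolded flat_def, rule_format, of "U \<inter> W" "?X h" "?X k" ?s x] X s x by simp
    then have "e x (fd (\<lambda>y. conn_matrix y k v) (\<phi> x) h + conn_matrix (\<phi> x) h (conn_matrix (\<phi> x) k v) -
        (fd (\<lambda>y. conn_matrix y h v) (\<phi> x) k + conn_matrix (\<phi> x) k (conn_matrix (\<phi> x) h v))) = e x 0"
      unfolding conn_matrix_rep[OF x r] linear_diff[OF triv_linear[OF t x(2)], symmetric]
      by (simp add: linear_0[OF triv_linear[OF t x(2)]])
    then have "fd (\<lambda>y. conn_matrix y k v) (\<phi> x) h + conn_matrix (\<phi> x) h (conn_matrix (\<phi> x) k v) -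
        (fd (\<lambda>y. conn_matrix y h v) (\<phi> x) k + conn_matrix (\<phi> x) k (conn_matrix (\<phi> x) h v)) = 0"
      using triv_inj[OF t x(2)] by (simp only: inj_eq)
    then show "fd (\<lambda>y. conn_matrix y k v) (\<phi> x) h - fd (\<lambda>y. conn_matrix y h v) (\<phi> x) k
      + conn_matrix (\<phi> x) h (conn_matrix (\<phi> x) k v) - conn_matrix (\<phi> x) k (conn_matrix (\<phi> x) h v) = 0"
      by (simp add: algebra_simps)
  qed
  then show ?thesis
    unfolding conn_form_def using conn_coords_matrix[OF x] conn_matrix_rep[OF x] by blast
qed

end

text \<open>The dual connection is a description over all sections through \<open>u\<close>. The
  derivative of the test section cancels between its two terms, which leaves
  \<open>fd \<sigma>\<close> and the transpose of \<open>A\<close> with a minus sign. The frame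
  section with constant components shows that the description is not vacuous.\<close>

lemma conn_form_dual:
  assumes c: "(U, \<phi>) \<in> M" and t: "(W, e) \<in> triv V" and x: "x \<in> U" "x \<in> W"
    and A: "conn_form M D U \<phi> e A x"
  shows "conn_form M (dual_connection M V D) U \<phi> (dual_frame V e) (dual_form A) x"
proof -
  have conn: "conn_coords A (\<phi> x)" and flat: "flat_coords A (\<phi> x)"
    and D: "\<And>s \<sigma> h. rep (inv_into U \<phi>) e (\<phi> x) s \<sigma> \<Longrightarrow>
      D x (dir_deriv M (U, \<phi>) x h) s = e x (fd \<sigma> (\<phi> x) h + A (\<phi> x) h (\<sigma> (\<phi> x)))"
    using A unfolding conn_form_def by blast+
  have "dual_connection M V D x (dir_deriv M (U, \<phi>) x h) s =
      dual_frame V e x (fd \<sigma> (\<phi> x) h + dual_form A (\<phi> x) h (\<sigma> (\<phi> x)))"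
    if s: "rep (inv_into U \<phi>) (dual_frame V e) (\<phi> x) s \<sigma>" for s \<sigma> h
  proof
    fix u
    let ?v = "dir_deriv M (U, \<phi>) x h"
    show "dual_connection M V D x ?v s u = dual_frame V e x (fd \<sigma> (\<phi> x) h + dual_form A (\<phi> x) h (\<sigma> (\<phi> x))) u"
    proof (cases "u \<in> fib V x")
      case True
      then obtain w where u: "u = e x w"
        using triv_range[OF t x(2)] by blast
      let ?r = "fd \<sigma> (\<phi> x) h \<bullet> w - \<sigma> (\<phi> x) \<bullet> A (\<phi> x) h w"
      let ?P = "\<lambda>s'. smooth_section_near M V x s' \<and> s' x = u"
      have *: "?r = ?v (\<lambda>y. s y (s' y)) - s x (D x ?v s')" if P: "?P s'" for s'
      proof -
        obtain \<tau> where s': "rep (inv_into U \<phi>) e (\<phi> x) s' \<tau>"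
          using iffD1[OF section_near_iff[OF c t x] conjunct1[OF P]] by (rule exE)
        have \<tau>: "\<tau> (\<phi> x) = w"
          using P rep_at_chart[OF c x(1) s'] triv_inj[OF t x(2)] u by (simp add: inj_eq)
        have ev: "\<forall>\<^sub>F y in nhds (\<phi> x). s (inv_into U \<phi> y) (s' (inv_into U \<phi> y)) = \<sigma> y \<bullet> \<tau> y"
          using conjunct2[OF s[unfolded rep_def]] conjunct2[OF s'[unfolded rep_def]]
            eventually_coordinate[OF c x(1) triv_openin[OF t] x(2)]
          by eventually_elim (simp add: dual_frame_apply[OF t])
        have "smooth_near M x (\<lambda>y. s y (s' y))"
          unfolding smooth_near_iff[OF c x(1)] comp_def smooth_at_cong[OF ev]
          by (intro smooth_at_inner rep_smooth[OF s] rep_smooth[OF s'])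
        then have "?v (\<lambda>y. s y (s' y)) = \<sigma> (\<phi> x) \<bullet> fd \<tau> (\<phi> x) h + fd \<sigma> (\<phi> x) h \<bullet> w"
          using fd_cong[OF ev] fd_inner[OF rep_smooth[OF s] rep_smooth[OF s']] \<tau>
          by (simp add: dir_deriv_apply comp_def)
        moreover have "s x (D x ?v s') = \<sigma> (\<phi> x) \<bullet> (fd \<tau> (\<phi> x) h + A (\<phi> x) h w)"
          unfolding D[OF s'] rep_at_chart[OF c x(1) s] \<tau> using t x by simp
        ultimately show ?thesis
          by (simp add: inner_add_right)
      qed
      have ex: "?P (\<lambda>q. e q w)"
        using constant_section_near[OF t x(2)] u by simp
      have "dual_connection M V D x ?v s u = (THE r. \<forall>s'. ?P s' \<longrightarrow> r = ?v (\<lambda>y. s y (s' y)) - s x (D x ?v s'))"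
        using True by (simp add: dual_connection_def)
      also have "\<dots> = ?r"
      proof (rule the_equality)
        show "\<forall>s'. ?P s' \<longrightarrow> ?r = ?v (\<lambda>y. s y (s' y)) - s x (D x ?v s')"
          using * by (intro allI impI)
        fix r assume "\<forall>s'. ?P s' \<longrightarrow> r = ?v (\<lambda>y. s y (s' y)) - s x (D x ?v s')"
        from mp[OF spec[OF this] ex] show "r = ?r"
          unfolding *[OF ex] .
      qed
      finally show ?thesis
        using t x dual_form_inner[of A, OF bilinear_at[OF conn]] by (simp add: u inner_add_left)
    qed (simp add: dual_connection_def dual_frame_def)
  qed
  then show ?thesis
    unfolding conn_form_def using conn_coords_dual[OF conn] flat_coords_dual[OF conn flat] by blast
qed

end

section \<open>The splitting in coordinates\<close>

definition base_frame :: "('a, 'e::euclidean_space) atlas \<Rightarrow> 'a set \<Rightarrow> ('a \<Rightarrow> 'e) \<Rightarrow> ('a \<Rightarrow> 'f \<Rightarrow> 'v) \<Rightarrow>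
    'a \<Rightarrow> 'f \<times> 'e \<Rightarrow> 'v \<times> 'a tvec" where
  "base_frame M U \<phi> e = (\<lambda>x. map_prod (e x) (dir_deriv M (U, \<phi>) x))"

context smooth_bundle
begin

lemma sum_tangent: "smooth_bundle M (sum_bundle V (tangent_bundle M))"
  by (rule bundleI[OF vector_bundle_sum[OF smooth_bundle_axioms TM.smooth_bundle_axioms]])

abbreviation "mixed_frame U \<phi> e \<equiv> double_frame (sum_bundle V (tangent_bundle M)) (base_frame M U \<phi> e)"

lemma triv_base_frame:
  assumes "(U, \<phi>) \<in> M" "(W, e) \<in> triv V"
  shows "(W \<inter> U, base_frame M U \<phi> e) \<in> triv (sum_bundle V (tangent_bundle M))"
proof -
  have "((W, e), (U, dir_deriv M (U, \<phi>))) \<in> triv V \<times> triv (tangent_bundle M)"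
    using assms triv_tangent by blast
  from imageI[OF this, of "\<lambda>((U, e), (U', e')). (U \<inter> U', \<lambda>x. map_prod (e x) (e' x))"]
  show ?thesis
    by (simp add: triv_sum_bundle base_frame_def)
qed

context
  fixes D U \<phi> W e
  assumes c: "(U, \<phi>) \<in> M" and t: "(W, e) \<in> triv V"
    \<comment> \<open>Connection forms in every frame, as \<open>vertical_proj\<close> is described
      by all frames at once.\<close>
    and forms: "\<And>x W' d. (W', d) \<in> triv V \<Longrightarrow> x \<in> U \<Longrightarrow> x \<in> W' \<Longrightarrow> \<exists>B. conn_form M D U \<phi> d B x"
begin

interpretation N: smooth_atlas "total_space M V"
  by (rule total_atlas)

interpretation S: smooth_bundle M "sum_bundle V (tangent_bundle M)"
  by (rule sum_tangent)

interpretation SD: smooth_bundle M "double_bundle (sum_bundle V (tangent_bundle M))"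
  by (rule S.double_bundle)

lemmas sf = triv_base_frame[OF c t]
  and sdf = S.triv_double[OF triv_base_frame[OF c t]]
  and tot = total_spaceI[OF c t]

abbreviation (input) "iT \<equiv> inv_into (tdom U W) (tchart \<phi> e)"
abbreviation (input) "tv x z \<equiv> dir_deriv (total_space M V) (tdom U W, tchart \<phi> e) (x, e x z)"

context
  fixes x assumes x: "x \<in> U" "x \<in> W"
begin

lemma tot_mem: "(x, e x z) \<in> tdom U W"
  using x t by (simp add: tdom_def)

lemma tchart_at [simp]: "tchart \<phi> e (x, e x z) = (\<phi> x, z)"
  using x t by (simp add: tchart_def)

lemma tot_near: "smooth_near (total_space M V) (x, e x z) f \<longleftrightarrow> smooth_at (\<phi> x, z) (f \<circ> iT)"
  using N.smooth_near_iff[OF tot tot_mem] by simp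

lemma tv_apply:
  "smooth_near (total_space M V) (x, e x z) f \<Longrightarrow> tv x z w f = fd (f \<circ> iT) (\<phi> x, z) w"
  using N.dir_deriv_apply by simp

lemma differential_fst: "differential M fst (x, e x z) (tv x z w) = dir_deriv M (U, \<phi>) x (fst w)"
proof
  fix g :: "'a \<Rightarrow> real"
  show "differential M fst (x, e x z) (tv x z w) g = dir_deriv M (U, \<phi>) x (fst w) g"
  proof (cases "smooth_near M x g")
    case True
    have ev: "\<forall>\<^sub>F q in nhds (\<phi> x, z). ((g \<circ> fst) \<circ> iT) q = (g \<circ> inv_into U \<phi>) (fst q)"
      using eventually_tchart[OF c t x] by eventually_elim simp
    have g: "smooth_at (fst (\<phi> x, z)) (g \<circ> inv_into U \<phi>)"
      using True unfolding smooth_near_iff[OF c x(1)] by simp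
    have "smooth_near (total_space M V) (x, e x z) (g \<circ> fst)"
      unfolding tot_near smooth_at_cong[OF ev] by (rule smooth_at_fst_compose(1)[OF g])
    then have "tv x z w (g \<circ> fst) = fd (\<lambda>q. (g \<circ> inv_into U \<phi>) (fst q)) (\<phi> x, z) w"
      by (simp only: tv_apply fd_cong[OF ev])
    also have "\<dots> = fd (g \<circ> inv_into U \<phi>) (\<phi> x) (fst w)"
      using smooth_at_fst_compose(2)[OF g] by simp
    finally show ?thesis
      using True by (simp add: differential_def dir_deriv_apply)
  qed (simp add: differential_def dir_deriv_def)
qed

text \<open>Since \<open>e x\<close> is linear, the curve in the fibre is a straight line in the
  fibre coordinate, and the chain rule applies.\<close>

lemma vertical_lift_frame: "vertical_lift M V (x, e x z) (e x u) = tv x z (0, u)"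
proof
  fix f :: "'a \<times> 'v \<Rightarrow> real"
  show "vertical_lift M V (x, e x z) (e x u) f = tv x z (0, u) f"
  proof (cases "smooth_near (total_space M V) (x, e x z) f")
    case True
    let ?F = "f \<circ> iT"
    have F: "smooth_at (\<phi> x, z) ?F"
      using True unfolding tot_near .
    have eq: "f (x, e x z + s *\<^sub>R e x u) = ?F (\<phi> x, z + s *\<^sub>R u)" for s
      using tchart_inv[OF c t x, of "z + s *\<^sub>R u"]
      by (simp add: linear_add[OF triv_linear[OF t x(2)]] linear_scale[OF triv_linear[OF t x(2)]])
    have "((\<lambda>s. (\<phi> x, z + s *\<^sub>R u)) has_derivative (\<lambda>s. (0, s *\<^sub>R u))) (at 0)"
      by (auto intro!: derivative_eq_intros)
    moreover have "(?F has_derivative fd ?F (\<phi> x, z)) (at (\<phi> x, z + 0 *\<^sub>R u))"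
      using smooth_at_has_derivative[OF F] by simp
    ultimately have "((\<lambda>s. ?F (\<phi> x, z + s *\<^sub>R u)) has_derivative (\<lambda>s. fd ?F (\<phi> x, z) (0, s *\<^sub>R u))) (at 0)"
      by (rule has_derivative_compose)
    moreover have "fd ?F (\<phi> x, z) (0, s *\<^sub>R u) = fd ?F (\<phi> x, z) (0, u) * s" for s
      using linear_scale[OF linear_fd[OF F], of s "(0, u)"] by simp
    ultimately have "((\<lambda>s. ?F (\<phi> x, z + s *\<^sub>R u)) has_real_derivative fd ?F (\<phi> x, z) (0, u)) (at 0)"
      unfolding has_field_derivative_def by simp
    then have "deriv (\<lambda>s. f (x, e x z + s *\<^sub>R e x u)) 0 = fd ?F (\<phi> x, z) (0, u)"
      unfolding eq by (rule DERIV_imp_deriv)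
    then show ?thesis
      using True by (simp add: vertical_lift_def tv_apply)
  qed (simp add: vertical_lift_def dir_deriv_def)
qed

text \<open>\<open>pullback_connection\<close> is a description over all frames, so the derivative of the
  tautological section has to be computed in an arbitrary frame \<open>d\<close>.\<close>

lemma tautological_derivative:
  assumes A: "conn_form M D U \<phi> e A x" and t': "(W', d) \<in> triv V" "x \<in> W'"
  defines "f \<equiv> \<lambda>b q. inv (d (fst q)) (snd q) \<bullet> b"
  shows "(\<Sum>b\<in>Basis. tv x z w (f b) *\<^sub>R d x b +
      f b (x, e x z) *\<^sub>R D x (differential M fst (x, e x z) (tv x z w)) (\<lambda>y. d y b)) =
    e x (snd w + A (\<phi> x) (fst w) z)"
proof -
  \<comment> \<open>\<open>g\<close> is the change of frame from \<open>e\<close> to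
    \<open>d\<close>, and \<open>G\<close> gives the components of the tautological section in the
    frame \<open>d\<close>.\<close>
  define g where "g = (\<lambda>y u. inv (d (inv_into U \<phi> y)) (e (inv_into U \<phi> y) u))"
  define G where "G = (\<lambda>q. g (fst q) (snd q))"
  have G: "smooth_at (\<phi> x, z) G" "fd G (\<phi> x, z) w = fd (\<lambda>y. g y z) (\<phi> x) (fst w) + inv (d x) (e x (snd w))"
    using frame_change_total[OF c x(1) t x(2) t', of z] unfolding G_def g_def by simp_all
  have ev: "\<forall>\<^sub>F q in nhds (\<phi> x, z). (f b \<circ> iT) q = G q \<bullet> b" for b
    using eventually_tchart[OF c t x] by eventually_elim (simp add: f_def G_def g_def)
  have fb: "smooth_near (total_space M V) (x, e x z) (f b)" for b
    unfolding tot_near smooth_at_cong[OF ev] by (intro smooth_at_inner G smooth_at_const)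
  have tvf: "tv x z w (f b) = fd G (\<phi> x, z) w \<bullet> b" for b
    unfolding tv_apply[OF fb] fd_cong[OF ev] using G(1) by (simp add: fd_inner)
  obtain B where B: "conn_form M D U \<phi> d B x"
    using forms[OF t'(1) x(1) t'(2)] by blast
  have DB: "D x (dir_deriv M (U, \<phi>) x h) s = d x (fd \<sigma> (\<phi> x) h + B (\<phi> x) h (\<sigma> (\<phi> x)))"
    if "rep (inv_into U \<phi>) d (\<phi> x) s \<sigma>" for s \<sigma> h
    using B that unfolding conn_form_def by blast
  have DA: "D x (dir_deriv M (U, \<phi>) x h) s = e x (fd \<sigma> (\<phi> x) h + A (\<phi> x) h (\<sigma> (\<phi> x)))"
    if "rep (inv_into U \<phi>) e (\<phi> x) s \<sigma>" for s \<sigma> h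
    using A that unfolding conn_form_def by blast
  note ld = triv_linear[OF t'] and le = triv_linear[OF t x(2)]
  have lB: "linear (B (\<phi> x) h)" for h
    using bilinear_at[of B "\<phi> x"] B unfolding conn_form_def bilinear_def by blast
  have gx: "g (\<phi> x) u = inv (d x) (e x u)" "d x (g (\<phi> x) u) = e x u" for u
    using c x t t' by (simp_all add: g_def inv_triv[OF t'(1)] triv_fib[OF t])
  \<comment> \<open>The section with constant components \<open>z\<close> in \<open>e\<close> has
    the components \<open>g y z\<close> in \<open>d\<close>. Its covariant derivative, computed in
    both frames, replaces the transformation law of connection forms.\<close>
  have ge: "rep (inv_into U \<phi>) d (\<phi> x) (\<lambda>q. e q z) (\<lambda>y. g y z)"
    unfolding rep_def
  proof
    show "smooth_at (\<phi> x) (\<lambda>y. g y z)"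
      using frame_change(2)[OF c x(1) t x(2) t'] unfolding g_def .
    show "\<forall>\<^sub>F y in nhds (\<phi> x). e (inv_into U \<phi> y) z = d (inv_into U \<phi> y) (g y z)"
      using eventually_coordinate[OF c x(1) triv_openin[OF t] x(2)]
        eventually_coordinate[OF c x(1) triv_openin[OF t'(1)] t'(2)]
      by eventually_elim (simp add: g_def inv_triv[OF t'(1)] triv_fib[OF t])
  qed
  have "(\<Sum>b\<in>Basis. tv x z w (f b) *\<^sub>R d x b +
      f b (x, e x z) *\<^sub>R D x (differential M fst (x, e x z) (tv x z w)) (\<lambda>y. d y b)) =
    (\<Sum>b\<in>Basis. (fd G (\<phi> x, z) w \<bullet> b) *\<^sub>R d x b + (g (\<phi> x) z \<bullet> b) *\<^sub>R d x (B (\<phi> x) (fst w) b))"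
    unfolding differential_fst DB[OF rep_const] tvf by (simp add: f_def gx)
  also have "\<dots> = d x (fd G (\<phi> x, z) w) + d x (B (\<phi> x) (fst w) (g (\<phi> x) z))"
    using linear_expand[OF ld, of "fd G (\<phi> x, z) w"]
      linear_expand[OF linear_compose[OF lB[of "fst w"] ld], of "g (\<phi> x) z"] by (simp add: sum.distrib comp_def)
  also have "\<dots> = d x (g (\<phi> x) (snd w)) + d x (fd (\<lambda>y. g y z) (\<phi> x) (fst w) + B (\<phi> x) (fst w) (g (\<phi> x) z))"
    unfolding G(2) gx(1)[symmetric] by (simp add: linear_add[OF ld])
  also have "\<dots> = e x (snd w) + D x (dir_deriv M (U, \<phi>) x (fst w)) (\<lambda>q. e q z)"
    unfolding DB[OF ge] gx(2) ..
  also have "\<dots> = e x (snd w + A (\<phi> x) (fst w) z)"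
    unfolding DA[OF rep_const] by (simp add: linear_add[OF le])
  finally show ?thesis .
qed

context
  fixes A assumes A: "conn_form M D U \<phi> e A x"
begin

lemma vertical_proj_frame: "vertical_proj M V D (x, e x z) (tv x z w) = e x (snd w + A (\<phi> x) (fst w) z)"
proof -
  let ?P = "\<lambda>d. \<forall>(W', e')\<in>triv V. x \<in> W' \<longrightarrow>
      d = (\<Sum>b\<in>Basis. tv x z w (\<lambda>q. inv (e' (fst q)) (snd q) \<bullet> b) *\<^sub>R e' x b +
      (inv (e' x) (e x z) \<bullet> b) *\<^sub>R D x (differential M fst (x, e x z) (tv x z w)) (\<lambda>y. e' y b))"
  have "vertical_proj M V D (x, e x z) (tv x z w) = (THE d. ?P d)"
    by (simp add: vertical_proj_def pullback_connection_def Let_def)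
  also have "\<dots> = e x (snd w + A (\<phi> x) (fst w) z)"
  proof (rule the_equality)
    show "?P (e x (snd w + A (\<phi> x) (fst w) z))"
      using tautological_derivative[OF A, of _ _ z w] by auto
    fix d assume "?P d"
    then show "d = e x (snd w + A (\<phi> x) (fst w) z)"
      using tautological_derivative[OF A t x(2), of z w] t x by auto
  qed
  finally show ?thesis .
qed

lemma tangent_total: "tangent_space (total_space M V) (x, e x z) = range (tv x z)"
  by (rule N.tangent_space_range[OF tot tot_mem])

text \<open>For a tangent vector with components \<open>w\<close> the two conditions read
  \<open>fst w = h\<close> and \<open>snd w + A (\<phi> x) (fst w) z = 0\<close>, which have exactly
  one solution.\<close>

lemma horizontal_lift_frame:
  "horizontal_lift M V D (x, e x z) (dir_deriv M (U, \<phi>) x h) = tv x z (h, - A (\<phi> x) h z)"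
  unfolding horizontal_lift_def
proof (rule the_equality)
  have "e x 0 = 0"
    by (rule linear_0[OF triv_linear[OF t x(2)]])
  then show "tv x z (h, - A (\<phi> x) h z) \<in> tangent_space (total_space M V) (x, e x z) \<and>
    differential M fst (x, e x z) (tv x z (h, - A (\<phi> x) h z)) = dir_deriv M (U, \<phi>) x h \<and>
    vertical_proj M V D (x, e x z) (tv x z (h, - A (\<phi> x) h z)) = 0"
    unfolding tangent_total differential_fst vertical_proj_frame by simp
  fix u assume u: "u \<in> tangent_space (total_space M V) (x, e x z) \<and>
    differential M fst (x, e x z) u = dir_deriv M (U, \<phi>) x h \<and> vertical_proj M V D (x, e x z) u = 0"
  then obtain w where w: "u = tv x z w"
    unfolding tangent_total by blast
  have "fst w = h"
    using u dir_deriv_inj[OF c x(1)] unfolding w differential_fst by (simp add: inj_eq)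
  moreover have "e x (snd w + A (\<phi> x) (fst w) z) = e x 0"
    using u \<open>e x 0 = 0\<close> unfolding w vertical_proj_frame by simp
  then have "snd w + A (\<phi> x) (fst w) z = 0"
    using triv_inj[OF t x(2)] by (simp only: inj_eq)
  ultimately have "w = (h, - A (\<phi> x) h z)"
    by (simp add: prod_eq_iff eq_neg_iff_add_eq_0)
  then show "u = tv x z (h, - A (\<phi> x) h z)"
    unfolding w by simp
qed

abbreviation (input) "tframe \<equiv> double_frame (tangent_bundle (total_space M V))
  (dir_deriv (total_space M V) (tdom U W, tchart \<phi> e))"

text \<open>The components of a covector are its values on the vertical lifts \<open>(0, a)\<close>
  and the horizontal lifts \<open>(h, - A (\<phi> x) h z)\<close>; the latter produce the
  \<open>conn_adj\<close> term of \<open>mcoframe\<close>.\<close>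

lemma splitting_frame:
  "splitting M V D (x, e x z) (tframe (x, e x z) u) = mixed_frame U \<phi> e x (mcoframe A (\<phi> x, z) u)"
proof -
  let ?p = "(x, e x z)" and ?m = "mcoframe A (\<phi> x, z) u"
  let ?\<xi> = "dual_frame (tangent_bundle (total_space M V))
    (dir_deriv (total_space M V) (tdom U W, tchart \<phi> e)) ?p (snd u)"
  let ?\<eta> = "dual_frame (sum_bundle V (tangent_bundle M)) (base_frame M U \<phi> e) x (snd ?m)"
  let ?S = "fib V x" and ?T = "tangent_space M x"
  have x': "x \<in> W \<inter> U" using x by blast
  have bil: "bilinear (A (\<phi> x))"
    using A bilinear_at unfolding conn_form_def by blast
  have "functional_sum ?S ?T (transpose_map ?S (vertical_lift M V ?p) ?\<xi>)
      (transpose_map ?T (horizontal_lift M V D ?p) ?\<xi>) = ?\<eta>" (is "?l = _")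
  proof
    fix y :: "'v \<times> 'a tvec"
    show "?l y = ?\<eta> y"
    proof (cases "y \<in> ?S \<times> ?T")
      case True
      then obtain a h where y: "y = (e x a, dir_deriv M (U, \<phi>) x h)"
        using triv_range[OF t x(2)] tangent_space_range[OF c x(1)] by blast
      have \<xi>: "?\<xi> (tv x z w) = snd u \<bullet> w" for w
        by (rule N.coframe_apply[OF tot tot_mem])
      have "?l y = snd u \<bullet> (0, a) + snd u \<bullet> (h, - A (\<phi> x) h z)"
        using True unfolding y
        by (simp add: functional_sum_def transpose_map_def vertical_lift_frame horizontal_lift_frame \<xi>)
      also have "\<dots> = snd ?m \<bullet> (a, h)"
        by (simp add: mcoframe_def inner_prod_def inner_diff_left conn_adj_inner[OF bil])
      also have "\<dots> = ?\<eta> y"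
        using S.dual_frame_apply[OF sf x', of "snd ?m" "(a, h)"] by (simp add: y base_frame_def)
      finally show ?thesis .
    next
      case False
      then show ?thesis
        by (cases y) (auto simp: functional_sum_def dual_frame_def fib_sum_bundle)
    qed
  qed
  moreover have "(vertical_proj M V D ?p (tv x z (fst u)), differential M fst ?p (tv x z (fst u))) =
    base_frame M U \<phi> e x (fst ?m)"
    unfolding vertical_proj_frame differential_fst by (simp add: base_frame_def mcoframe_def)
  ultimately show ?thesis
    by (simp add: splitting_def double_frame_apply)
qed

text \<open>In frames \<open>splitting\<close> is \<open>mcoframe\<close>, hence injective on the
  fibre, and \<open>inv_into\<close> acts as \<open>mframe\<close>.\<close>

lemma semi_flat_frame:
  assumes J: "\<And>v. J x (mixed_frame U \<phi> e x v) = mixed_frame U \<phi> e x (k v)"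
  shows "semi_flat M V D J (x, e x z) (tframe (x, e x z) u) =
    tframe (x, e x z) (mframe A (\<phi> x, z) (k (mcoframe A (\<phi> x, z) u)))"
proof -
  let ?p = "(x, e x z)"
  let ?E = "fib (double_bundle (tangent_bundle (total_space M V))) ?p"
  have E: "?E = range (tframe ?p)"
    using N.TTM.triv_range[OF N.triv_gframe[OF tot] tot_mem] by simp
  have inj: "inj (mixed_frame U \<phi> e x)"
    using SD.triv_inj[OF sdf] x by blast
  have "inj_on (splitting M V D ?p) ?E"
    unfolding E
  proof (rule inj_onI)
    fix a b assume "a \<in> range (tframe ?p)" "b \<in> range (tframe ?p)"
      and eq: "splitting M V D ?p a = splitting M V D ?p b"
    then obtain u v where uv: "a = tframe ?p u" "b = tframe ?p v"
      by blast
    from eq have "mcoframe A (\<phi> x, z) u = mcoframe A (\<phi> x, z) v"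
      unfolding uv splitting_frame using inj by (simp add: inj_eq)
    then have "u = v"
      by (metis mframe_mcoframe)
    then show "a = b" unfolding uv by simp
  qed
  moreover have "J x (splitting M V D ?p (tframe ?p u)) =
      splitting M V D ?p (tframe ?p (mframe A (\<phi> x, z) (k (mcoframe A (\<phi> x, z) u))))"
    unfolding splitting_frame J by simp
  ultimately show ?thesis
    unfolding semi_flat_def using E by (simp add: inv_into_f_f)
qed

end

end

lemma integrable_at_semi_flat:
  assumes A: "\<And>x. x \<in> U \<Longrightarrow> x \<in> W \<Longrightarrow> conn_form M D U \<phi> e A x"
    and K: "\<And>x. x \<in> U \<Longrightarrow> x \<in> W \<Longrightarrow> acs_coords K (\<phi> x)"
    and J: "\<And>x v. x \<in> U \<Longrightarrow> x \<in> W \<Longrightarrow> J x (mixed_frame U \<phi> e x v) = mixed_frame U \<phi> e x (K (\<phi> x) v)"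
    and x: "x \<in> U" "x \<in> W"
  shows "gacs_form (total_space M V) (tdom U W) (tchart \<phi> e) (semi_flat M V D J)
      (\<lambda>q u. mframe A q (K (fst q) (mcoframe A q u))) (x, e x z)"
    and "integrable_at (total_space M V) (semi_flat M V D J) (x, e x z) \<longleftrightarrow>
      (\<forall>a b c. nijenhuis_form A K (\<phi> x) a b c = 0)"
proof -
  let ?K = "\<lambda>q u. mframe A q (K (fst q) (mcoframe A q u))" and ?p = "(\<phi> x, z)"
  have conn: "conn_coords A (\<phi> x)" "flat_coords A (\<phi> x)"
    using A[OF x] unfolding conn_form_def by blast+
  have Kev: "\<forall>\<^sub>F q in nhds ?p. linear (K (fst q)) \<and> (\<forall>u. K (fst q) (K (fst q) u) = - u)"
    using conjunct1[OF K[OF x, unfolded acs_coords_def]]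
      by (intro eventually_nhds_fst) (auto elim: eventually_mono)
  have near: "\<forall>\<^sub>F q in nhds ?p. linear (K (fst q)) \<and> linear (mframe A q) \<and> linear (mcoframe A q)"
    using Kev bilinear_near[OF conn(1), of z] by eventually_elim (simp add: linear_mframe)
  have sm: "smooth_at ?p (\<lambda>q. ?K q u)" for u
  proof -
    have K1: "smooth_at ?p (\<lambda>q. K (fst q) v)" for v
      using smooth_at_fst_compose(1)[of ?p "\<lambda>y. K y v"] K[OF x] unfolding acs_coords_def by simp
    have lin: "\<forall>\<^sub>F q in nhds ?p. linear (K (fst q))" "\<forall>\<^sub>F q in nhds ?p. linear (mframe A q)"
      using near by (auto elim: eventually_mono)
    show ?thesis
      by (rule smooth_at_family(1)[OF lin(2) mframe_smooth(1)[OF conn(1)]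
          smooth_at_family(1)[OF lin(1) K1 mframe_smooth(2)[OF conn(1)]]])
  qed
  have "\<forall>\<^sub>F q in nhds ?p. linear (?K q) \<and> (\<forall>u. ?K q (?K q u) = - u) \<and>
      (\<forall>u. semi_flat M V D J (inv_into (tdom U W) (tchart \<phi> e) q) (tframe (inv_into (tdom U W) (tchart \<phi> e) q) u) =
        tframe (inv_into (tdom U W) (tchart \<phi> e) q) (?K q u))"
    using near Kev eventually_tchart[OF c t x]
  proof eventually_elim
    case (elim q)
    let ?y = "inv_into U \<phi> (fst q)"
    have y: "?y \<in> U" "?y \<in> W" "\<phi> ?y = fst q" using elim by blast+
    have "linear (?K q)"
      using linear_compose[OF linear_compose[of "mcoframe A q" "K (fst q)"], of "mframe A q"] elim
        by (simp add: comp_def)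
    moreover have "?K q (?K q u) = - u" for u
      using elim linear_neg[of "mframe A q"] by simp
    moreover have "semi_flat M V D J (?y, e ?y (snd q)) (tframe (?y, e ?y (snd q)) u) =
      tframe (?y, e ?y (snd q)) (?K q u)" for u
      using semi_flat_frame[OF y(1,2) A[OF y(1,2)], of J "K (fst q)" "snd q" u] J[OF y(1,2)] y(3) by simp
    ultimately show ?case
      using elim by simp
  qed
  then show form: "gacs_form (total_space M V) (tdom U W) (tchart \<phi> e) (semi_flat M V D J) ?K (x, e x z)"
    unfolding gacs_form_def using sm x by simp
  show "integrable_at (total_space M V) (semi_flat M V D J) (x, e x z) \<longleftrightarrow>
      (\<forall>a b c. nijenhuis_form A K (\<phi> x) a b c = 0)"
    unfolding N.integrable_at_iff[OF tot tot_mem[OF x] form] 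
    using nijenhuis_total[OF conn K[OF x], of z] x by simp
qed

end

end

section \<open>Semi-flat structures and their mirrors\<close>

context smooth_bundle
begin

lemma pairing_double_frame:
  assumes "(W, e) \<in> triv V" "x \<in> W"
  shows "pairing (double_frame V e x a) (double_frame V e x b) = - (1/2) * cpair a b"
  using assms by (simp add: pairing_def double_frame_apply cpair_def)

text \<open>The algebraic properties transfer pointwise through the frame. Smoothness of the matrix
  is obtained by letting \<open>J\<close> act on sections with constant components.\<close>

lemma acs_matrix:
  assumes J: "generalized_acs M V J" and c: "(U, \<phi>) \<in> M" and t: "(W, e) \<in> triv V"
  obtains K where
    "\<And>x v. x \<in> U \<Longrightarrow> x \<in> W \<Longrightarrow> J x (double_frame V e x v) = double_frame V e x (K (\<phi> x) v)"
    "\<And>x. x \<in> U \<Longrightarrow> x \<in> W \<Longrightarrow> \<forall>\<^sub>F y in nhds (\<phi> x). linear (K y) \<and> (\<forall>z. K y (K y z) = - z) \<and>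
       (\<forall>z w. cpair (K y z) (K y w) = cpair z w)"
    "\<And>x z. x \<in> U \<Longrightarrow> x \<in> W \<Longrightarrow> smooth_at (\<phi> x) (\<lambda>y. K y z)"
proof -
  interpret E: smooth_bundle M "double_bundle V"
    by (rule double_bundle)
  note tE = triv_double[OF t]
  define F where "F = double_frame V e"
  define K where "K y z = inv (F (inv_into U \<phi> y)) (J (inv_into U \<phi> y) (F (inv_into U \<phi> y) z))" for y z
  have fib: "fib (double_bundle V) x = range (F x)" if "x \<in> W" for x
    using E.triv_range[OF tE that] by (simp add: F_def)
  have Jx: "bij_betw (J x) (range (F x)) (range (F x)) \<and>
        (\<forall>a\<in>range (F x). \<forall>b\<in>range (F x). J x (a + b) = J x a + J x b) \<and>
        (\<forall>r. \<forall>a\<in>range (F x). J x (r *\<^sub>R a) = r *\<^sub>R J x a) \<and>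
        (\<forall>a\<in>range (F x). \<forall>b\<in>range (F x). pairing (J x a) (J x b) = pairing a b) \<and>
        (\<forall>a\<in>range (F x). J x (J x a) = - a)" if "x \<in> U" "x \<in> W" for x
    using J that chart_carrier[OF c that(1)]
      unfolding generalized_acs_def Let_def fib[OF that(2), symmetric] by blast
  have JF: "J x (F x v) = F x (K (\<phi> x) v)" if x: "x \<in> U" "x \<in> W" for x v
  proof -
    have "J x (F x v) \<in> range (F x)"
      using Jx[OF x] bij_betwE by blast
    then show ?thesis
      using c x by (simp add: K_def f_inv_into_f)
  qed
  have alg: "linear (K (\<phi> x)) \<and> (\<forall>z. K (\<phi> x) (K (\<phi> x) z) = - z) \<and>
    (\<forall>z w. cpair (K (\<phi> x) z) (K (\<phi> x) w) = cpair z w)"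
    if x: "x \<in> U" "x \<in> W" for x
  proof -
    have lin: "linear (F x)"
      using E.triv_linear[OF tE x(2)] by (simp add: F_def)
    have inj: "a = b" if "F x a = F x b" for a b
      using that E.triv_inj[OF tE x(2)] by (simp add: F_def inj_eq)
    have "K (\<phi> x) (a + b) = K (\<phi> x) a + K (\<phi> x) b" for a b
      by (rule inj) (simp add: linear_add[OF lin] JF[OF x, symmetric] Jx[OF x])
    moreover have "K (\<phi> x) (r *\<^sub>R a) = r *\<^sub>R K (\<phi> x) a" for r a
      by (rule inj) (simp add: linear_scale[OF lin] JF[OF x, symmetric] Jx[OF x])
    moreover have "K (\<phi> x) (K (\<phi> x) z) = - z" for z
      by (rule inj) (simp add: linear_neg[OF lin] JF[OF x, symmetric] Jx[OF x])
    moreover have "cpair (K (\<phi> x) z) (K (\<phi> x) w) = cpair z w" for z w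
    proof -
      have "pairing (F x (K (\<phi> x) z)) (F x (K (\<phi> x) w)) = pairing (F x z) (F x w)"
        by (simp add: JF[OF x, symmetric] Jx[OF x])
      then show ?thesis
        using pairing_double_frame[OF t x(2)] by (simp add: F_def)
    qed
    ultimately show ?thesis
      by (auto intro: linearI)
  qed
  show ?thesis
  proof (rule that)
    fix x assume x: "x \<in> U" "x \<in> W"
    show "J x (double_frame V e x v) = double_frame V e x (K (\<phi> x) v)" for v
      using JF[OF x] by (simp add: F_def)
    show "\<forall>\<^sub>F y in nhds (\<phi> x). linear (K y) \<and> (\<forall>z. K y (K y z) = - z) \<and>
      (\<forall>z w. cpair (K y z) (K y w) = cpair z w)"
      using eventually_coordinate[OF c x(1) triv_openin[OF t] x(2)]
    proof eventually_elim
      case (elim y)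
      then show ?case using alg[of "inv_into U \<phi> y"] by simp
    qed
    fix z
    have "openin (atlas_topology M) (U \<inter> W)"
      using chart_openin[OF c] triv_openin[OF t] by blast
    then have "smooth_section M (double_bundle V) (U \<inter> W) (\<lambda>x. F x z)"
      unfolding E.smooth_section_iff F_def using E.constant_section_near[OF tE] by simp
    then have "smooth_section M (double_bundle V) (U \<inter> W) (\<lambda>x. J x (F x z))"
      using J unfolding generalized_acs_def by blast
    then have "smooth_section_near M (double_bundle V) x (\<lambda>x. J x (F x z))"
      unfolding E.smooth_section_iff using x by simp
    then obtain \<sigma> where \<sigma>: "rep (inv_into U \<phi>) F (\<phi> x) (\<lambda>x. J x (F x z)) \<sigma>"
      unfolding E.section_near_iff[OF c tE x] F_def by blast
    have "\<forall>\<^sub>F y in nhds (\<phi> x). \<sigma> y = K y z"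
      using conjunct2[OF \<sigma>[unfolded rep_def]] eventually_coordinate[OF c x(1) triv_openin[OF t] x(2)]
      by eventually_elim (simp add: K_def F_def E.triv_inv[OF tE])
    then show "smooth_at (\<phi> x) (\<lambda>y. K y z)"
      by (rule smooth_at_transfer[OF rep_smooth[OF \<sigma>]])
  qed
qed

text \<open>What the integrability criterion uses, in one chart and frame. Being stated through
  forms and matrices instead of \<open>connection\<close> and \<open>generalized_acs\<close>, it
  passes to the mirror by \<open>dual_form\<close> and \<open>dswap\<close> alone.\<close>

definition semi_flat_data where
  "semi_flat_data D J U \<phi> W e A K \<longleftrightarrow> (\<forall>x. x \<in> U \<longrightarrow> x \<in> W \<longrightarrow> conn_form M D U \<phi> e A x \<and> acs_coords K (\<phi> x) \<and>
     (\<forall>v. J x (mixed_frame U \<phi> e x v) = mixed_frame U \<phi> e x (K (\<phi> x) v)))"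

lemma semi_flat_dataI:
  assumes D: "connection M V D" "flat M V D" and J: "generalized_acs M (sum_bundle V (tangent_bundle M)) J"
    and c: "(U, \<phi>) \<in> M" and t: "(W, e) \<in> triv V"
  shows "\<exists>A K. semi_flat_data D J U \<phi> W e A K"
proof -
  interpret S: smooth_bundle M "sum_bundle V (tangent_bundle M)"
    by (rule sum_tangent)
  obtain K where K:
    "\<And>x v. x \<in> U \<Longrightarrow> x \<in> W \<inter> U \<Longrightarrow> J x (mixed_frame U \<phi> e x v) = mixed_frame U \<phi> e x (K (\<phi> x) v)"
    "\<And>x. x \<in> U \<Longrightarrow> x \<in> W \<inter> U \<Longrightarrow> \<forall>\<^sub>F y in nhds (\<phi> x). linear (K y) \<and> (\<forall>z. K y (K y z) = - z) \<and>
       (\<forall>z w. cpair (K y z) (K y w) = cpair z w)"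
    "\<And>x z. x \<in> U \<Longrightarrow> x \<in> W \<inter> U \<Longrightarrow> smooth_at (\<phi> x) (\<lambda>y. K y z)"
    by (rule S.acs_matrix[OF J c triv_base_frame[OF c t]]) blast
  have "semi_flat_data D J U \<phi> W e (conn_matrix D U \<phi> e) K"
    unfolding semi_flat_data_def acs_coords_def using conn_form_matrix[OF D(1) c t _ _ D(2)] K by simp
  then show ?thesis by blast
qed

context
  fixes D J
  assumes data: "\<forall>U \<phi> W e. (U, \<phi>) \<in> M \<longrightarrow> (W, e) \<in> triv V \<longrightarrow> (\<exists>A K. semi_flat_data D J U \<phi> W e A K)"
begin

lemma integrable_at_data:
  assumes c: "(U, \<phi>) \<in> M" "x \<in> U" and t: "(W, e) \<in> triv V" "x \<in> W" and AK: "semi_flat_data D J U \<phi> W e A K"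
  shows "\<exists>K. gacs_form (total_space M V) (tdom U W) (tchart \<phi> e) (semi_flat M V D J) K (x, e x z)"
    and "integrable_at (total_space M V) (semi_flat M V D J) (x, e x z) \<longleftrightarrow>
      (\<forall>a b c. nijenhuis_form A K (\<phi> x) a b c = 0)"
proof -
  have forms: "\<exists>B. conn_form M D U \<phi> d B x" if "(W', d) \<in> triv V" "x \<in> U" "x \<in> W'" for x W' d
    using data[rule_format, OF c(1) that(1)] that(2,3) unfolding semi_flat_data_def by blast
  have *: "conn_form M D U \<phi> e A x" "acs_coords K (\<phi> x)"
    "J x (mixed_frame U \<phi> e x v) = mixed_frame U \<phi> e x (K (\<phi> x) v)" if "x \<in> U" "x \<in> W" for x v
    using AK that unfolding semi_flat_data_def by blast+
  note th = integrable_at_semi_flat[OF c(1) t(1) forms * c(2) t(2)]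
  show "\<exists>K. gacs_form (total_space M V) (tdom U W) (tchart \<phi> e) (semi_flat M V D J) K (x, e x z)"
    by (rule exI, rule th(1))
  show "integrable_at (total_space M V) (semi_flat M V D J) (x, e x z) \<longleftrightarrow>
      (\<forall>a b c. nijenhuis_form A K (\<phi> x) a b c = 0)"
    by (rule th(2))
qed

lemma total_pointE:
  assumes "p \<in> carrier (total_space M V)"
  obtains U \<phi> W e A K x z where "(U, \<phi>) \<in> M" "(W, e) \<in> triv V" "semi_flat_data D J U \<phi> W e A K"
    "x \<in> U" "x \<in> W" "p = (x, e x z)" "(tdom U W, tchart \<phi> e) \<in> total_space M V" "p \<in> tdom U W"
proof -
  obtain X \<theta> where X: "(X, \<theta>) \<in> total_space M V" "p \<in> X"
    using assms unfolding carrier_def by blast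
  obtain U \<phi> W e where *: "(U, \<phi>) \<in> M" "(W, e) \<in> triv V" "X = tdom U W" "\<theta> = tchart \<phi> e"
    using X(1) by (rule total_spaceE)
  obtain x v where p: "p = (x, v)" "x \<in> U" "x \<in> W" "v \<in> fib V x"
    using X(2) *(3) by (auto simp: tdom_def)
  obtain z where "v = e x z"
    using p triv_range[OF *(2)] by blast
  moreover obtain A K where "semi_flat_data D J U \<phi> W e A K"
    using data[rule_format, OF *(1,2)] by blast
  ultimately show thesis
    using that * p X by blast
qed

text \<open>The criterion at a point of the total space involves only its projection, so the
  condition ranges over points of the base.\<close>

lemma integrable_semi_flat:
  "integrable_gacs (total_space M V) (semi_flat M V D J) \<longleftrightarrow>
   (\<forall>U \<phi> W e A K x. (U, \<phi>) \<in> M \<longrightarrow> (W, e) \<in> triv V \<longrightarrow> semi_flat_data D J U \<phi> W e A K \<longrightarrow> x \<in> U \<longrightarrow> x \<in> W \<longrightarrow>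
      (\<forall>a b c. nijenhuis_form A K (\<phi> x) a b c = 0))" (is "?l \<longleftrightarrow> ?r")
proof -
  interpret N: smooth_atlas "total_space M V"
    by (rule total_atlas)
  have "?l \<longleftrightarrow> (\<forall>p\<in>carrier (total_space M V). integrable_at (total_space M V) (semi_flat M V D J) p)"
  proof (rule N.integrable_gacs_iff)
    fix p assume "p \<in> carrier (total_space M V)"
    then obtain U \<phi> W e A K x z where *: "(U, \<phi>) \<in> M" "(W, e) \<in> triv V" "semi_flat_data D J U \<phi> W e A K"
      "x \<in> U" "x \<in> W" "p = (x, e x z)" "(tdom U W, tchart \<phi> e) \<in> total_space M V" "p \<in> tdom U W"
      by (rule total_pointE)
    obtain K' where "gacs_form (total_space M V) (tdom U W) (tchart \<phi> e) (semi_flat M V D J) K' p"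
      using integrable_at_data(1)[OF *(1,4,2,5,3), of z] unfolding *(6) by blast
    then show "\<exists>U \<phi> K. (U, \<phi>) \<in> total_space M V \<and> p \<in> U \<and>
        gacs_form (total_space M V) U \<phi> (semi_flat M V D J) K p"
      using *(7,8) by blast
  qed
  also have "\<dots> \<longleftrightarrow> ?r"
  proof
    assume l: "\<forall>p\<in>carrier (total_space M V). integrable_at (total_space M V) (semi_flat M V D J) p"
    show ?r
    proof (intro allI impI)
      fix U \<phi> W e A K x a b c
      assume *: "(U, \<phi>) \<in> M" "(W, e) \<in> triv V" "semi_flat_data D J U \<phi> W e A K" "x \<in> U" "x \<in> W"
      \<comment> \<open>Any point of the fibre over \<open>x\<close> would do; the zero vector is
        taken.\<close>
      have "(x, e x 0) \<in> carrier (total_space M V)"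
        using *(2,4,5) by (intro N.chart_carrier[OF total_spaceI[OF *(1,2)]]) (simp add: tdom_def)
      then show "nijenhuis_form A K (\<phi> x) a b c = 0"
        using l integrable_at_data(2)[OF *(1,4,2,5,3)] by blast
    qed
  next
    assume r: ?r
    show "\<forall>p\<in>carrier (total_space M V). integrable_at (total_space M V) (semi_flat M V D J) p"
    proof
      fix p assume "p \<in> carrier (total_space M V)"
      then obtain U \<phi> W e A K x z where *: "(U, \<phi>) \<in> M" "(W, e) \<in> triv V" "semi_flat_data D J U \<phi> W e A K"
        "x \<in> U" "x \<in> W" "p = (x, e x z)" "(tdom U W, tchart \<phi> e) \<in> total_space M V" "p \<in> tdom U W"
        by (rule total_pointE)
      show "integrable_at (total_space M V) (semi_flat M V D J) p"
        unfolding *(6) integrable_at_data(2)[OF *(1,4,2,5,3)] using r * by blast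
    qed
  qed
  finally show ?thesis .
qed

end

section \<open>Frames and local data of the mirror\<close>

lemma dual_smooth_bundle: "smooth_bundle M (dual_bundle V)"
  by (rule bundleI[OF vector_bundle_dual])

abbreviation "dual_mixed_frame U \<phi> e \<equiv>
  double_frame (sum_bundle (dual_bundle V) (tangent_bundle M)) (base_frame M U \<phi> (dual_frame V e))"

text \<open>In a frame and its dual frames the evaluation map from \<open>V\<close> to its bidual is
  the identity on components, so the interchange becomes \<open>dswap\<close>.\<close>

lemma mirror_swap_frame:
  assumes c: "(U, \<phi>) \<in> M" "x \<in> U" and t: "(W, e) \<in> triv V" "x \<in> W"
  shows "mirror_swap M V x (mixed_frame U \<phi> e x z) = dual_mixed_frame U \<phi> e x (dswap z)"
proof -
  interpret Vd: smooth_bundle M "dual_bundle V"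
    by (rule dual_smooth_bundle)
  interpret S: smooth_bundle M "sum_bundle V (tangent_bundle M)"
    by (rule sum_tangent)
  interpret Sd: smooth_bundle M "sum_bundle (dual_bundle V) (tangent_bundle M)"
    by (rule Vd.sum_tangent)
  have td: "(W, dual_frame V e) \<in> triv (dual_bundle V)"
    using t(1) by (auto simp: triv_dual_bundle)
  have x: "x \<in> W \<inter> U" using c t by blast
  let ?\<phi> = "dual_frame (sum_bundle V (tangent_bundle M)) (base_frame M U \<phi> e) x (snd z)"
  let ?\<psi> = "dual_frame (sum_bundle (dual_bundle V) (tangent_bundle M)) (base_frame M U \<phi> (dual_frame V e)) x (vc z, tc z)"
  have \<phi>: "?\<phi> (e x a, dir_deriv M (U, \<phi>) x h) = fc z \<bullet> a + tc z \<bullet> h" for a h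
    using S.dual_frame_apply[OF triv_base_frame[OF c(1) t(1)] x, of "snd z" "(a, h)"]
    by (simp add: base_frame_def components inner_prod_def)
  have \<psi>: "?\<psi> (dual_frame V e x a, dir_deriv M (U, \<phi>) x h) = vc z \<bullet> a + tc z \<bullet> h" for a h
    using Sd.dual_frame_apply[OF Vd.triv_base_frame[OF c(1) td] x, of "(vc z, tc z)" "(a, h)"]
    by (simp add: base_frame_def inner_prod_def)
  \<comment> \<open>The restrictions of a functional are its values at \<open>(u, 0)\<close> and
    \<open>(0, t)\<close>; these zeros have to be written as frame vectors before the frame formulas
    apply.\<close>
  have z0: "e x 0 = 0" "dir_deriv M (U, \<phi>) x 0 = 0"
    using linear_0[OF triv_linear[OF t]] linear_0[OF dir_deriv_linear[OF c]] by auto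
  have "?\<phi> (u, 0) = dual_frame V e x (fc z) u" for u
  proof (cases "u \<in> fib V x")
    case True
    then obtain a where "u = e x a"
      using triv_range[OF t] by blast
    then show ?thesis
      using \<phi>[of a 0] t by (simp add: z0)
  qed (simp add: dual_frame_def fib_sum_bundle)
  moreover have "functional_sum (dual_space (fib V x)) (tangent_space M x)
      (\<lambda>f. if f \<in> dual_space (fib V x) then f (e x (vc z)) else 0) (\<lambda>t'. ?\<phi> (0, t')) = ?\<psi>" (is "?l = _")
  proof
    fix y :: "('v \<Rightarrow> real) \<times> 'a tvec"
    show "?l y = ?\<psi> y"
    proof (cases "y \<in> dual_space (fib V x) \<times> tangent_space M x")
      case True
      then obtain a h where y: "y = (dual_frame V e x a, dir_deriv M (U, \<phi>) x h)"
        using dual_frame_range[OF t] tangent_space_range[OF c] by blast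
      then show ?thesis
        using True \<phi>[of 0 h] t by (simp add: functional_sum_def \<psi> z0 inner_commute)
    next
      case False
      then show ?thesis
        by (cases y) (auto simp: functional_sum_def dual_frame_def fib_sum_bundle fib_dual_bundle)
    qed
  qed
  moreover have "base_frame M U \<phi> e x (fst z) = (e x (vc z), dir_deriv M (U, \<phi>) x (tm z))"
    "base_frame M U \<phi> (dual_frame V e) x (fst (dswap z)) =
      (dual_frame V e x (fc z), dir_deriv M (U, \<phi>) x (tm z))"
    "snd (dswap z) = (vc z, tc z)"
    by (simp_all add: base_frame_def dswap_def components map_prod_def case_prod_beta)
  ultimately show ?thesis
    by (simp add: mirror_swap_def double_frame_apply)
qed

text \<open>The swap is injective on the fibre, so \<open>inv_into\<close> can be computed from
  \<open>dswap\<close>, which is its own inverse.\<close>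

lemma mirror_frame:
  assumes c: "(U, \<phi>) \<in> M" "x \<in> U" and t: "(W, e) \<in> triv V" "x \<in> W"
    and J: "\<And>v. J x (mixed_frame U \<phi> e x v) = mixed_frame U \<phi> e x (k v)"
  shows "mirror M V J x (dual_mixed_frame U \<phi> e x v) = dual_mixed_frame U \<phi> e x (dswap (k (dswap v)))"
proof -
  interpret Vd: smooth_bundle M "dual_bundle V"
    by (rule dual_smooth_bundle)
  interpret S: smooth_bundle M "sum_bundle V (tangent_bundle M)"
    by (rule sum_tangent)
  interpret Sd: smooth_bundle M "sum_bundle (dual_bundle V) (tangent_bundle M)"
    by (rule Vd.sum_tangent)
  interpret SD: smooth_bundle M "double_bundle (sum_bundle V (tangent_bundle M))"
    by (rule S.double_bundle)
  interpret SdD: smooth_bundle M "double_bundle (sum_bundle (dual_bundle V) (tangent_bundle M))"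
    by (rule Sd.double_bundle)
  have td: "(W, dual_frame V e) \<in> triv (dual_bundle V)"
    using t(1) by (auto simp: triv_dual_bundle)
  have x: "x \<in> W \<inter> U" using c t by blast
  let ?E = "fib (double_bundle (sum_bundle V (tangent_bundle M))) x"
  have E: "?E = range (mixed_frame U \<phi> e x)"
    using SD.triv_range[OF S.triv_double[OF triv_base_frame[OF c(1) t(1)]] x] by simp
  have "inj (dual_mixed_frame U \<phi> e x)"
    using SdD.triv_inj[OF Sd.triv_double[OF Vd.triv_base_frame[OF c(1) td]] x] .
  then have "inj_on (mirror_swap M V x) ?E"
    unfolding E
  proof (intro inj_onI)
    fix a b assume "a \<in> range (mixed_frame U \<phi> e x)" "b \<in> range (mixed_frame U \<phi> e x)"
      and eq: "mirror_swap M V x a = mirror_swap M V x b"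
    then obtain u v where uv: "a = mixed_frame U \<phi> e x u" "b = mixed_frame U \<phi> e x v"
      by blast
    have "dswap u = dswap v"
      using eq \<open>inj (dual_mixed_frame U \<phi> e x)\<close> unfolding uv mirror_swap_frame[OF c t] by (simp add: inj_eq)
    then show "a = b"
      unfolding uv by (metis dswap_twice)
  qed
  moreover have "mirror_swap M V x (mixed_frame U \<phi> e x (dswap v)) = dual_mixed_frame U \<phi> e x v"
    by (simp add: mirror_swap_frame[OF c t])
  ultimately have "inv_into ?E (mirror_swap M V x) (dual_mixed_frame U \<phi> e x v) = mixed_frame U \<phi> e x (dswap v)"
    using E by (metis inv_into_f_f rangeI)
  then show ?thesis
    by (simp add: mirror_def J mirror_swap_frame[OF c t])
qed

lemma mirror_data:
  assumes c: "(U, \<phi>) \<in> M" and t: "(W, e) \<in> triv V" and AK: "semi_flat_data D J U \<phi> W e A K"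
  shows "smooth_bundle.semi_flat_data M (dual_bundle V) (dual_connection M V D) (mirror M V J) U \<phi> W (dual_frame V e)
    (dual_form A) (\<lambda>y z. dswap (K y (dswap z)))"
proof -
  interpret Vd: smooth_bundle M "dual_bundle V"
    by (rule dual_smooth_bundle)
  show ?thesis
    unfolding Vd.semi_flat_data_def
  proof (intro allI impI conjI)
    fix x v assume x: "x \<in> U" "x \<in> W"
    have *: "conn_form M D U \<phi> e A x" "acs_coords K (\<phi> x)"
      "\<And>v. J x (mixed_frame U \<phi> e x v) = mixed_frame U \<phi> e x (K (\<phi> x) v)"
      using AK x unfolding semi_flat_data_def by blast+
    show "conn_form M (dual_connection M V D) U \<phi> (dual_frame V e) (dual_form A) x"
      by (rule conn_form_dual[OF c t x *(1)])
    show "acs_coords (\<lambda>y z. dswap (K y (dswap z))) (\<phi> x)"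
      by (rule acs_coords_swap[OF *(2)])
    show "mirror M V J x (dual_mixed_frame U \<phi> e x v) = dual_mixed_frame U \<phi> e x (dswap (K (\<phi> x) (dswap v)))"
      by (rule mirror_frame[of U \<phi> x W e J "K (\<phi> x)", OF c x(1) t x(2) *(3)])
  qed
qed

end

theorem corollary7p4:
  fixes M :: "('m, real ^ 'n) atlas"
    and V :: "('m, 'v::real_vector, real ^ 'n) vbundle"
    and D :: "('m, 'v) conn"
    and J :: "'m \<Rightarrow> ('m, 'v) mixed \<Rightarrow> ('m, 'v) mixed"
  assumes "smooth_manifold M"
    and "vector_bundle M V"
    and "connection M V D" and "flat M V D"
    and "generalized_acs M (sum_bundle V (tangent_bundle M)) J"
    and "adapted M V J"
  shows "integrable_gacs (total_space M V) (semi_flat M V D J) \<longleftrightarrow>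
         integrable_gacs (total_space M (dual_bundle V))
           (semi_flat M (dual_bundle V) (dual_connection M V D) (mirror M V J))"
proof -
  interpret smooth_bundle M V
    using assms(1,2) by unfold_locales (auto simp: smooth_manifold_def)
  interpret Vd: smooth_bundle M "dual_bundle V"
    by (rule dual_smooth_bundle)
  have data: "\<forall>U \<phi> W e. (U, \<phi>) \<in> M \<longrightarrow> (W, e) \<in> triv V \<longrightarrow> (\<exists>A K. semi_flat_data D J U \<phi> W e A K)"
    using semi_flat_dataI[OF assms(3,4,5)] by blast
  let ?Dd = "dual_connection M V D" and ?Jd = "mirror M V J"
  have data': "\<forall>U \<phi> W d. (U, \<phi>) \<in> M \<longrightarrow> (W, d) \<in> triv (dual_bundle V) \<longrightarrow>
      (\<exists>A K. Vd.semi_flat_data ?Dd ?Jd U \<phi> W d A K)"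
  proof (intro allI impI)
    fix U \<phi> W d assume c: "(U, \<phi>) \<in> M" and d: "(W, d) \<in> triv (dual_bundle V)"
    \<comment> \<open>Trivializations of the dual bundle are dual frames by construction, so their
      data come from data of \<open>V\<close>.\<close>
    obtain e where e: "(W, e) \<in> triv V" "d = dual_frame V e"
      using d by (auto simp: triv_dual_bundle)
    then show "\<exists>A K. Vd.semi_flat_data ?Dd ?Jd U \<phi> W d A K"
      using data[rule_format, OF c e(1)] mirror_data[OF c e(1)] by blast
  qed
  \<comment> \<open>\<open>dswap\<close> is an involution, so the swapped vectors again range over
    everything.\<close>
  have key: "(\<forall>a b c. nijenhuis_form (dual_form A) (\<lambda>y z. dswap (K y (dswap z))) (\<phi> x) a b c = 0) \<longleftrightarrow>
      (\<forall>a b c. nijenhuis_form A K (\<phi> x) a b c = 0)"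
    if "semi_flat_data D J U \<phi> W e A K" "x \<in> U" "x \<in> W" for U \<phi> W e A K x
  proof -
    have "conn_coords A (\<phi> x)" "acs_coords K (\<phi> x)"
      using that unfolding semi_flat_data_def conn_form_def by blast+
    from nijenhuis_form_dual[OF this] show ?thesis
      by (metis dswap_twice)
  qed
  note L = integrable_semi_flat[OF data] and R = Vd.integrable_semi_flat[OF data']
  show ?thesis
  proof
    assume "integrable_gacs (total_space M V) (semi_flat M V D J)"
    note l = this[unfolded L, rule_format]
    show "integrable_gacs (total_space M (dual_bundle V)) (semi_flat M (dual_bundle V) ?Dd ?Jd)"
      unfolding R
    proof (intro allI impI)
      fix U \<phi> W d A K x a b c
      assume c: "(U, \<phi>) \<in> M" and d: "(W, d) \<in> triv (dual_bundle V)" and AK: "Vd.semi_flat_data ?Dd ?Jd U \<phi> W d A K"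
        and x: "x \<in> U" "x \<in> W"
      obtain e where e: "(W, e) \<in> triv V" "d = dual_frame V e"
        using d by (auto simp: triv_dual_bundle)
      obtain A' K' where AK': "semi_flat_data D J U \<phi> W e A' K'"
        using data[rule_format, OF c e(1)] by blast
      have "\<forall>a b c. nijenhuis_form (dual_form A') (\<lambda>y z. dswap (K' y (dswap z))) (\<phi> x) a b c = 0"
        unfolding key[OF AK' x] using l[OF c e(1) AK' x] by blast
      \<comment> \<open>The given \<open>A\<close> and \<open>K\<close> need not be the dual form
        and the swapped matrix. \<open>integrable_at\<close> does not refer to local data and
        carries the condition from one choice to the other.\<close>
      then have "integrable_at (total_space M (dual_bundle V)) (semi_flat M (dual_bundle V) ?Dd ?Jd) (x, d x 0)"
        using Vd.integrable_at_data(2)[OF data' c x(1) d x(2) mirror_data[OF c e(1) AK', folded e(2)]] by blast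
      then show "nijenhuis_form A K (\<phi> x) a b c = 0"
        using Vd.integrable_at_data(2)[OF data' c x(1) d x(2) AK] by blast
    qed
  next
    assume "integrable_gacs (total_space M (dual_bundle V)) (semi_flat M (dual_bundle V) ?Dd ?Jd)"
    note r = this[unfolded R, rule_format]
    show "integrable_gacs (total_space M V) (semi_flat M V D J)"
      unfolding L
    proof (intro allI impI)
      fix U \<phi> W e A K x a b c
      assume c: "(U, \<phi>) \<in> M" and t: "(W, e) \<in> triv V" and AK: "semi_flat_data D J U \<phi> W e A K"
        and x: "x \<in> U" "x \<in> W"
      have "(W, dual_frame V e) \<in> triv (dual_bundle V)"
        using t by (auto simp: triv_dual_bundle)
      then have "\<forall>a b c. nijenhuis_form (dual_form A) (\<lambda>y z. dswap (K y (dswap z))) (\<phi> x) a b c = 0"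
        using r[OF c _ mirror_data[OF c t AK] x] by blast
      then show "nijenhuis_form A K (\<phi> x) a b c = 0"
        unfolding key[OF AK x] by blast
    qed
  qed
qed

end
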